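(* Let $d\geq 3$. The homogeneous prime ideal $\mathcal{I}(\mathcal{M}^{\Gamma}_d)\subseteq\mathbb{C}[m_0,\ldots,m_d]$ of the $d$th gamma moment variety $\mathcal{M}^{\Gamma}_d\subseteq\mathbb{P}^d$ is generated by the $\binom{d}{3}$ cubics given by the maximal minors of the $(3\times d)$-matrix $$H_d^{\Gamma}=\begin{pmatrix} 0 & m_1 & 2m_2 & 3m_3&\cdots& (d-1)m_{d-1}\\ m_0 & m_1 & m_2 & m_3 &\cdots& m_{d-1}\\ m_1 & m_2 & m_3 &m_4 & \cdots& m_d \end{pmatrix}.$$ Furthermore, $\mathcal{M}^{\Gamma}_d$ is Cohen--Macaulay.
   Context: The moments of the gamma distribution with shape parameter $k$ and scale parameter $\theta$ are $m_0=1$ and $m_i=\theta^i\prod_{j=0}^{i-1}(k+j)$ for $i\ge 1$. The gamma moment variety $\mathcal{M}^{\Gamma}_d\subseteq\mathbb{P}^d$ is the Zariski closure of the image of the map $\mathbb{C}^2\to\mathbb{P}^d$, $(k,\theta)\mapsto[m_0(k,\theta):m_1(k,\theta):\cdots:m_d(k,\theta)]$ (complex projective space with homogeneous coordinates $m_0,\dots,m_d$). $\mathcal{I}(V)$ denotes the homogeneous vanishing ideal of a projective variety $V$. A projective variety $V\subseteq\mathbb{P}^d$ is called Cohen--Macaulay if its homogeneous coordinate ring $\mathbb{C}[m_0,\ldots,m_d]/\mathcal{I}(V)$ is a Cohen--Macaulay ring. *)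

theory Defs
  imports
    Complex_Main
    "HOL-Library.Poly_Mapping"
    "HOL-Library.Extended_Nat"
    "HOL-Algebra.QuotRing"
    "HOL-Algebra.Ring_Divisibility"
    "Jordan_Normal_Form.Determinant"
    "Jordan_Normal_Form.DL_Submatrix"
begin

section \<open>The polynomial ring in finitely many variables\<close>

text \<open>A polynomial maps finitely many monomials to nonzero coefficients, and a monomial maps
  finitely many variable indices to positive exponents.\<close>

type_synonym cpoly = "(nat \<Rightarrow>\<^sub>0 nat) \<Rightarrow>\<^sub>0 complex"

definition var :: "nat \<Rightarrow> cpoly" where
  "var i = Poly_Mapping.single (Poly_Mapping.single i 1) 1"

definition eval_cpoly :: "cpoly \<Rightarrow> (nat \<Rightarrow> complex) \<Rightarrow> complex" where
  "eval_cpoly f v = (\<Sum>a\<in>Poly_Mapping.keys f.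
     Poly_Mapping.lookup f a * (\<Prod>i\<in>Poly_Mapping.keys a. v i ^ Poly_Mapping.lookup a i))"

definition homogeneous :: "nat \<Rightarrow> cpoly \<Rightarrow> bool" where
  "homogeneous n f \<longleftrightarrow> (\<forall>a\<in>Poly_Mapping.keys f.
     (\<Sum>i\<in>Poly_Mapping.keys a. Poly_Mapping.lookup a i) = n)"

text \<open>The ring of polynomials in the \<open>d + 1\<close> variables with indices \<open>0, \<dots>, d\<close>.\<close>

definition poly_ring :: "nat \<Rightarrow> cpoly ring" where
  "poly_ring d = \<lparr>carrier = {f. \<forall>a\<in>Poly_Mapping.keys f. Poly_Mapping.keys a \<subseteq> {..d}},
     mult = (*), one = 1, zero = 0, add = (+)\<rparr>"


section \<open>Projective varieties\<close>

text \<open>Points of \<open>d\<close>-dimensional projective space are lines through the origin with the origin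
  removed.  A coordinate vector is a function that vanishes beyond index \<open>d\<close>.\<close>

definition proj_point :: "(nat \<Rightarrow> complex) \<Rightarrow> (nat \<Rightarrow> complex) set" where
  "proj_point v = {\<lambda>i. c * v i |c. c \<noteq> 0}"

definition proj_space :: "nat \<Rightarrow> (nat \<Rightarrow> complex) set set" where
  "proj_space d = proj_point ` {v. v \<noteq> (\<lambda>_. 0) \<and> (\<forall>i>d. v i = 0)}"

definition homogeneous_polys :: "nat \<Rightarrow> cpoly set" where
  "homogeneous_polys d = {f \<in> carrier (poly_ring d). \<exists>n. homogeneous n f}"

definition vanishes_at :: "cpoly \<Rightarrow> (nat \<Rightarrow> complex) set \<Rightarrow> bool" where
  "vanishes_at f p \<longleftrightarrow> (\<forall>v\<in>p. eval_cpoly f v = 0)"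

definition zariski_closed :: "nat \<Rightarrow> (nat \<Rightarrow> complex) set set \<Rightarrow> bool" where
  "zariski_closed d V \<longleftrightarrow> (\<exists>F \<subseteq> homogeneous_polys d.
     V = {p \<in> proj_space d. \<forall>f\<in>F. vanishes_at f p})"

definition zariski_closure :: "nat \<Rightarrow> (nat \<Rightarrow> complex) set set \<Rightarrow> (nat \<Rightarrow> complex) set set" where
  "zariski_closure d S = zariski_closed d hull S"

definition vanishing_ideal :: "nat \<Rightarrow> (nat \<Rightarrow> complex) set set \<Rightarrow> cpoly set" where
  "vanishing_ideal d V =
     Idl\<^bsub>poly_ring d\<^esub> {f \<in> homogeneous_polys d. \<forall>p\<in>V. vanishes_at f p}"


section \<open>Cohen--Macaulay rings\<close>

text \<open>\<open>fraction R S r s\<close> is the fraction \<open>r / s\<close>, i.e. the class of all pairs \<open>(r', s')\<close> such that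
  \<open>t (r' s - r s') = 0\<close> for some \<open>t \<in> S\<close>.\<close>

definition fraction :: "('a, 'm) ring_scheme \<Rightarrow> 'a set \<Rightarrow> 'a \<Rightarrow> 'a \<Rightarrow> ('a \<times> 'a) set" where
  "fraction R S r s = {(r', s'). r' \<in> carrier R \<and> s' \<in> S \<and>
     (\<exists>t\<in>S. t \<otimes>\<^bsub>R\<^esub> (r' \<otimes>\<^bsub>R\<^esub> s \<ominus>\<^bsub>R\<^esub> r \<otimes>\<^bsub>R\<^esub> s') = \<zero>\<^bsub>R\<^esub>)}"

text \<open>The ring of fractions with denominators in \<open>S\<close>, for \<open>S\<close> a submonoid of \<open>carrier R\<close>.  All
  members of each of the two unions below are the same class (see \<open>fraction_mult\<close> and \<open>fraction_add\<close>).\<close>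

definition localization :: "('a, 'm) ring_scheme \<Rightarrow> 'a set \<Rightarrow> ('a \<times> 'a) set ring" where
  "localization R S =
     \<lparr>carrier = {fraction R S r s |r s. r \<in> carrier R \<and> s \<in> S},
      mult = (\<lambda>X Y. \<Union>(r, s)\<in>X. \<Union>(r', s')\<in>Y. fraction R S (r \<otimes>\<^bsub>R\<^esub> r') (s \<otimes>\<^bsub>R\<^esub> s')),
      one = fraction R S \<one>\<^bsub>R\<^esub> \<one>\<^bsub>R\<^esub>,
      zero = fraction R S \<zero>\<^bsub>R\<^esub> \<one>\<^bsub>R\<^esub>,
      add = (\<lambda>X Y. \<Union>(r, s)\<in>X. \<Union>(r', s')\<in>Y.
        fraction R S (r \<otimes>\<^bsub>R\<^esub> s' \<oplus>\<^bsub>R\<^esub> r' \<otimes>\<^bsub>R\<^esub> s) (s \<otimes>\<^bsub>R\<^esub> s'))\<rparr>"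

text \<open>The supremum of the lengths of chains of prime ideals; it is only used for nonzero rings (for
  the zero ring this definition gives 0).\<close>

definition krull_dim :: "('a, 'm) ring_scheme \<Rightarrow> enat" where
  "krull_dim R = Sup {enat n |n. \<exists>P :: nat \<Rightarrow> 'a set.
     (\<forall>i\<le>n. primeideal (P i) R) \<and> (\<forall>i<n. P i \<subset> P (Suc i))}"

text \<open>Each \<open>xs ! i\<close> is a nonzerodivisor modulo its predecessors, and the quotient by all of them is
  nonzero.\<close>

definition regular_sequence :: "('a, 'm) ring_scheme \<Rightarrow> 'a list \<Rightarrow> bool" where
  "regular_sequence R xs \<longleftrightarrow> set xs \<subseteq> carrier R \<and>
     (\<forall>i<length xs. \<forall>r\<in>carrier R.
        r \<otimes>\<^bsub>R\<^esub> xs ! i \<in> Idl\<^bsub>R\<^esub> (set (take i xs)) \<longrightarrow> r \<in> Idl\<^bsub>R\<^esub> (set (take i xs))) \<and>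
     Idl\<^bsub>R\<^esub> (set xs) \<noteq> carrier R"

definition depth :: "('a, 'm) ring_scheme \<Rightarrow> 'a set \<Rightarrow> enat" where
  "depth R M = Sup {enat (length xs) |xs. regular_sequence R xs \<and> set xs \<subseteq> M}"

definition cohen_macaulay_local_ring :: "('a, 'm) ring_scheme \<Rightarrow> bool" where
  "cohen_macaulay_local_ring R \<longleftrightarrow> cring R \<and> noetherian_ring R \<and>
     (\<exists>M. {N. maximalideal N R} = {M} \<and> depth R M = krull_dim R)"

definition cohen_macaulay_ring :: "('a, 'm) ring_scheme \<Rightarrow> bool" where
  "cohen_macaulay_ring R \<longleftrightarrow> cring R \<and> noetherian_ring R \<and>
     (\<forall>M. maximalideal M R \<longrightarrow> cohen_macaulay_local_ring (localization R (carrier R - M)))"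

definition cohen_macaulay_variety :: "nat \<Rightarrow> (nat \<Rightarrow> complex) set set \<Rightarrow> bool" where
  "cohen_macaulay_variety d V \<longleftrightarrow> cohen_macaulay_ring (poly_ring d Quot vanishing_ideal d V)"


section \<open>The gamma moment variety and its matrix\<close>

definition gamma_moment :: "complex \<Rightarrow> complex \<Rightarrow> nat \<Rightarrow> complex" where
  "gamma_moment k \<theta> i = \<theta> ^ i * (\<Prod>j<i. k + of_nat j)"

definition gamma_moment_point :: "nat \<Rightarrow> complex \<Rightarrow> complex \<Rightarrow> (nat \<Rightarrow> complex) set" where
  "gamma_moment_point d k \<theta> = proj_point (\<lambda>i. if i \<le> d then gamma_moment k \<theta> i else 0)"

definition gamma_moment_variety :: "nat \<Rightarrow> (nat \<Rightarrow> complex) set set" where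
  "gamma_moment_variety d = zariski_closure d {gamma_moment_point d k \<theta> |k \<theta>. True}"

definition gamma_matrix :: "nat \<Rightarrow> cpoly mat" where
  "gamma_matrix d = mat 3 d (\<lambda>(i, j).
     if i = 0 then of_nat j * var j else if i = 1 then var j else var (j + 1))"

text \<open>The minors of maximal order of a matrix with at least as many columns as rows.\<close>

definition maximal_minors :: "'a::comm_ring_1 mat \<Rightarrow> 'a set" where
  "maximal_minors A =
     {det (submatrix A UNIV J) |J. J \<subseteq> {..<dim_col A} \<and> card J = dim_row A}"


section \<open>Well-definedness\<close>

lemma poly_ring_simps [simp]:
  "mult (poly_ring d) = (*)" "one (poly_ring d) = 1"
  "zero (poly_ring d) = 0" "add (poly_ring d) = (+)"
  by (simp_all add: poly_ring_def)

lemma carrier_poly_ring: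
  "f \<in> carrier (poly_ring d) \<longleftrightarrow> (\<forall>a\<in>Poly_Mapping.keys f. Poly_Mapping.keys a \<subseteq> {..d})"
  by (simp add: poly_ring_def)

lemma cring_poly_ring: "cring (poly_ring d)"
proof -
  have mult: "f * g \<in> carrier (poly_ring d)"
    if "f \<in> carrier (poly_ring d)" "g \<in> carrier (poly_ring d)" for f g
    unfolding carrier_poly_ring
  proof
    fix a assume "a \<in> Poly_Mapping.keys (f * g)"
    then obtain b c where "a = b + c" "b \<in> Poly_Mapping.keys f" "c \<in> Poly_Mapping.keys g"
      using keys_mult[of f g] by blast
    then show "Poly_Mapping.keys a \<subseteq> {..d}"
      using that Poly_Mapping.keys_add[of b c] unfolding carrier_poly_ring by blast
  qed
  have add: "f + g \<in> carrier (poly_ring d)"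
    if "f \<in> carrier (poly_ring d)" "g \<in> carrier (poly_ring d)" for f g
    using that Poly_Mapping.keys_add[of f g] unfolding carrier_poly_ring by blast
  have uminus: "\<exists>g\<in>carrier (poly_ring d). f + g = 0" if "f \<in> carrier (poly_ring d)" for f
    using that by (intro bexI[of _ "- f"]) (simp_all add: carrier_poly_ring)
  have zero_one: "0 \<in> carrier (poly_ring d)" "1 \<in> carrier (poly_ring d)"
    by (simp_all add: carrier_poly_ring)
  have "abelian_group (poly_ring d)"
    by (rule abelian_groupI) (simp_all add: add uminus zero_one ac_simps)
  moreover have "Group.comm_monoid (poly_ring d)"
    by (rule comm_monoidI) (simp_all add: mult zero_one ac_simps)
  ultimately show ?thesis
    by (rule cringI) (simp add: distrib_right)
qed

lemma UN_UN_const: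
  assumes "(a, b) \<in> X" "(a', b') \<in> Y"
    and eq: "\<And>r s r' s'. (r, s) \<in> X \<Longrightarrow> (r', s') \<in> Y \<Longrightarrow> f r s r' s' = Z"
  shows "(\<Union>(r, s)\<in>X. \<Union>(r', s')\<in>Y. f r s r' s') = Z"
proof -
  have "(\<Union>(r, s)\<in>X. \<Union>(r', s')\<in>Y. f r s r' s') = (\<Union>p\<in>X. \<Union>q\<in>Y. Z)"
    using eq by (intro SUP_cong refl) auto
  also have "\<dots> = Z"
    using assms(1,2) by blast
  finally show ?thesis .
qed

context
  fixes R :: "('a, 'm) ring_scheme" (structure) and S :: "'a set"
  assumes R: "cring R" and S: "submonoid S R"
begin

interpretation cring R by (fact R)
interpretation S: submonoid S R by (fact S)

lemma denominator_closed: "s \<in> S \<Longrightarrow> s \<in> carrier R"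
  using S.subset by blast

lemma mem_fraction_iff:
  assumes "r \<in> carrier R" "s \<in> S"
  shows "(r', s') \<in> fraction R S r s \<longleftrightarrow>
    r' \<in> carrier R \<and> s' \<in> S \<and> (\<exists>t\<in>S. t \<otimes> (r' \<otimes> s) = t \<otimes> (r \<otimes> s'))"
proof -
  have "t \<otimes> (r' \<otimes> s \<ominus> r \<otimes> s') = \<zero> \<longleftrightarrow> t \<otimes> (r' \<otimes> s) = t \<otimes> (r \<otimes> s')"
    if "r' \<in> carrier R" "s' \<in> S" "t \<in> S" for t
  proof -
    have "t \<otimes> (r' \<otimes> s \<ominus> r \<otimes> s') = t \<otimes> (r' \<otimes> s) \<ominus> t \<otimes> (r \<otimes> s')"
      using assms that by (simp add: denominator_closed minus_eq r_distr r_minus)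
    then show ?thesis
      using assms that r_right_minus_eq by (simp add: denominator_closed)
  qed
  then show ?thesis
    unfolding fraction_def by auto
qed

lemma fraction_subset:
  assumes rs: "r \<in> carrier R" "s \<in> S" and rs': "r' \<in> carrier R" "s' \<in> S"
    and t: "t \<in> S" "t \<otimes> (r' \<otimes> s) = t \<otimes> (r \<otimes> s')"
  shows "fraction R S r s \<subseteq> fraction R S r' s'"
proof (rule subrelI)
  fix a b assume "(a, b) \<in> fraction R S r s"
  then obtain u where a: "a \<in> carrier R" "b \<in> S" "u \<in> S" "u \<otimes> (a \<otimes> s) = u \<otimes> (r \<otimes> b)"
    using rs by (auto simp: mem_fraction_iff)
  note closed = rs rs' t(1) a(1-3) denominator_closed
  have "(u \<otimes> t \<otimes> s) \<otimes> (a \<otimes> s') = t \<otimes> s' \<otimes> (u \<otimes> (a \<otimes> s))"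
    using closed by (simp add: m_ac)
  also have "\<dots> = u \<otimes> b \<otimes> (t \<otimes> (r \<otimes> s'))"
    unfolding a(4) using closed by (simp add: m_ac)
  also have "\<dots> = (u \<otimes> t \<otimes> s) \<otimes> (r' \<otimes> b)"
    unfolding t(2)[symmetric] using closed by (simp add: m_ac)
  finally show "(a, b) \<in> fraction R S r' s'"
    using rs' a rs t by (auto simp: mem_fraction_iff intro!: bexI[of _ "u \<otimes> t \<otimes> s"])
qed

lemma fraction_eqI:
  assumes "r \<in> carrier R" "s \<in> S" "r' \<in> carrier R" "s' \<in> S"
    and "t \<in> S" "t \<otimes> (r' \<otimes> s) = t \<otimes> (r \<otimes> s')"
  shows "fraction R S r s = fraction R S r' s'"
  using assms fraction_subset[of r s r' s' t] fraction_subset[of r' s' r s t] by auto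

lemma fraction_eqI':
  assumes "r \<in> carrier R" "s \<in> S" "r' \<in> carrier R" "s' \<in> S" "r' \<otimes> s = r \<otimes> s'"
  shows "fraction R S r s = fraction R S r' s'"
  using assms by (intro fraction_eqI[of _ _ _ _ \<one>]) auto

lemma fraction_self: "r \<in> carrier R \<Longrightarrow> s \<in> S \<Longrightarrow> (r, s) \<in> fraction R S r s"
  by (auto simp: mem_fraction_iff intro!: bexI[of _ \<one>])

lemma fraction_mult:
  assumes rs: "r \<in> carrier R" "s \<in> S" and rs': "r' \<in> carrier R" "s' \<in> S"
  shows "fraction R S r s \<otimes>\<^bsub>localization R S\<^esub> fraction R S r' s' = fraction R S (r \<otimes> r') (s \<otimes> s')"
proof -
  have "fraction R S (a \<otimes> a') (b \<otimes> b') = fraction R S (r \<otimes> r') (s \<otimes> s')"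
    if ab: "(a, b) \<in> fraction R S r s" "(a', b') \<in> fraction R S r' s'" for a b a' b'
  proof -
    obtain t where a: "a \<in> carrier R" "b \<in> S" "t \<in> S" "t \<otimes> (a \<otimes> s) = t \<otimes> (r \<otimes> b)"
      using ab(1) rs by (auto simp: mem_fraction_iff)
    obtain t' where a': "a' \<in> carrier R" "b' \<in> S" "t' \<in> S" "t' \<otimes> (a' \<otimes> s') = t' \<otimes> (r' \<otimes> b')"
      using ab(2) rs' by (auto simp: mem_fraction_iff)
    note closed = rs rs' a(1-3) a'(1-3) denominator_closed
    have "(t \<otimes> t') \<otimes> ((r \<otimes> r') \<otimes> (b \<otimes> b')) = (t \<otimes> (r \<otimes> b)) \<otimes> (t' \<otimes> (r' \<otimes> b'))"
      using closed by (simp add: m_ac)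
    also have "\<dots> = (t \<otimes> t') \<otimes> ((a \<otimes> a') \<otimes> (s \<otimes> s'))"
      unfolding a(4)[symmetric] a'(4)[symmetric] using closed by (simp add: m_ac)
    finally show ?thesis
      using closed by (intro fraction_eqI[of _ _ _ _ "t \<otimes> t'"]) auto
  qed
  note const = this
  have "fraction R S r s \<otimes>\<^bsub>localization R S\<^esub> fraction R S r' s'
    = (\<Union>(a, b)\<in>fraction R S r s. \<Union>(a', b')\<in>fraction R S r' s'. fraction R S (a \<otimes> a') (b \<otimes> b'))"
    by (simp add: localization_def)
  also have "\<dots> = fraction R S (r \<otimes> r') (s \<otimes> s')"
    by (rule UN_UN_const[OF fraction_self[OF rs] fraction_self[OF rs']]) (rule const)
  finally show ?thesis .
qed

lemma fraction_add:
  assumes rs: "r \<in> carrier R" "s \<in> S" and rs': "r' \<in> carrier R" "s' \<in> S"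
  shows "fraction R S r s \<oplus>\<^bsub>localization R S\<^esub> fraction R S r' s'
    = fraction R S (r \<otimes> s' \<oplus> r' \<otimes> s) (s \<otimes> s')"
proof -
  have "fraction R S (a \<otimes> b' \<oplus> a' \<otimes> b) (b \<otimes> b') = fraction R S (r \<otimes> s' \<oplus> r' \<otimes> s) (s \<otimes> s')"
    if ab: "(a, b) \<in> fraction R S r s" "(a', b') \<in> fraction R S r' s'" for a b a' b'
  proof -
    obtain t where a: "a \<in> carrier R" "b \<in> S" "t \<in> S" "t \<otimes> (a \<otimes> s) = t \<otimes> (r \<otimes> b)"
      using ab(1) rs by (auto simp: mem_fraction_iff)
    obtain t' where a': "a' \<in> carrier R" "b' \<in> S" "t' \<in> S" "t' \<otimes> (a' \<otimes> s') = t' \<otimes> (r' \<otimes> b')"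
      using ab(2) rs' by (auto simp: mem_fraction_iff)
    note closed = rs rs' a(1-3) a'(1-3) denominator_closed
    have "(t \<otimes> t') \<otimes> ((r \<otimes> s' \<oplus> r' \<otimes> s) \<otimes> (b \<otimes> b'))
      = (t' \<otimes> s' \<otimes> b') \<otimes> (t \<otimes> (r \<otimes> b)) \<oplus> (t \<otimes> s \<otimes> b) \<otimes> (t' \<otimes> (r' \<otimes> b'))"
      using closed by (simp add: m_ac l_distr r_distr)
    also have "\<dots> = (t \<otimes> t') \<otimes> ((a \<otimes> b' \<oplus> a' \<otimes> b) \<otimes> (s \<otimes> s'))"
      unfolding a(4)[symmetric] a'(4)[symmetric] using closed by (simp add: m_ac l_distr r_distr)
    finally show ?thesis
      using closed by (intro fraction_eqI[of _ _ _ _ "t \<otimes> t'"]) auto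
  qed
  note const = this
  have "fraction R S r s \<oplus>\<^bsub>localization R S\<^esub> fraction R S r' s'
    = (\<Union>(a, b)\<in>fraction R S r s. \<Union>(a', b')\<in>fraction R S r' s'. fraction R S (a \<otimes> b' \<oplus> a' \<otimes> b) (b \<otimes> b'))"
    by (simp add: localization_def)
  also have "\<dots> = fraction R S (r \<otimes> s' \<oplus> r' \<otimes> s) (s \<otimes> s')"
    by (rule UN_UN_const[OF fraction_self[OF rs] fraction_self[OF rs']]) (rule const)
  finally show ?thesis .
qed

lemma localization_simps:
  "x \<in> carrier (localization R S) \<longleftrightarrow> (\<exists>r\<in>carrier R. \<exists>s\<in>S. x = fraction R S r s)"
  "\<one>\<^bsub>localization R S\<^esub> = fraction R S \<one> \<one>"
  "\<zero>\<^bsub>localization R S\<^esub> = fraction R S \<zero> \<one>"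
  by (auto simp: localization_def)

lemma cring_localization: "cring (localization R S)"
proof -
  note simps = localization_simps fraction_mult fraction_add denominator_closed
  have add: "abelian_group (localization R S)"
  proof (rule abelian_groupI)
    fix x assume "x \<in> carrier (localization R S)"
    then obtain r s where x: "x = fraction R S r s" "r \<in> carrier R" "s \<in> S"
      by (auto simp: simps)
    show "\<exists>y\<in>carrier (localization R S). y \<oplus>\<^bsub>localization R S\<^esub> x = \<zero>\<^bsub>localization R S\<^esub>"
    proof
      show "fraction R S (\<ominus> r) s \<oplus>\<^bsub>localization R S\<^esub> x = \<zero>\<^bsub>localization R S\<^esub>"
        using x fraction_eqI'[of \<zero> "s \<otimes> s" \<zero> \<one>]
        by (simp add: simps l_minus l_neg S.m_closed)
      show "fraction R S (\<ominus> r) s \<in> carrier (localization R S)"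
        using x by (auto simp: simps)
    qed
  next
    fix x y assume "x \<in> carrier (localization R S)" "y \<in> carrier (localization R S)"
    then show "x \<oplus>\<^bsub>localization R S\<^esub> y \<in> carrier (localization R S)"
      unfolding localization_simps by (force simp: fraction_add denominator_closed)
  next
    fix x y z assume "x \<in> carrier (localization R S)" "y \<in> carrier (localization R S)"
      "z \<in> carrier (localization R S)"
    then show "x \<oplus>\<^bsub>localization R S\<^esub> y \<oplus>\<^bsub>localization R S\<^esub> z
      = x \<oplus>\<^bsub>localization R S\<^esub> (y \<oplus>\<^bsub>localization R S\<^esub> z)"
      unfolding localization_simps
      by (auto simp: fraction_add denominator_closed l_distr r_distr m_ac a_ac)
  next
    fix x y assume "x \<in> carrier (localization R S)" "y \<in> carrier (localization R S)"
    then show "x \<oplus>\<^bsub>localization R S\<^esub> y = y \<oplus>\<^bsub>localization R S\<^esub> x"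
      unfolding localization_simps by (auto simp: fraction_add denominator_closed m_ac a_ac)
  next
    fix x assume "x \<in> carrier (localization R S)"
    then show "\<zero>\<^bsub>localization R S\<^esub> \<oplus>\<^bsub>localization R S\<^esub> x = x"
      unfolding localization_simps by (auto simp: fraction_add denominator_closed)
  next
    show "\<zero>\<^bsub>localization R S\<^esub> \<in> carrier (localization R S)"
      using S.one_closed zero_closed one_closed unfolding localization_simps by blast
  qed
  have mult: "Group.comm_monoid (localization R S)"
  proof (rule comm_monoidI)
    fix x y assume "x \<in> carrier (localization R S)" "y \<in> carrier (localization R S)"
    then show "x \<otimes>\<^bsub>localization R S\<^esub> y \<in> carrier (localization R S)"
      unfolding localization_simps by (force simp: fraction_mult denominator_closed)
  next
    fix x y z assume "x \<in> carrier (localization R S)" "y \<in> carrier (localization R S)"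
      "z \<in> carrier (localization R S)"
    then show "x \<otimes>\<^bsub>localization R S\<^esub> y \<otimes>\<^bsub>localization R S\<^esub> z
      = x \<otimes>\<^bsub>localization R S\<^esub> (y \<otimes>\<^bsub>localization R S\<^esub> z)"
      unfolding localization_simps by (auto simp: fraction_mult denominator_closed m_ac)
  next
    fix x y assume "x \<in> carrier (localization R S)" "y \<in> carrier (localization R S)"
    then show "x \<otimes>\<^bsub>localization R S\<^esub> y = y \<otimes>\<^bsub>localization R S\<^esub> x"
      unfolding localization_simps by (auto simp: fraction_mult denominator_closed m_ac)
  next
    fix x assume "x \<in> carrier (localization R S)"
    then show "\<one>\<^bsub>localization R S\<^esub> \<otimes>\<^bsub>localization R S\<^esub> x = x"
      unfolding localization_simps by (auto simp: fraction_mult denominator_closed)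
  next
    show "\<one>\<^bsub>localization R S\<^esub> \<in> carrier (localization R S)"
      using S.one_closed zero_closed one_closed unfolding localization_simps by blast
  qed
  show ?thesis
  proof (rule cringI[OF add mult])
    fix x y z assume "x \<in> carrier (localization R S)" "y \<in> carrier (localization R S)"
      "z \<in> carrier (localization R S)"
    then obtain a b c p q r where
      *: "x = fraction R S a p" "y = fraction R S b q" "z = fraction R S c r"
        "a \<in> carrier R" "b \<in> carrier R" "c \<in> carrier R" "p \<in> S" "q \<in> S" "r \<in> S"
      unfolding localization_simps by blast
    then show "(x \<oplus>\<^bsub>localization R S\<^esub> y) \<otimes>\<^bsub>localization R S\<^esub> z
      = x \<otimes>\<^bsub>localization R S\<^esub> z \<oplus>\<^bsub>localization R S\<^esub> y \<otimes>\<^bsub>localization R S\<^esub> z"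
      by (simp add: fraction_mult fraction_add)
        (rule fraction_eqI', auto simp: denominator_closed l_distr r_distr m_ac)
  qed
qed

end

end

theory Submission
  imports Defs
    "HOL-Analysis.Continuum_Not_Denumerable"
    "HOL-Computational_Algebra.Fundamental_Theorem_Algebra"
begin

text \<open>
  Write \<open>L = m\<^sub>1 + \<dots> + m\<^sub>d\<^sub>-\<^sub>1\<close>.  Modulo the minors every cubic monomial in \<open>m\<^sub>1, \<dots>, m\<^sub>d\<^sub>-\<^sub>1\<close> lies in
  the ideal \<open>(m\<^sub>0, m\<^sub>d, L)\<close>, so the polynomial ring modulo the minors is generated as a module over
  \<open>\<complex>[m\<^sub>0, m\<^sub>d, L]\<close> by the monomials of degree at most 2 in \<open>m\<^sub>2, \<dots>, m\<^sub>d\<^sub>-\<^sub>1\<close>.  On the other hand, the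
  monomials \<open>m\<^sub>0\<^sup>p m\<^sub>d\<^sup>q m\<^sub>a m\<^sub>c\<^sup>n\<close> with \<open>1 \<le> a \<le> c < d\<close> are linearly independent on the variety, where
  \<open>m\<^sub>i = \<lambda> \<theta>\<^sup>i k (k + 1) \<dots> (k + i - 1)\<close>, as one sees from the zeros of these polynomials in \<open>k\<close>.  Both
  families have the same number of members in each degree.  Hence the minors generate the vanishing
  ideal, which is prime, and the coordinate ring is free over \<open>\<complex>[m\<^sub>0, m\<^sub>d, L]\<close>.

  Every maximal ideal contains \<open>m\<^sub>0 - \<alpha>, m\<^sub>d - \<beta>, L - \<gamma>\<close> for some complex numbers, by a weak
  Nullstellensatz, and freeness makes this a regular sequence.  Any four elements of the coordinate
  ring are algebraically dependent, because the part of degree at most \<open>N\<close> has dimension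
  \<open>O(N\<^sup>3)\<close>; looking at the lowest terms of an algebraic relation shows that there is no chain of five
  primes.  As the depth of a noetherian ring is at most its dimension, both are 3 in every
  localization at a maximal ideal.
\<close>


section \<open>Polynomials and their evaluation\<close>

text \<open>Independence of the family with powers of L is hard to see directly, because the values
  of a sum do not factor. The values of the family with m_a m_c^n do factor, into powers of
  \<lambda> and \<theta> and rising factorials in k, but that family does not display the module
  structure. So spanning is proved for one family and independence for the other, and the equality
  of sizes turns a dependence of the first on the variety into a dependence of the second. Degrees
  are bounded by N instead of fixed, so that this is plain linear algebra in finite-dimensional
  spaces and no grading of the quotient enters. The third parameter is a sum for the following
  reason: modulo the minors, m_0 and m_d alone leave the powers of every m_c with 0 < c < d, and L
  contains each of these m_c with coefficient 1. The number 3 is the dimension of the affine cone,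
  whose parameters are \<lambda>, \<theta> and k.\<close>

definition tdeg :: "(nat \<Rightarrow>\<^sub>0 nat) \<Rightarrow> nat" where
  "tdeg a = (\<Sum>i\<in>Poly_Mapping.keys a. Poly_Mapping.lookup a i)"

definition monomial_value :: "(nat \<Rightarrow> complex) \<Rightarrow> (nat \<Rightarrow>\<^sub>0 nat) \<Rightarrow> complex" where
  "monomial_value v a = (\<Prod>i\<in>Poly_Mapping.keys a. v i ^ Poly_Mapping.lookup a i)"

definition constp :: "complex \<Rightarrow> cpoly" where
  "constp c = Poly_Mapping.single 0 c"

lemma tdeg_superset:
  "finite A \<Longrightarrow> Poly_Mapping.keys a \<subseteq> A \<Longrightarrow> tdeg a = (\<Sum>i\<in>A. Poly_Mapping.lookup a i)"
  unfolding tdeg_def by (rule sum.mono_neutral_left) (auto simp: in_keys_iff)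

lemma tdeg_add: "tdeg (a + b) = tdeg a + tdeg b"
proof -
  let ?A = "Poly_Mapping.keys a \<union> Poly_Mapping.keys b"
  have "tdeg (a + b) = (\<Sum>i\<in>?A. Poly_Mapping.lookup (a + b) i)"
    by (rule tdeg_superset) (auto simp: Poly_Mapping.keys_add)
  moreover have "tdeg a = (\<Sum>i\<in>?A. Poly_Mapping.lookup a i)"
    and "tdeg b = (\<Sum>i\<in>?A. Poly_Mapping.lookup b i)"
    by (rule tdeg_superset; auto)+
  ultimately show ?thesis by (simp add: lookup_add sum.distrib)
qed

lemma tdeg_single [simp]: "tdeg (Poly_Mapping.single i n) = n"
  by (simp add: tdeg_def)

lemma tdeg_zero [simp]: "tdeg 0 = 0"
  by (simp add: tdeg_def)

lemma monomial_value_superset: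
  "finite A \<Longrightarrow> Poly_Mapping.keys a \<subseteq> A \<Longrightarrow>
    monomial_value v a = (\<Prod>i\<in>A. v i ^ Poly_Mapping.lookup a i)"
  unfolding monomial_value_def by (rule prod.mono_neutral_left) (auto simp: in_keys_iff)

lemma monomial_value_add: "monomial_value v (a + b) = monomial_value v a * monomial_value v b"
proof -
  let ?A = "Poly_Mapping.keys a \<union> Poly_Mapping.keys b"
  have "monomial_value v (a + b) = (\<Prod>i\<in>?A. v i ^ Poly_Mapping.lookup (a + b) i)"
    by (rule monomial_value_superset) (auto simp: Poly_Mapping.keys_add)
  moreover have "monomial_value v a = (\<Prod>i\<in>?A. v i ^ Poly_Mapping.lookup a i)"
    and "monomial_value v b = (\<Prod>i\<in>?A. v i ^ Poly_Mapping.lookup b i)"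
    by (rule monomial_value_superset; auto)+
  ultimately show ?thesis by (simp add: lookup_add power_add prod.distrib)
qed

lemma monomial_value_zero [simp]: "monomial_value v 0 = 1"
  by (simp add: monomial_value_def)

lemma eval_cpoly_superset:
  "finite A \<Longrightarrow> Poly_Mapping.keys f \<subseteq> A \<Longrightarrow>
    eval_cpoly f v = (\<Sum>a\<in>A. Poly_Mapping.lookup f a * monomial_value v a)"
  unfolding eval_cpoly_def monomial_value_def
  by (rule sum.mono_neutral_left) (auto simp: in_keys_iff)

lemma eval_cpoly_add [simp]: "eval_cpoly (f + g) v = eval_cpoly f v + eval_cpoly g v"
proof -
  let ?A = "Poly_Mapping.keys f \<union> Poly_Mapping.keys g"
  have "eval_cpoly (f + g) v = (\<Sum>a\<in>?A. Poly_Mapping.lookup (f + g) a * monomial_value v a)"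
    by (rule eval_cpoly_superset) (auto simp: Poly_Mapping.keys_add)
  moreover have "eval_cpoly f v = (\<Sum>a\<in>?A. Poly_Mapping.lookup f a * monomial_value v a)"
    and "eval_cpoly g v = (\<Sum>a\<in>?A. Poly_Mapping.lookup g a * monomial_value v a)"
    by (rule eval_cpoly_superset; auto)+
  ultimately show ?thesis by (simp add: lookup_add algebra_simps sum.distrib)
qed

lemma eval_cpoly_zero [simp]: "eval_cpoly 0 v = 0"
  by (simp add: eval_cpoly_def)

lemma eval_cpoly_single [simp]:
  "eval_cpoly (Poly_Mapping.single a c) v = c * monomial_value v a"
  by (cases "c = 0") (auto simp: eval_cpoly_def monomial_value_def)

lemma eval_cpoly_sum [simp]: "eval_cpoly (\<Sum>i\<in>A. f i) v = (\<Sum>i\<in>A. eval_cpoly (f i) v)"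
  by (induction A rule: infinite_finite_induct) auto

lemma eval_cpoly_uminus [simp]: "eval_cpoly (- f) v = - eval_cpoly f v"
  using eval_cpoly_add[of f "- f" v] by (simp add: eq_neg_iff_add_eq_0 add.commute)

lemma eval_cpoly_diff [simp]: "eval_cpoly (f - g) v = eval_cpoly f v - eval_cpoly g v"
  using eval_cpoly_add[of f "- g" v] by simp

lemma cpoly_sum_single:
  fixes f :: "'a \<Rightarrow>\<^sub>0 'b::comm_monoid_add"
  shows "f = (\<Sum>a\<in>Poly_Mapping.keys f. Poly_Mapping.single a (Poly_Mapping.lookup f a))"
  by (rule poly_mapping_eqI) (simp add: lookup_sum lookup_single when_def in_keys_iff)

lemma eval_cpoly_mult [simp]: "eval_cpoly (f * g) v = eval_cpoly f v * eval_cpoly g v"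
proof -
  have "eval_cpoly (f * g) v = eval_cpoly ((\<Sum>a\<in>Poly_Mapping.keys f. Poly_Mapping.single a (Poly_Mapping.lookup f a)) *
     (\<Sum>b\<in>Poly_Mapping.keys g. Poly_Mapping.single b (Poly_Mapping.lookup g b))) v"
    by (subst cpoly_sum_single[of f], subst cpoly_sum_single[of g]) (rule refl)
  also have "\<dots> = (\<Sum>a\<in>Poly_Mapping.keys f. \<Sum>b\<in>Poly_Mapping.keys g.
      (Poly_Mapping.lookup f a * monomial_value v a) * (Poly_Mapping.lookup g b * monomial_value v b))"
    by (simp add: sum_product mult_single monomial_value_add algebra_simps)
  also have "\<dots> = eval_cpoly f v * eval_cpoly g v"
    by (simp add: sum_product eval_cpoly_def monomial_value_def)
  finally show ?thesis .
qed

lemma eval_cpoly_constp [simp]: "eval_cpoly (constp c) v = c"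
  by (simp add: constp_def)

lemma eval_cpoly_var [simp]: "eval_cpoly (var i) v = v i"
  by (simp add: var_def monomial_value_def)

lemma constp_0 [simp]: "constp 0 = 0"
  by (simp add: constp_def)

lemma constp_1 [simp]: "constp 1 = 1"
  by (simp add: constp_def)

lemma constp_add: "constp (a + b) = constp a + constp b"
  by (simp add: constp_def single_add)

lemma constp_mult: "constp (a * b) = constp a * constp b"
  by (simp add: constp_def mult_single)

lemma constp_uminus: "constp (- a) = - constp a"
  by (simp add: constp_def single_uminus)

lemma constp_diff: "constp (a - b) = constp a - constp b"
  by (simp add: constp_def single_diff)

lemma constp_of_nat: "constp (of_nat n) = of_nat n"
  by (simp add: constp_def)

lemma eval_cpoly_one [simp]: "eval_cpoly 1 v = 1"
  using eval_cpoly_constp[of 1] by simp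

lemma eval_cpoly_of_nat [simp]: "eval_cpoly (of_nat n) v = of_nat n"
  by (metis constp_of_nat eval_cpoly_constp)

lemma eval_cpoly_power [simp]: "eval_cpoly (f ^ n) v = eval_cpoly f v ^ n"
  by (induction n) auto

abbreviation poly_carrier :: "nat \<Rightarrow> cpoly set" where
  "poly_carrier d \<equiv> carrier (poly_ring d)"

lemma poly_carrier_closed [simp]:
  "f \<in> poly_carrier d \<Longrightarrow> g \<in> poly_carrier d \<Longrightarrow> f + g \<in> poly_carrier d"
  "f \<in> poly_carrier d \<Longrightarrow> g \<in> poly_carrier d \<Longrightarrow> f * g \<in> poly_carrier d"
  "0 \<in> poly_carrier d" "1 \<in> poly_carrier d"
  "constp c \<in> poly_carrier d"
  "f \<in> poly_carrier d \<Longrightarrow> - f \<in> poly_carrier d"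
proof -
  interpret cring "poly_ring d" by (rule cring_poly_ring)
  show "f \<in> poly_carrier d \<Longrightarrow> g \<in> poly_carrier d \<Longrightarrow> f + g \<in> poly_carrier d"
    using a_closed[of f g] by simp
  show "f \<in> poly_carrier d \<Longrightarrow> g \<in> poly_carrier d \<Longrightarrow> f * g \<in> poly_carrier d"
    using m_closed[of f g] by simp
  show "0 \<in> poly_carrier d" "1 \<in> poly_carrier d"
    using zero_closed one_closed by simp_all
qed (auto simp: carrier_poly_ring constp_def)

lemma poly_carrier_var [simp]: "i \<le> d \<Longrightarrow> var i \<in> poly_carrier d"
  by (simp add: carrier_poly_ring var_def)

lemma poly_carrier_diff [simp]:
  "f \<in> poly_carrier d \<Longrightarrow> g \<in> poly_carrier d \<Longrightarrow> f - g \<in> poly_carrier d"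
  using poly_carrier_closed(1)[of f d "- g"] by simp

lemma poly_carrier_of_nat [simp]: "of_nat n \<in> poly_carrier d"
  using poly_carrier_closed(5)[of "of_nat n" d] by (simp only: constp_of_nat)

lemma poly_carrier_power [simp]: "f \<in> poly_carrier d \<Longrightarrow> f ^ n \<in> poly_carrier d"
  by (induction n) auto

lemma poly_carrier_sum [simp]:
  "(\<And>i. i \<in> A \<Longrightarrow> f i \<in> poly_carrier d) \<Longrightarrow> (\<Sum>i\<in>A. f i) \<in> poly_carrier d"
  by (induction A rule: infinite_finite_induct) auto

lemma poly_carrier_prod [simp]:
  "(\<And>i. i \<in> A \<Longrightarrow> f i \<in> poly_carrier d) \<Longrightarrow> (\<Prod>i\<in>A. f i) \<in> poly_carrier d"
  by (induction A rule: infinite_finite_induct) auto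

definition degree_le :: "nat \<Rightarrow> cpoly \<Rightarrow> bool" where
  "degree_le N f \<longleftrightarrow> (\<forall>a\<in>Poly_Mapping.keys f. tdeg a \<le> N)"

lemma degree_le_mult: "degree_le M f \<Longrightarrow> degree_le N g \<Longrightarrow> degree_le (M + N) (f * g)"
  unfolding degree_le_def
proof
  fix a assume *: "\<forall>a\<in>Poly_Mapping.keys f. tdeg a \<le> M" "\<forall>a\<in>Poly_Mapping.keys g. tdeg a \<le> N"
    "a \<in> Poly_Mapping.keys (f * g)"
  then obtain b c where "a = b + c" "b \<in> Poly_Mapping.keys f" "c \<in> Poly_Mapping.keys g"
    using keys_mult[of f g] by blast
  then show "tdeg a \<le> M + N" using * by (simp add: tdeg_add add_mono)
qed

lemma degree_le_one [simp]: "degree_le N 1"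
  by (simp add: degree_le_def)

lemma degree_le_power: "degree_le N f \<Longrightarrow> degree_le (N * k) (f ^ k)"
  by (induction k) (auto simp: degree_le_mult)

lemma degree_le_mono: "degree_le M f \<Longrightarrow> M \<le> N \<Longrightarrow> degree_le N f"
  unfolding degree_le_def by fastforce

lemma degree_le_exists: "\<exists>N. degree_le N f"
  unfolding degree_le_def
  by (rule exI[of _ "\<Sum>a\<in>Poly_Mapping.keys f. tdeg a"]) (simp add: member_le_sum)

section \<open>Ideals of the polynomial ring in terms of the type class operations\<close>

text \<open>Closure under negation comes from multiplication by the constant -1.\<close>

lemma poly_ring_ideal_iff:
  "ideal J (poly_ring d) \<longleftrightarrow> J \<subseteq> poly_carrier d \<and> 0 \<in> J \<and>
    (\<forall>f\<in>J. \<forall>g\<in>J. f + g \<in> J) \<and> (\<forall>f\<in>J. \<forall>g\<in>poly_carrier d. g * f \<in> J)"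
proof
  assume "ideal J (poly_ring d)"
  then interpret ideal J "poly_ring d" .
  show "J \<subseteq> poly_carrier d \<and> 0 \<in> J \<and>
    (\<forall>f\<in>J. \<forall>g\<in>J. f + g \<in> J) \<and> (\<forall>f\<in>J. \<forall>g\<in>poly_carrier d. g * f \<in> J)"
    using a_subset additive_subgroup.zero_closed[OF is_additive_subgroup]
      additive_subgroup.a_closed[OF is_additive_subgroup] I_l_closed by auto
next
  assume *: "J \<subseteq> poly_carrier d \<and> 0 \<in> J \<and>
    (\<forall>f\<in>J. \<forall>g\<in>J. f + g \<in> J) \<and> (\<forall>f\<in>J. \<forall>g\<in>poly_carrier d. g * f \<in> J)"
  interpret R: cring "poly_ring d" by (rule cring_poly_ring)
  have inv: "\<ominus>\<^bsub>poly_ring d\<^esub> f = - f" if "f \<in> poly_carrier d" for f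
    using that R.minus_equality[of "- f" f] by simp
  have neg: "- f \<in> J" if "f \<in> J" for f
  proof -
    have "g * f \<in> J" if "g \<in> poly_carrier d" for g using * \<open>f \<in> J\<close> that by simp
    from this[of "constp (- 1)"] show ?thesis by (simp add: constp_uminus)
  qed
  show "ideal J (poly_ring d)"
  proof (rule idealI)
    show "ring (poly_ring d)" by (rule R.ring_axioms)
    show "subgroup J (add_monoid (poly_ring d))"
      by (rule R.add.subgroupI) (use * neg inv in \<open>auto simp: a_inv_def[symmetric]\<close>)
  qed (use * in \<open>auto simp: mult.commute\<close>)
qed

lemma poly_ring_minus:
  assumes "f \<in> poly_carrier d" "g \<in> poly_carrier d"
  shows "f \<ominus>\<^bsub>poly_ring d\<^esub> g = f - g"
proof -
  interpret R: cring "poly_ring d" by (rule cring_poly_ring)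
  have "\<ominus>\<^bsub>poly_ring d\<^esub> g = - g"
    using assms R.minus_equality[of "- g" g] by simp
  then show ?thesis by (simp add: a_minus_def)
qed

lemma poly_ring_idealD:
  assumes "ideal J (poly_ring d)"
  shows "f \<in> J \<Longrightarrow> f \<in> poly_carrier d" "0 \<in> J"
    "f \<in> J \<Longrightarrow> g \<in> J \<Longrightarrow> f + g \<in> J"
    "f \<in> J \<Longrightarrow> g \<in> poly_carrier d \<Longrightarrow> g * f \<in> J"
    "f \<in> J \<Longrightarrow> g \<in> poly_carrier d \<Longrightarrow> f * g \<in> J"
    "f \<in> J \<Longrightarrow> - f \<in> J"
    "f \<in> J \<Longrightarrow> g \<in> J \<Longrightarrow> f - g \<in> J"
proof -
  note * = assms[unfolded poly_ring_ideal_iff]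
  show "f \<in> J \<Longrightarrow> f \<in> poly_carrier d" "0 \<in> J"
    "f \<in> J \<Longrightarrow> g \<in> J \<Longrightarrow> f + g \<in> J"
    "f \<in> J \<Longrightarrow> g \<in> poly_carrier d \<Longrightarrow> g * f \<in> J"
    using * by blast+
  then show "f \<in> J \<Longrightarrow> g \<in> poly_carrier d \<Longrightarrow> f * g \<in> J"
    by (simp add: mult.commute)
  have neg: "- f \<in> J" if "f \<in> J" for f
  proof -
    have "g * f \<in> J" if "g \<in> poly_carrier d" for g using * \<open>f \<in> J\<close> that by simp
    from this[of "constp (- 1)"] show ?thesis by (simp add: constp_uminus)
  qed
  then show "f \<in> J \<Longrightarrow> - f \<in> J" .
  show "f \<in> J \<Longrightarrow> g \<in> J \<Longrightarrow> f - g \<in> J"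
  proof -
    assume J: "f \<in> J" "g \<in> J"
    have "f + h \<in> J" if "h \<in> J" for h using * J(1) that by simp
    from this[OF neg[OF J(2)]] show "f - g \<in> J" by simp
  qed
qed

lemma poly_ring_ideal_sum:
  assumes "ideal J (poly_ring d)" "\<And>i. i \<in> A \<Longrightarrow> f i \<in> J"
  shows "(\<Sum>i\<in>A. f i) \<in> J"
  using assms(2) by (induction A rule: infinite_finite_induct)
    (auto simp: poly_ring_idealD[OF assms(1)])

section \<open>A criterion for Cohen--Macaulay rings\<close>

lemma (in cring) mem_add_principal:
  assumes "ideal Q R" "a \<in> carrier R"
  shows "x \<in> set_add R Q (PIdl a) \<longleftrightarrow> (\<exists>q\<in>Q. \<exists>r\<in>carrier R. x = q \<oplus> r \<otimes> a)"
  by (auto simp: set_add_defs cgenideal_def)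

text \<open>An ideal Q that is maximal among those containing \<open>J\<close> and avoiding
  \<open>T\<close> is prime: if a and b lie outside Q, then Q + (a) and Q + (b) meet
  \<open>T\<close>, and the product of two elements of these intersections lies in \<open>T\<close>
  and in Q + (ab). Zorn's lemma applies because a nonempty chain of ideals in a noetherian ring
  contains its union.\<close>

lemma prime_avoiding:
  fixes R (structure)
  assumes "cring R" "noetherian_ring R" "ideal J R" and T: "T \<subseteq> carrier R" "\<one> \<in> T"
    "\<And>a b. a \<in> T \<Longrightarrow> b \<in> T \<Longrightarrow> a \<otimes> b \<in> T" and JT: "J \<inter> T = {}"
  shows "\<exists>Q. primeideal Q R \<and> J \<subseteq> Q \<and> Q \<inter> T = {}"
proof -
  interpret cring R by fact
  let ?A = "{I. ideal I R \<and> J \<subseteq> I \<and> I \<inter> T = {}}"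
  have "\<exists>M\<in>?A. \<forall>X\<in>?A. M \<subseteq> X \<longrightarrow> X = M"
  proof (rule subset_Zorn)
    fix C assume C: "subset.chain ?A C"
    show "\<exists>U\<in>?A. \<forall>X\<in>C. X \<subseteq> U"
    proof (cases "C = {}")
      case True
      then show ?thesis using assms(3) JT by blast
    next
      case False
      have "subset.chain {I. ideal I R} C"
        using C by (auto simp: subset.chain_def)
      then have "\<Union>C \<in> C"
        using noetherian_ring.ideal_chain_is_trivial[OF assms(2) False] by blast
      moreover have "C \<subseteq> ?A" using C by (auto simp: subset.chain_def)
      ultimately show ?thesis by blast
    qed
  qed
  then obtain Q where Q: "ideal Q R" "J \<subseteq> Q" "Q \<inter> T = {}"
    and max: "\<And>X. ideal X R \<Longrightarrow> Q \<subseteq> X \<Longrightarrow> X \<inter> T = {} \<Longrightarrow> X = Q"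
    by (auto simp: Ball_def)
  interpret Q: ideal Q R by fact
  have meet: "\<exists>q\<in>Q. \<exists>r\<in>carrier R. q \<oplus> r \<otimes> a \<in> T" if a: "a \<in> carrier R" "a \<notin> Q" for a
  proof (rule ccontr)
    assume none: "\<not> ?thesis"
    let ?X = "set_add R Q (PIdl a)"
    have "ideal ?X R" by (intro add_ideals Q cgenideal_ideal a)
    moreover have "Q \<subseteq> ?X"
    proof
      fix q assume "q \<in> Q"
      then show "q \<in> ?X" unfolding mem_add_principal[OF Q(1) a(1)]
        using a Q.Icarr by (intro bexI[of _ q] bexI[of _ \<zero>]) auto
    qed
    moreover have "?X \<inter> T = {}" using none by (auto simp: mem_add_principal[OF Q(1) a(1)])
    ultimately have "?X = Q" by (rule max)
    moreover have "a \<in> ?X" unfolding mem_add_principal[OF Q(1) a(1)]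
      using a by (intro bexI[of _ \<zero>] bexI[of _ \<one>]) auto
    ultimately show False using a by blast
  qed
  have "primeideal Q R"
  proof (rule primeidealI[OF Q(1) assms(1)])
    show "carrier R \<noteq> Q" using Q T by blast
    fix a b assume ab: "a \<in> carrier R" "b \<in> carrier R" "a \<otimes> b \<in> Q"
    show "a \<in> Q \<or> b \<in> Q"
    proof (rule ccontr)
      assume "\<not> ?thesis"
      then obtain q r q' r' where *: "q \<in> Q" "r \<in> carrier R" "q \<oplus> r \<otimes> a \<in> T"
        "q' \<in> Q" "r' \<in> carrier R" "q' \<oplus> r' \<otimes> b \<in> T"
        using meet ab by meson
      note cl = *(2,5) ab(1,2) Q.Icarr[OF *(1)] Q.Icarr[OF *(4)]
      have "(q \<oplus> r \<otimes> a) \<otimes> (q' \<oplus> r' \<otimes> b) = (q' \<oplus> r' \<otimes> b) \<otimes> q \<oplus> r \<otimes> a \<otimes> q' \<oplus> r \<otimes> r' \<otimes> (a \<otimes> b)"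
        using cl by (simp add: l_distr r_distr m_ac a_ac)
      moreover have "\<dots> \<in> Q"
        using Q.I_l_closed[OF *(1), of "q' \<oplus> r' \<otimes> b"] Q.I_l_closed[OF *(4), of "r \<otimes> a"]
          Q.I_l_closed[OF ab(3), of "r \<otimes> r'"] cl
        by (intro Q.a_closed) auto
      ultimately show False using T(3)[OF *(3) *(6)] Q(3) by auto
    qed
  qed
  then show ?thesis using Q by blast
qed

text \<open>The chain is built from the top: below a prime containing \<open>x\<^sub>1, \<dots>, x\<^sub>i\<close> there is a prime
  containing \<open>x\<^sub>1, \<dots>, x\<^sub>i\<^sub>-\<^sub>1\<close> but avoiding all \<open>s x\<^sub>i\<^sup>k\<close> with \<open>s\<close> outside the former.\<close>

lemma regular_sequence_prime_chain:
  fixes R (structure)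
  assumes "cring R" "noetherian_ring R" and reg: "regular_sequence R xs"
  shows "\<exists>P. (\<forall>i\<le>length xs. primeideal (P i) R) \<and> (\<forall>i<length xs. P i \<subset> P (Suc i))"
proof -
  interpret cring R by fact
  let ?n = "length xs"
  let ?I = "\<lambda>j. Idl (set (take j xs))"
  have xs: "set xs \<subseteq> carrier R" using reg by (simp add: regular_sequence_def)
  have sub: "set (take j xs) \<subseteq> carrier R" for j using xs set_take_subset by fastforce
  have id: "ideal (?I j) R" for j by (rule genideal_ideal[OF sub])
  \<comment> \<open>Downward induction on \<open>j\<close>: only the part of the chain from
    \<open>j\<close> upwards exists, and its bottom contains the first \<open>j\<close> members of
    the sequence.\<close>
  let ?C = "\<lambda>j. \<exists>P. (\<forall>i. j \<le> i \<longrightarrow> i \<le> ?n \<longrightarrow> primeideal (P i) R) \<and>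
     (\<forall>i. j \<le> i \<longrightarrow> i < ?n \<longrightarrow> P i \<subset> P (Suc i)) \<and> ?I j \<subseteq> P j"
  have "?C 0"
  proof (rule inc_induct[of 0 ?n])
    have "\<exists>Q. primeideal Q R \<and> ?I ?n \<subseteq> Q \<and> Q \<inter> {\<one>} = {}"
    proof (rule prime_avoiding[OF assms(1,2) id])
      have "?I ?n \<noteq> carrier R" using reg by (simp add: regular_sequence_def)
      then show "?I ?n \<inter> {\<one>} = {}" using ideal.one_imp_carrier[OF id[of ?n]] by blast
    qed auto
    then obtain Q where "primeideal Q R" "?I ?n \<subseteq> Q" by blast
    then show "?C ?n" by (intro exI[of _ "\<lambda>_. Q"]) auto
  next
    fix j assume j: "j < ?n" and "?C (Suc j)"
    then obtain P where P: "\<And>i. Suc j \<le> i \<Longrightarrow> i \<le> ?n \<Longrightarrow> primeideal (P i) R"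
      "\<And>i. Suc j \<le> i \<Longrightarrow> i < ?n \<Longrightarrow> P i \<subset> P (Suc i)" "?I (Suc j) \<subseteq> P (Suc j)"
      by blast
    interpret P: primeideal "P (Suc j)" R using P(1)[of "Suc j"] j by simp
    define x where "x = xs ! j"
    have x: "x \<in> carrier R" using xs j by (auto simp: x_def)
    have "x \<in> set (take (Suc j) xs)" using j by (simp add: x_def take_Suc_conv_app_nth)
    then have xP: "x \<in> P (Suc j)" using genideal_self[OF sub[of "Suc j"]] P(3) by blast
    have "set (take j xs) \<subseteq> set (take (Suc j) xs)" by (rule set_take_subset_set_take) simp
    then have mono: "?I j \<subseteq> ?I (Suc j)" by (rule subset_Idl_subset[OF sub])
    \<comment> \<open>The products with \<open>k = 0\<close> force the new prime into
      \<open>P (Suc j)\<close>, and the product with \<open>s = \<one>\<close>, \<open>k = 1\<close>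
      keeps \<open>x\<close> out of it, which makes the inclusion strict.\<close>
    let ?T = "{s \<otimes> x [^] k |s k::nat. s \<in> carrier R - P (Suc j)}"
    have memT: "s \<in> carrier R \<Longrightarrow> s \<notin> P (Suc j) \<Longrightarrow> s \<otimes> x [^] k \<in> ?T" for s and k :: nat
      by blast
    have one: "\<one> \<notin> P (Suc j)" using P.one_imp_carrier P.I_notcarr by blast
    have "\<exists>Q. primeideal Q R \<and> ?I j \<subseteq> Q \<and> Q \<inter> ?T = {}"
    proof (rule prime_avoiding[OF assms(1,2) id])
      show "?T \<subseteq> carrier R" using x by auto
      show "\<one> \<in> ?T" using memT[of \<one> 0] one by simp
      fix a b assume "a \<in> ?T" "b \<in> ?T"
      then obtain s k s' k' where ab: "a = s \<otimes> x [^] (k::nat)" "b = s' \<otimes> x [^] (k'::nat)"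
        "s \<in> carrier R" "s \<notin> P (Suc j)" "s' \<in> carrier R" "s' \<notin> P (Suc j)" by blast
      have "a \<otimes> b = (s \<otimes> s') \<otimes> x [^] (k + k')"
        using ab x by (simp add: nat_pow_mult[symmetric] m_ac)
      then show "a \<otimes> b \<in> ?T" using memT[of "s \<otimes> s'" "k + k'"] ab P.I_prime by auto
    next
      \<comment> \<open>Regularity cancels the factors \<open>x\<close> one by one. What remains is
        \<open>s\<close> in \<open>?I j\<close>, hence in \<open>P (Suc j)\<close>, contrary to the
        choice of \<open>s\<close> in \<open>?T\<close>.\<close>
      have "s \<in> ?I j" if "s \<in> carrier R" "s \<otimes> x [^] k \<in> ?I j" for s and k :: nat
        using that
      proof (induction k arbitrary: s)
        case (Suc k)
        have "(s \<otimes> x [^] k) \<otimes> xs ! j \<in> ?I j"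
          using Suc.prems x by (simp add: x_def[symmetric] m_ac)
        then have "s \<otimes> x [^] k \<in> ?I j"
          using reg j Suc.prems(1) x unfolding regular_sequence_def by (auto simp del: nat_pow_Suc)
        then show ?case using Suc by blast
      qed simp
      then show "?I j \<inter> ?T = {}" using mono P(3) by blast
    qed
    then obtain Q where Q: "primeideal Q R" "?I j \<subseteq> Q" "Q \<inter> ?T = {}" by blast
    interpret Q: primeideal Q R by fact
    have "Q \<subseteq> P (Suc j)"
    proof
      fix s assume s: "s \<in> Q"
      then have "s \<in> carrier R" by (rule Q.Icarr)
      then show "s \<in> P (Suc j)" using memT[of s 0] Q(3) s by auto
    qed
    moreover have "x \<notin> Q" using memT[of \<one> 1] Q(3) one x by auto
    ultimately have "Q \<subset> P (Suc j)" using xP by blast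
    then have "(\<forall>i. j \<le> i \<longrightarrow> i \<le> ?n \<longrightarrow> primeideal ((P(j := Q)) i) R) \<and>
     (\<forall>i. j \<le> i \<longrightarrow> i < ?n \<longrightarrow> (P(j := Q)) i \<subset> (P(j := Q)) (Suc i)) \<and> ?I j \<subseteq> (P(j := Q)) j"
      using P Q by (auto simp: Suc_le_eq)
    then show "?C j" by (rule exI[of _ "P(j := Q)"])
  qed simp
  then show ?thesis by auto
qed

lemma depth_geI:
  assumes "regular_sequence R xs" "set xs \<subseteq> M"
  shows "enat (length xs) \<le> depth R M"
  unfolding depth_def by (rule Sup_upper) (use assms in blast)

lemma depth_le_krull_dim:
  assumes "cring R" "noetherian_ring R"
  shows "depth R M \<le> krull_dim R"
  unfolding depth_def
proof (rule Sup_least)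
  fix e assume "e \<in> {enat (length xs) |xs. regular_sequence R xs \<and> set xs \<subseteq> M}"
  then obtain xs where xs: "e = enat (length xs)" "regular_sequence R xs" by blast
  show "e \<le> krull_dim R"
    unfolding krull_dim_def xs(1)
    by (rule Sup_upper) (use regular_sequence_prime_chain[OF assms xs(2)] in blast)
qed

text \<open>The common feature of quotient and localization maps through which the noetherian property
  and bounds for the Krull dimension pass to the codomain.\<close>

locale extension_hom = R: cring R + S: cring S + ring_hom_cring R S h for R and S and h +
  assumes ideal_extended:
    "ideal J S \<Longrightarrow> J \<subseteq> Idl\<^bsub>S\<^esub> (h ` {r \<in> carrier R. h r \<in> J})"
begin

text \<open>By \<open>ideal_extended\<close> an ideal of \<open>S\<close> is generated by the image
  of its preimage, so the preimage determines it.\<close>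

lemma preimage_strict_mono:
  assumes "ideal J S" "ideal J' S" "J \<subset> J'"
  shows "{r \<in> carrier R. h r \<in> J} \<subset> {r \<in> carrier R. h r \<in> J'}"
proof -
  have "{r \<in> carrier R. h r \<in> J} \<noteq> {r \<in> carrier R. h r \<in> J'}"
  proof
    assume eq: "{r \<in> carrier R. h r \<in> J} = {r \<in> carrier R. h r \<in> J'}"
    have "J' \<subseteq> Idl\<^bsub>S\<^esub> (h ` {r \<in> carrier R. h r \<in> J})"
      unfolding eq by (rule ideal_extended[OF assms(2)])
    also have "\<dots> \<subseteq> J" by (rule S.genideal_minimal[OF assms(1)]) auto
    finally show False using assms(3) by blast
  qed
  then show ?thesis using assms(3) by blast
qed

lemma preimage_primeideal:
  assumes "primeideal Q S"
  shows "primeideal {r \<in> carrier R. h r \<in> Q} R"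
proof -
  interpret Q: primeideal Q S by fact
  show ?thesis
  proof (rule primeidealI)
    show "ideal {r \<in> carrier R. h r \<in> Q} R" by (rule ring.ideal_vimage[OF Q.is_ideal])
    show "cring R" by (rule R.is_cring)
    show "carrier R \<noteq> {r \<in> carrier R. h r \<in> Q}"
      using Q.one_imp_carrier Q.I_notcarr R.one_closed by force
  qed (use Q.I_prime in auto)
qed

lemma krull_dim_le: "krull_dim S \<le> krull_dim R"
  unfolding krull_dim_def
proof (rule Sup_subset_mono, safe)
  fix n and P :: "nat \<Rightarrow> 'c set"
  assume P: "\<forall>i\<le>n. primeideal (P i) S" "\<forall>i<n. P i \<subset> P (Suc i)"
  have "\<forall>i\<le>n. primeideal {r \<in> carrier R. h r \<in> P i} R"
    using P preimage_primeideal by blast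
  moreover have "\<forall>i<n. {r \<in> carrier R. h r \<in> P i} \<subset> {r \<in> carrier R. h r \<in> P (Suc i)}"
  proof (intro allI impI)
    fix i assume "i < n"
    then show "{r \<in> carrier R. h r \<in> P i} \<subset> {r \<in> carrier R. h r \<in> P (Suc i)}"
      using P by (intro preimage_strict_mono primeideal.axioms(1)) auto
  qed
  ultimately show "\<exists>m. enat n = enat m \<and> (\<exists>P. (\<forall>i\<le>m. primeideal (P i) R) \<and> (\<forall>i<m. P i \<subset> P (Suc i)))"
    by (intro exI[of _ n] conjI refl exI[of _ "\<lambda>i. {r \<in> carrier R. h r \<in> P i}"])
qed

text \<open>The images of finitely many generators of the preimage of \<open>J\<close> generate
  \<open>J\<close>.\<close>

lemma noetherian:
  assumes "noetherian_ring R"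
  shows "noetherian_ring S"
proof (rule S.noetherian_ringI)
  fix J assume J: "ideal J S"
  let ?I = "{r \<in> carrier R. h r \<in> J}"
  have "ideal ?I R" by (rule ring.ideal_vimage[OF J])
  then obtain A where A: "A \<subseteq> carrier R" "finite A" "?I = Idl\<^bsub>R\<^esub> A"
    using noetherian_ring.finetely_gen[OF assms] by blast
  have sub: "h ` A \<subseteq> carrier S" using A by auto
  have "A \<subseteq> ?I" unfolding A(3) by (rule R.genideal_self[OF A(1)])
  then have "Idl\<^bsub>S\<^esub> (h ` A) \<subseteq> J" by (intro S.genideal_minimal[OF J]) auto
  moreover have "?I \<subseteq> {r \<in> carrier R. h r \<in> Idl\<^bsub>S\<^esub> (h ` A)}"
    unfolding A(3)
    by (rule R.genideal_minimal[OF ring.ideal_vimage[OF S.genideal_ideal[OF sub]]])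
      (use A S.genideal_self[OF sub] in auto)
  then have "Idl\<^bsub>S\<^esub> (h ` ?I) \<subseteq> Idl\<^bsub>S\<^esub> (h ` A)"
    by (intro S.genideal_minimal[OF S.genideal_ideal[OF sub]]) auto
  then have "J \<subseteq> Idl\<^bsub>S\<^esub> (h ` A)" using ideal_extended[OF J] by blast
  ultimately show "\<exists>A\<subseteq>carrier S. finite A \<and> J = Idl\<^bsub>S\<^esub> A"
    using sub A(2) by (intro exI[of _ "h ` A"]) auto
qed

end

lemma extension_hom_quotient:
  assumes "cring R" "ideal I R"
  shows "extension_hom R (R Quot I) ((+>\<^bsub>R\<^esub>) I)"
proof -
  interpret R: cring R by fact
  interpret I: ideal I R by fact
  interpret h: ring_hom_cring R "R Quot I" "(+>\<^bsub>R\<^esub>) I"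
    by (rule I.rcos_ring_hom_cring[OF assms(1)])
  show ?thesis
  proof (unfold_locales)
    fix J assume J: "ideal J (R Quot I)"
    have "J \<subseteq> carrier (R Quot I)" by (simp add: J additive_subgroup.a_subset ideal.axioms(1))
    let ?A = "{r \<in> carrier R. I +>\<^bsub>R\<^esub> r \<in> J}"
    have "J \<subseteq> (+>\<^bsub>R\<^esub>) I ` ?A"
    proof
      fix x assume x: "x \<in> J"
      then have "x \<in> a_rcosets\<^bsub>R\<^esub> I"
        using \<open>J \<subseteq> carrier (R Quot I)\<close> unfolding FactRing_def by force
      then obtain r where "r \<in> carrier R" "x = I +>\<^bsub>R\<^esub> r"
        unfolding A_RCOSETS_def' by blast
      then show "x \<in> (+>\<^bsub>R\<^esub>) I ` ?A" using x by blast
    qed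
    also have "\<dots> \<subseteq> Idl\<^bsub>R Quot I\<^esub> ((+>\<^bsub>R\<^esub>) I ` ?A)"
      by (rule h.S.genideal_self) auto
    finally show "J \<subseteq> Idl\<^bsub>R Quot I\<^esub> ((+>\<^bsub>R\<^esub>) I ` ?A)" .
  qed
qed

section \<open>Ideals and regular sequences in a localization\<close>

locale localized_ring = R: cring R + S: submonoid S R for R (structure) and S
begin

abbreviation L where "L \<equiv> localization R S"
abbreviation frac where "frac \<equiv> fraction R S"

lemmas frac_mult = fraction_mult[OF R.is_cring S.submonoid_axioms]
lemmas frac_add = fraction_add[OF R.is_cring S.submonoid_axioms]
lemmas mem_frac_iff = mem_fraction_iff[OF R.is_cring S.submonoid_axioms]
lemmas frac_eqI = fraction_eqI[OF R.is_cring S.submonoid_axioms]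
lemmas frac_eqI' = fraction_eqI'[OF R.is_cring S.submonoid_axioms]
lemmas frac_self = fraction_self[OF R.is_cring S.submonoid_axioms]
lemmas L_simps = localization_simps[OF R.is_cring S.submonoid_axioms]

sublocale L: cring L by (rule cring_localization[OF R.is_cring S.submonoid_axioms])

lemma S_carrier [simp]: "s \<in> S \<Longrightarrow> s \<in> carrier R"
  using S.subset by blast

lemma frac_closed [simp]: "r \<in> carrier R \<Longrightarrow> s \<in> S \<Longrightarrow> frac r s \<in> carrier L"
  unfolding L_simps by blast

lemma frac_eq_iff:
  assumes "r \<in> carrier R" "s \<in> S" "r' \<in> carrier R" "s' \<in> S"
  shows "frac r s = frac r' s' \<longleftrightarrow> (\<exists>t\<in>S. t \<otimes> (r \<otimes> s') = t \<otimes> (r' \<otimes> s))"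
proof
  assume "frac r s = frac r' s'"
  then have "(r, s) \<in> frac r' s'" using frac_self[OF assms(1,2)] by simp
  then show "\<exists>t\<in>S. t \<otimes> (r \<otimes> s') = t \<otimes> (r' \<otimes> s)"
    unfolding mem_frac_iff[OF assms(3,4)] by blast
next
  assume "\<exists>t\<in>S. t \<otimes> (r \<otimes> s') = t \<otimes> (r' \<otimes> s)"
  then obtain t where "t \<in> S" "t \<otimes> (r \<otimes> s') = t \<otimes> (r' \<otimes> s)" by blast
  then show "frac r s = frac r' s'" using assms by (intro frac_eqI[of _ _ _ _ t]) auto
qed

lemma frac_same: "s \<in> S \<Longrightarrow> frac s s = \<one>\<^bsub>L\<^esub>"
  unfolding L_simps(2) by (rule frac_eqI') simp_all

lemma frac_hom: "ring_hom_cring R L (\<lambda>r. frac r \<one>)"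
proof (rule ring_hom_cringI)
  show "cring R" "cring L" by (rule R.is_cring L.is_cring)+
  show "(\<lambda>r. frac r \<one>) \<in> Ring.ring_hom R L"
    by (rule ring_hom_memI) (auto simp: frac_mult frac_add L_simps(2))
qed

text \<open>If r/s lies in \<open>J\<close>, then so does r/1 = (s/1)(r/s), and r/s = (1/s)(r/1) is
  recovered from it.\<close>

lemma frac_extension: "extension_hom R L (\<lambda>r. frac r \<one>)"
proof -
  interpret h: ring_hom_cring R L "\<lambda>r. frac r \<one>" by (rule frac_hom)
  show ?thesis
  proof (unfold_locales)
    fix J assume "ideal J L"
    then interpret J: ideal J L .
    let ?A = "(\<lambda>r. frac r \<one>) ` {r \<in> carrier R. frac r \<one> \<in> J}"
    have sub: "?A \<subseteq> carrier L" by auto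
    interpret A: ideal "Idl\<^bsub>L\<^esub> ?A" L by (rule L.genideal_ideal[OF sub])
    show "J \<subseteq> Idl\<^bsub>L\<^esub> ?A"
    proof
      fix x assume x: "x \<in> J"
      then obtain r s where rs: "r \<in> carrier R" "s \<in> S" "x = frac r s"
        using J.Icarr[OF x, unfolded L_simps(1)] by blast
      have "frac r \<one> = frac s \<one> \<otimes>\<^bsub>L\<^esub> x"
        unfolding rs(3) using rs by (simp add: frac_mult, intro frac_eqI') (auto simp: R.m_ac)
      then have "frac r \<one> \<in> J" using J.I_l_closed[OF x] rs by simp
      then have "frac r \<one> \<in> ?A" using rs(1) by (intro imageI CollectI conjI)
      then have "frac r \<one> \<in> Idl\<^bsub>L\<^esub> ?A" by (rule subsetD[OF L.genideal_self[OF sub]])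
      then have "frac \<one> s \<otimes>\<^bsub>L\<^esub> frac r \<one> \<in> Idl\<^bsub>L\<^esub> ?A"
        using rs by (intro A.I_l_closed frac_closed R.one_closed)
      moreover have "frac \<one> s \<otimes>\<^bsub>L\<^esub> frac r \<one> = x" using rs by (simp add: frac_mult)
      ultimately show "x \<in> Idl\<^bsub>L\<^esub> ?A" by (rule back_subst)
    qed
  qed
qed

lemma fractions_of_ideal:
  assumes "ideal I R"
  shows "ideal {frac r s |r s. r \<in> I \<and> s \<in> S} L"
proof -
  interpret I: ideal I R by fact
  let ?J = "{frac r s |r s. r \<in> I \<and> s \<in> S}"
  have mem: "frac r s \<in> ?J" if "r \<in> I" "s \<in> S" for r s using that by blast
  have sub: "?J \<subseteq> carrier L" using I.Icarr by auto
  have l: "x \<otimes>\<^bsub>L\<^esub> a \<in> ?J" if ax: "a \<in> ?J" "x \<in> carrier L" for a x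
  proof -
    obtain r s where "a = frac r s" "r \<in> I" "s \<in> S" using ax by blast
    moreover obtain r' s' where "x = frac r' s'" "r' \<in> carrier R" "s' \<in> S"
      using ax unfolding L_simps by blast
    ultimately show ?thesis
      using mem[of "r' \<otimes> r" "s' \<otimes> s"] by (simp add: frac_mult I.Icarr I.I_l_closed)
  qed
  show ?thesis
  proof (rule idealI[OF L.ring_axioms])
    show "subgroup ?J (add_monoid L)"
    proof (rule L.add.subgroupI)
      show "?J \<subseteq> carrier L" by (rule sub)
      show "?J \<noteq> {}" using mem[OF I.zero_closed S.one_closed] by blast
      show "\<ominus>\<^bsub>L\<^esub> a \<in> ?J" if "a \<in> ?J" for a
      proof -
        have "a \<in> carrier L" using that sub by blast
        then have "\<ominus>\<^bsub>L\<^esub> a = (\<ominus>\<^bsub>L\<^esub> \<one>\<^bsub>L\<^esub>) \<otimes>\<^bsub>L\<^esub> a" by (simp add: L.l_minus)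
        moreover have "(\<ominus>\<^bsub>L\<^esub> \<one>\<^bsub>L\<^esub>) \<otimes>\<^bsub>L\<^esub> a \<in> ?J" by (rule l[OF that]) simp
        ultimately show ?thesis by (rule ssubst)
      qed
      show "a \<oplus>\<^bsub>L\<^esub> b \<in> ?J" if ab: "a \<in> ?J" "b \<in> ?J" for a b
      proof -
        obtain r s where 1: "a = frac r s" "r \<in> I" "s \<in> S" using ab by blast
        obtain r' s' where 2: "b = frac r' s'" "r' \<in> I" "s' \<in> S" using ab by blast
        have "r \<otimes> s' \<oplus> r' \<otimes> s \<in> I" using 1 2 by (simp add: I.I_r_closed)
        then show ?thesis
          using mem[of "r \<otimes> s' \<oplus> r' \<otimes> s" "s \<otimes> s'"] 1 2 by (simp add: frac_add I.Icarr)
      qed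
    qed
    show "a \<otimes>\<^bsub>L\<^esub> x \<in> ?J" if "a \<in> ?J" "x \<in> carrier L" for a x
    proof -
      have "a \<in> carrier L" using that sub by blast
      then have "a \<otimes>\<^bsub>L\<^esub> x = x \<otimes>\<^bsub>L\<^esub> a" using that(2) by (rule L.m_comm)
      then show ?thesis using l[OF that] by (rule ssubst)
    qed
  qed (rule l)
qed

lemma frac_mem_extended_ideal:
  assumes A: "A \<subseteq> carrier R" and rs: "r \<in> carrier R" "s \<in> S"
  shows "frac r s \<in> Idl\<^bsub>L\<^esub> ((\<lambda>r. frac r \<one>) ` A) \<longleftrightarrow> (\<exists>t\<in>S. t \<otimes> r \<in> Idl A)"
proof
  let ?I = "Idl A"
  interpret h: ring_hom_cring R L "\<lambda>r. frac r \<one>" by (rule frac_hom)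
  interpret I: ideal ?I R by (rule R.genideal_ideal[OF A])
  assume "frac r s \<in> Idl\<^bsub>L\<^esub> ((\<lambda>r. frac r \<one>) ` A)"
  moreover have "Idl\<^bsub>L\<^esub> ((\<lambda>r. frac r \<one>) ` A) \<subseteq> {frac r s |r s. r \<in> ?I \<and> s \<in> S}"
    by (rule L.genideal_minimal[OF fractions_of_ideal[OF I.is_ideal]])
      (use R.genideal_self[OF A] S.one_closed in blast)
  ultimately obtain r' s' where *: "frac r s = frac r' s'" "r' \<in> ?I" "s' \<in> S" by blast
  then obtain t where t: "t \<in> S" "t \<otimes> (r \<otimes> s') = t \<otimes> (r' \<otimes> s)"
    using frac_eq_iff[OF rs I.Icarr[OF *(2)] *(3)] by blast
  have "(t \<otimes> s') \<otimes> r = (t \<otimes> s) \<otimes> r'"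
    using t rs *(3) I.Icarr[OF *(2)] by (simp add: R.m_ac)
  moreover have "\<dots> \<in> ?I" using *(2) t(1) rs by (simp add: I.I_l_closed)
  ultimately have "(t \<otimes> s') \<otimes> r \<in> ?I" by (rule ssubst)
  then show "\<exists>t\<in>S. t \<otimes> r \<in> ?I" using S.m_closed[OF t(1) *(3)] by (rule bexI)
next
  let ?A = "(\<lambda>r. frac r \<one>) ` A"
  interpret h: ring_hom_cring R L "\<lambda>r. frac r \<one>" by (rule frac_hom)
  have sub: "?A \<subseteq> carrier L" using A by auto
  interpret A: ideal "Idl\<^bsub>L\<^esub> ?A" L by (rule L.genideal_ideal[OF sub])
  assume "\<exists>t\<in>S. t \<otimes> r \<in> Idl A"
  then obtain t where t: "t \<in> S" "t \<otimes> r \<in> Idl A" by blast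
  have "Idl A \<subseteq> {r \<in> carrier R. frac r \<one> \<in> Idl\<^bsub>L\<^esub> ?A}"
    by (rule R.genideal_minimal[OF h.ring.ideal_vimage[OF A.is_ideal]])
      (use A L.genideal_self[OF sub] in auto)
  then have "frac (t \<otimes> r) \<one> \<in> Idl\<^bsub>L\<^esub> ?A" using t by blast
  then have "frac \<one> (t \<otimes> s) \<otimes>\<^bsub>L\<^esub> frac (t \<otimes> r) \<one> \<in> Idl\<^bsub>L\<^esub> ?A"
    using rs t by (intro A.I_l_closed frac_closed R.one_closed S.m_closed)
  moreover have "frac \<one> (t \<otimes> s) \<otimes>\<^bsub>L\<^esub> frac (t \<otimes> r) \<one> = frac (\<one> \<otimes> (t \<otimes> r)) ((t \<otimes> s) \<otimes> \<one>)"
    by (rule frac_mult) (use rs t in simp_all)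
  moreover have "\<dots> = frac r s"
    by (rule frac_eqI') (use rs t in \<open>simp_all add: R.m_ac\<close>)
  ultimately show "frac r s \<in> Idl\<^bsub>L\<^esub> ?A" by (metis (no_types))
qed

text \<open>A relation over the localization becomes one over \<open>R\<close> after multiplication
  by some \<open>t\<close> in \<open>S\<close>; regularity over \<open>R\<close> is then applied to
  \<open>t \<otimes> r\<close> in place of \<open>r\<close>. The hypothesis \<open>disj\<close>
  prevents the extended ideal from becoming the whole ring.\<close>

lemma regular_sequence_localization:
  assumes reg: "regular_sequence R xs"
    and disj: "Idl (set xs) \<inter> S = {}"
  shows "regular_sequence L (map (\<lambda>r. frac r \<one>) xs)"
proof -
  let ?h = "\<lambda>r. frac r \<one>"
  have xs: "set xs \<subseteq> carrier R" using reg by (simp add: regular_sequence_def)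
  have sub: "set (take j xs) \<subseteq> carrier R" for j using xs set_take_subset by fastforce
  have take: "set (take i (map ?h xs)) = ?h ` set (take i xs)" for i by (simp add: take_map)
  show ?thesis
    unfolding regular_sequence_def
  proof (intro conjI allI impI ballI)
    show "set (map ?h xs) \<subseteq> carrier L" using xs by auto
    fix i x assume i: "i < length (map ?h xs)" and x: "x \<in> carrier L"
      and *: "x \<otimes>\<^bsub>L\<^esub> map ?h xs ! i \<in> Idl\<^bsub>L\<^esub> (set (take i (map ?h xs)))"
    obtain r s where rs: "x = frac r s" "r \<in> carrier R" "s \<in> S" using x unfolding L_simps by blast
    have xi: "xs ! i \<in> carrier R" using xs i by auto
    have "frac (r \<otimes> xs ! i) s \<in> Idl\<^bsub>L\<^esub> (?h ` set (take i xs))"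
      using * i rs xi unfolding take by (simp add: frac_mult)
    then obtain t where t: "t \<in> S" "t \<otimes> (r \<otimes> xs ! i) \<in> Idl (set (take i xs))"
      using frac_mem_extended_ideal[OF sub, of "r \<otimes> xs ! i" s] rs xi by auto
    have "(t \<otimes> r) \<otimes> xs ! i \<in> Idl (set (take i xs))" using t rs xi by (simp add: R.m_ac)
    then have "t \<otimes> r \<in> Idl (set (take i xs))"
      using reg i t rs unfolding regular_sequence_def by auto
    then show "x \<in> Idl\<^bsub>L\<^esub> (set (take i (map ?h xs)))"
      unfolding take rs(1) using frac_mem_extended_ideal[OF sub rs(2,3)] t(1) by blast
  next
    show "Idl\<^bsub>L\<^esub> (set (map ?h xs)) \<noteq> carrier L"
    proof
      assume "Idl\<^bsub>L\<^esub> (set (map ?h xs)) = carrier L"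
      then have "frac \<one> \<one> \<in> Idl\<^bsub>L\<^esub> (?h ` set xs)" by simp
      then obtain t where "t \<in> S" "t \<otimes> \<one> \<in> Idl (set xs)"
        using frac_mem_extended_ideal[OF xs, of \<one> \<one>] by auto
      then show False using disj by auto
    qed
  qed
qed

end

section \<open>Localization at a prime and the Cohen--Macaulay criterion\<close>

lemma localized_ring_at_prime:
  assumes "primeideal M R"
  shows "localized_ring R (carrier R - M)"
proof -
  interpret M: primeideal M R by fact
  show ?thesis
  proof (unfold_locales)
    show "\<one>\<^bsub>R\<^esub> \<in> carrier R - M" using M.one_imp_carrier M.I_notcarr by auto
  qed (use M.I_prime in auto)
qed

text \<open>Hypothesis \<open>unit\<close> stands in for the invertibility of all elements outside
  \<open>J\<close>; it puts every proper ideal inside \<open>J\<close>.\<close>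

lemma (in ring) maximal_ideals_local:
  assumes J: "ideal J R" "carrier R \<noteq> J"
    and unit: "\<And>N x. ideal N R \<Longrightarrow> x \<in> N \<Longrightarrow> x \<notin> J \<Longrightarrow> N = carrier R"
  shows "{N. maximalideal N R} = {J}"
proof (intro equalityI subsetI)
  interpret J: ideal J R by (rule J)
  fix N assume "N \<in> {N. maximalideal N R}"
  then interpret N: maximalideal N R by simp
  have "N \<subseteq> J" using unit[OF N.is_ideal] N.I_notcarr by blast
  then show "N \<in> {J}" using N.I_maximal[OF J(1)] J.a_subset J(2) by blast
next
  fix N assume "N \<in> {J}"
  moreover have "maximalideal J R"
    by (rule maximalidealI[OF J]) (use unit in blast)
  ultimately show "N \<in> {N. maximalideal N R}" by simp
qed

lemma maximal_ideals_localization: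
  assumes R: "cring R" and M: "primeideal M R"
  shows "{N. maximalideal N (localization R (carrier R - M))}
    = {{fraction R (carrier R - M) r s |r s. r \<in> M \<and> s \<in> carrier R - M}}"
proof -
  interpret localized_ring R "carrier R - M" by (rule localized_ring_at_prime[OF M])
  interpret M: primeideal M R by (rule M)
  let ?J = "{frac r s |r s. r \<in> M \<and> s \<in> carrier R - M}"
  interpret J: ideal ?J L by (rule fractions_of_ideal[OF M.is_ideal])
  \<comment> \<open>An element of \<open>?J\<close> has many representations as a fraction.
    Primality of \<open>M\<close> shows that all of them have their numerator in
    \<open>M\<close>.\<close>
  have mem: "r \<in> M" if rs: "frac r s \<in> ?J" "r \<in> carrier R" "s \<in> carrier R - M" for r s
  proof -
    obtain r' s' where *: "frac r s = frac r' s'" "r' \<in> M" "s' \<in> carrier R - M"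
      using rs(1) by blast
    then obtain t where t: "t \<in> carrier R - M"
      "t \<otimes>\<^bsub>R\<^esub> (r \<otimes>\<^bsub>R\<^esub> s') = t \<otimes>\<^bsub>R\<^esub> (r' \<otimes>\<^bsub>R\<^esub> s)"
      using iffD1[OF frac_eq_iff[OF rs(2,3) M.Icarr[OF *(2)] *(3)] *(1)] by blast
    have cl: "t \<in> carrier R" "s \<in> carrier R" "s' \<in> carrier R" "s' \<notin> M" "t \<notin> M"
      using t(1) rs(3) *(3) by blast+
    have "t \<otimes>\<^bsub>R\<^esub> (r' \<otimes>\<^bsub>R\<^esub> s) \<in> M"
      by (intro M.I_l_closed M.I_r_closed *(2) cl)
    then have "t \<otimes>\<^bsub>R\<^esub> (r \<otimes>\<^bsub>R\<^esub> s') \<in> M" unfolding t(2) .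
    then have "r \<otimes>\<^bsub>R\<^esub> s' \<in> M"
      using M.I_prime[OF cl(1) R.m_closed[OF rs(2) cl(3)]] cl(5) by blast
    then show "r \<in> M" using M.I_prime[OF rs(2) cl(3)] cl(4) by blast
  qed
  have one: "\<one>\<^bsub>R\<^esub> \<in> carrier R - M" using M.one_imp_carrier M.I_notcarr by auto
  have notcarr: "carrier L \<noteq> ?J"
  proof
    assume eq: "carrier L = ?J"
    have "frac \<one>\<^bsub>R\<^esub> \<one>\<^bsub>R\<^esub> \<in> carrier L" by (rule frac_closed[OF R.one_closed one])
    then have "frac \<one>\<^bsub>R\<^esub> \<one>\<^bsub>R\<^esub> \<in> ?J" unfolding eq .
    from mem[OF this R.one_closed one] one show False by blast
  qed
  have unit: "N = carrier L" if x: "ideal N L" "x \<in> N" "x \<notin> ?J" for N x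
  proof -
    interpret N: ideal N L by (rule x(1))
    obtain r s where rs: "x = frac r s" "r \<in> carrier R" "s \<in> carrier R - M"
      using N.Icarr[OF x(2)] unfolding L_simps by blast
    then have r: "r \<in> carrier R - M" using x(3) by blast
    have "frac s r \<otimes>\<^bsub>L\<^esub> x \<in> N"
      by (rule N.I_l_closed[OF x(2) frac_closed]) (use r rs(3) in blast)+
    moreover have "frac s r \<otimes>\<^bsub>L\<^esub> x = frac (s \<otimes>\<^bsub>R\<^esub> r) (r \<otimes>\<^bsub>R\<^esub> s)"
      unfolding rs(1) by (rule frac_mult) (use r rs(2,3) in blast)+
    moreover have "s \<otimes>\<^bsub>R\<^esub> r = r \<otimes>\<^bsub>R\<^esub> s"
      by (rule R.m_comm) (use r rs(3) in blast)+
    moreover have "frac (r \<otimes>\<^bsub>R\<^esub> s) (r \<otimes>\<^bsub>R\<^esub> s) = \<one>\<^bsub>L\<^esub>"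
      by (rule frac_same[OF S.m_closed[OF r rs(3)]])
    ultimately show ?thesis using N.one_imp_carrier by (metis (no_types))
  qed
  show ?thesis by (rule L.maximal_ideals_local[OF J.is_ideal notcarr unit])
qed

text \<open>For the localization L at a maximal ideal, n \<le> depth L \<le> dim L \<le> dim R \<le>
  n, so that all of these are equal.\<close>

theorem cohen_macaulay_ringI:
  assumes R: "cring R" "noetherian_ring R" and dim: "krull_dim R \<le> enat n"
    and reg: "\<And>M. maximalideal M R \<Longrightarrow> \<exists>xs. regular_sequence R xs \<and> set xs \<subseteq> M \<and> length xs = n"
  shows "cohen_macaulay_ring R"
  unfolding cohen_macaulay_ring_def
proof (intro conjI allI impI R)
  fix M assume M: "maximalideal M R"
  interpret R: cring R by fact
  interpret M: primeideal M R by (rule R.maximalideal_prime[OF M])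
  interpret localized_ring R "carrier R - M"
    by (rule localized_ring_at_prime[OF M.primeideal])
  interpret h: extension_hom R L "\<lambda>r. frac r \<one>\<^bsub>R\<^esub>" by (rule frac_extension)
  let ?J = "{frac r s |r s. r \<in> M \<and> s \<in> carrier R - M}"
  have noeth: "noetherian_ring L" by (rule h.noetherian[OF R(2)])
  obtain xs where xs: "regular_sequence R xs" "set xs \<subseteq> M" "length xs = n" using reg[OF M] by blast
  have "Idl\<^bsub>R\<^esub> (set xs) \<subseteq> M" by (rule R.genideal_minimal[OF M.is_ideal xs(2)])
  then have regL: "regular_sequence L (map (\<lambda>r. frac r \<one>\<^bsub>R\<^esub>) xs)"
    by (intro regular_sequence_localization xs) auto
  have "set (map (\<lambda>r. frac r \<one>\<^bsub>R\<^esub>) xs) \<subseteq> ?J"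
    unfolding set_map using xs(2) S.one_closed by blast
  from depth_geI[OF regL this] have "enat n \<le> depth L ?J"
    unfolding length_map xs(3) .
  moreover have "depth L ?J \<le> krull_dim L" by (rule depth_le_krull_dim[OF L.is_cring noeth])
  moreover have "krull_dim L \<le> enat n" using h.krull_dim_le dim by (rule order_trans)
  ultimately have "depth L ?J = krull_dim L" by (meson order_antisym order_trans)
  then show "cohen_macaulay_local_ring L"
    unfolding cohen_macaulay_local_ring_def
    by (intro conjI L.is_cring noeth exI[of _ ?J]
      maximal_ideals_localization[OF R(1) M.primeideal])
qed

section \<open>The maximal minors\<close>

lemma det_mat_2:
  fixes f :: "nat \<times> nat \<Rightarrow> 'a::comm_ring_1"
  shows "det (mat 2 2 f) = f (0, 0) * f (1, 1) - f (0, 1) * f (1, 0)"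
proof -
  have "det (mat 2 2 f) = (\<Sum>j<2. mat 2 2 f $$ (0, j) * cofactor (mat 2 2 f) 0 j)"
    by (rule laplace_expansion_row) auto
  then show ?thesis
    by (simp add: numeral_2_eq_2 lessThan_Suc cofactor_def det_single mat_delete_def)
qed

lemma det_mat_3:
  fixes f :: "nat \<times> nat \<Rightarrow> 'a::comm_ring_1"
  shows "det (mat 3 3 f) = f (0, 0) * (f (1, 1) * f (2, 2) - f (1, 2) * f (2, 1))
    - f (0, 1) * (f (1, 0) * f (2, 2) - f (1, 2) * f (2, 0))
    + f (0, 2) * (f (1, 0) * f (2, 1) - f (1, 1) * f (2, 0))"
proof -
  have *: "mat_delete (mat 3 3 f) 0 j = mat 2 2 (\<lambda>(i, k). f (Suc i, if k < j then k else Suc k))"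
    if "j < 3" for j
    using that by (intro eq_matI) (auto simp: mat_delete_def)
  have "det (mat 3 3 f) = (\<Sum>j<3. mat 3 3 f $$ (0, j) * cofactor (mat 3 3 f) 0 j)"
    by (rule laplace_expansion_row) auto
  also have "\<dots> = (\<Sum>j<3. f (0, j) * ((-1) ^ j * det (mat 2 2 (\<lambda>(i, k). f (Suc i, if k < j then k else Suc k)))))"
    by (intro sum.cong refl) (simp add: cofactor_def *)
  also have "\<dots> = f (0, 0) * (f (1, 1) * f (2, 2) - f (1, 2) * f (2, 1))
    - f (0, 1) * (f (1, 0) * f (2, 2) - f (1, 2) * f (2, 0))
    + f (0, 2) * (f (1, 0) * f (2, 1) - f (1, 1) * f (2, 0))"
    unfolding det_mat_2 by (simp add: eval_nat_numeral lessThan_Suc right_diff_distrib)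
  finally show ?thesis .
qed

lemma pick_triple:
  assumes "i < j" "j < k"
  shows "pick {i, j, k} 0 = i" "pick {i, j, k} 1 = j" "pick {i, j, k} 2 = k"
proof -
  show 0: "pick {i, j, k} 0 = i"
    unfolding pick.simps by (rule Least_equality) (use assms in auto)
  show 1: "pick {i, j, k} 1 = j"
    unfolding One_nat_def pick.simps(2) 0 by (rule Least_equality) (use assms in auto)
  show "pick {i, j, k} 2 = k"
    unfolding numeral_2_eq_2 pick.simps(2)[of _ "Suc 0"] 1[unfolded One_nat_def]
    by (rule Least_equality) (use assms in auto)
qed

section \<open>The minors as explicit cubics\<close>

text \<open>The columns of the first two rows are multiples of the same variable, so the six terms
  of the determinant combine in pairs, one for each choice of the column that supplies the entry of
  the third row.\<close>

definition gamma_minor :: "nat \<Rightarrow> nat \<Rightarrow> nat \<Rightarrow> cpoly" where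
  "gamma_minor i j k = (of_nat i - of_nat j) * (var i * var j * var (k + 1))
     + (of_nat k - of_nat i) * (var i * var (j + 1) * var k)
     + (of_nat j - of_nat k) * (var (i + 1) * var j * var k)"

lemma det_submatrix_gamma_matrix:
  assumes "i < j" "j < k" "k < d"
  shows "det (submatrix (gamma_matrix d) UNIV {i, j, k}) = gamma_minor i j k"
proof -
  have "{c. c < d \<and> c \<in> {i, j, k}} = {i, j, k}" using assms by auto
  moreover have "card {i, j, k} = 3" using assms by auto
  moreover have "pick UNIV r = r" for r by (rule pick_UNIV)
  ultimately have "submatrix (gamma_matrix d) UNIV {i, j, k}
      = mat 3 3 (\<lambda>(r, c). gamma_matrix d $$ (r, pick {i, j, k} c))"
    by (simp add: submatrix_def gamma_matrix_def)
  then show ?thesis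
    using assms pick_triple[OF assms(1,2)]
    by (simp add: det_mat_3 gamma_matrix_def gamma_minor_def algebra_simps)
qed

lemma card_3_sorted:
  fixes J :: "nat set"
  assumes "card J = 3"
  obtains i j k where "J = {i, j, k}" "i < j" "j < k"
proof -
  obtain x y z where "J = {x, y, z}" "x \<noteq> y" "x \<noteq> z" "y \<noteq> z"
    using assms by (auto simp: card_3_iff)
  moreover have "\<exists>i j k. {x, y, z} = {i, j, k} \<and> i < j \<and> j < k"
  proof -
    consider "x < y" "y < z" | "x < z" "z < y" | "y < x" "x < z" | "y < z" "z < x"
      | "z < x" "x < y" | "z < y" "y < x"
      using \<open>x \<noteq> y\<close> \<open>x \<noteq> z\<close> \<open>y \<noteq> z\<close> by linarith
    then show ?thesis by cases (metis insert_commute)+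
  qed
  ultimately show ?thesis using that by metis
qed

lemma maximal_minors_gamma_matrix:
  "maximal_minors (gamma_matrix d) = {gamma_minor i j k |i j k. i < j \<and> j < k \<and> k < d}"
proof (intro equalityI subsetI)
  fix f assume "f \<in> maximal_minors (gamma_matrix d)"
  then obtain J where J: "f = det (submatrix (gamma_matrix d) UNIV J)" "J \<subseteq> {..<d}" "card J = 3"
    by (auto simp: maximal_minors_def gamma_matrix_def)
  obtain i j k where "J = {i, j, k}" "i < j" "j < k" using J(3) by (rule card_3_sorted)
  then show "f \<in> {gamma_minor i j k |i j k. i < j \<and> j < k \<and> k < d}"
    using J det_submatrix_gamma_matrix[of i j k d] by auto
next
  fix f assume "f \<in> {gamma_minor i j k |i j k. i < j \<and> j < k \<and> k < d}"
  then obtain i j k where *: "f = gamma_minor i j k" "i < j" "j < k" "k < d" by blast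
  then have "f = det (submatrix (gamma_matrix d) UNIV {i, j, k})"
    by (simp add: det_submatrix_gamma_matrix)
  moreover have "{i, j, k} \<subseteq> {..<dim_col (gamma_matrix d)}" "card {i, j, k} = dim_row (gamma_matrix d)"
    using * by (auto simp: gamma_matrix_def)
  ultimately show "f \<in> maximal_minors (gamma_matrix d)"
    unfolding maximal_minors_def by blast
qed

definition cubic_monomial :: "nat \<Rightarrow> nat \<Rightarrow> nat \<Rightarrow> nat \<Rightarrow>\<^sub>0 nat" where
  "cubic_monomial a b c =
     Poly_Mapping.single a 1 + Poly_Mapping.single b 1 + Poly_Mapping.single c 1"

lemma var_mult3: "var a * var b * var c = Poly_Mapping.single (cubic_monomial a b c) 1"
  by (simp add: var_def mult_single cubic_monomial_def)

lemma gamma_minor_single: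
  "gamma_minor i j k = Poly_Mapping.single (cubic_monomial i j (k + 1)) (of_nat i - of_nat j)
     + Poly_Mapping.single (cubic_monomial i (j + 1) k) (of_nat k - of_nat i)
     + Poly_Mapping.single (cubic_monomial (i + 1) j k) (of_nat j - of_nat k)"
  unfolding gamma_minor_def var_mult3 constp_of_nat[symmetric] constp_diff[symmetric]
  by (simp add: constp_def mult_single)

lemma cubic_monomial_lookup:
  "Poly_Mapping.lookup (cubic_monomial a b c) x
    = (if x = a then 1 else 0) + (if x = b then 1 else 0) + (if x = c then 1 else 0)"
  by (auto simp: cubic_monomial_def lookup_add lookup_single when_def)

text \<open>A cubic monomial is a multiset of three indices, and the sorted list of a multiset is
  unique.\<close>

lemma cubic_monomial_eq_iff:
  assumes "a \<le> b" "b \<le> c" "a' \<le> b'" "b' \<le> c'"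
  shows "cubic_monomial a b c = cubic_monomial a' b' c' \<longleftrightarrow> a = a' \<and> b = b' \<and> c = c'"
proof
  assume "cubic_monomial a b c = cubic_monomial a' b' c'"
  then have *: "(if x = a then 1 else 0) + (if x = b then 1 else 0) + (if x = c then 1 else (0::nat))
    = (if x = a' then 1 else 0) + (if x = b' then 1 else 0) + (if x = c' then 1 else 0)" for x
    using cubic_monomial_lookup by metis
  have "count (mset [a, b, c]) x = (if x = a then 1 else 0) + (if x = b then 1 else 0)
      + (if x = c then 1 else 0)" for a b c x :: nat
    by auto
  then have "count (mset [a, b, c]) x = count (mset [a', b', c']) x" for x
    using *[of x] by presburger
  then have "mset [a, b, c] = mset [a', b', c']" by (rule multiset_eqI)
  then have "sort [a', b', c'] = [a, b, c]" using assms by (intro properties_for_sort) auto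
  moreover have "sort [a', b', c'] = [a', b', c']" using assms by (intro properties_for_sort) auto
  ultimately show "a = a' \<and> b = b' \<and> c = c'" by simp
qed simp

text \<open>The monomial \<open>m\<^sub>i\<^sub>+\<^sub>1 m\<^sub>j m\<^sub>k\<close> does not contain \<open>m\<^sub>r\<close> for any \<open>r \<le> i\<close>; a minor whose smallest
  column is at most \<open>i\<close> can only contain it in the same position.\<close>

lemma lookup_gamma_minor_leading:
  assumes "i' < j'" "j' < k'" "i < j" "j < k" "i' \<le> i"
  shows "Poly_Mapping.lookup (gamma_minor i' j' k') (cubic_monomial (i + 1) j k)
    = (if i' = i \<and> j' = j \<and> k' = k then of_nat j - of_nat k else 0)"
  using assms
  by (auto simp: gamma_minor_single lookup_add lookup_single when_def cubic_monomial_eq_iff)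

text \<open>By symmetry let i' \<le> i. The leading monomial of the first minor then occurs in the
  second one only if the column triples agree.\<close>

lemma gamma_minor_inject:
  assumes "i < j" "j < k" "i' < j'" "j' < k'" "gamma_minor i j k = gamma_minor i' j' k'"
  shows "i = i' \<and> j = j' \<and> k = k'"
proof -
  have *: "i = i' \<and> j = j' \<and> k = k'"
    if "i < j" "j < k" "i' < j'" "j' < k'" "i' \<le> i" "gamma_minor i j k = gamma_minor i' j' k'"
    for i j k i' j' k'
    using lookup_gamma_minor_leading[OF that(1,2,1,2)]
      lookup_gamma_minor_leading[OF that(3,4,1,2,5)] that by (auto split: if_splits)
  show ?thesis
    using *[OF assms(1-4) _ assms(5)] *[OF assms(3,4,1,2) _ assms(5)[symmetric]]
    by (cases "i' \<le> i") auto
qed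

lemma card_maximal_minors_gamma_matrix: "card (maximal_minors (gamma_matrix d)) = d choose 3"
proof -
  let ?A = "{J. J \<subseteq> {..<d} \<and> card J = 3}"
  have "maximal_minors (gamma_matrix d) = (\<lambda>J. det (submatrix (gamma_matrix d) UNIV J)) ` ?A"
    by (auto simp: maximal_minors_def gamma_matrix_def)
  moreover have "inj_on (\<lambda>J. det (submatrix (gamma_matrix d) UNIV J)) ?A"
  proof (rule inj_onI)
    fix J J' assume *: "J \<in> ?A" "J' \<in> ?A"
      "det (submatrix (gamma_matrix d) UNIV J) = det (submatrix (gamma_matrix d) UNIV J')"
    obtain i j k where J: "J = {i, j, k}" "i < j" "j < k" using card_3_sorted[of J] *(1) by blast
    obtain i' j' k' where J': "J' = {i', j', k'}" "i' < j'" "j' < k'" using card_3_sorted[of J'] *(2) by blast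
    have "gamma_minor i j k = gamma_minor i' j' k'"
      using * J J' det_submatrix_gamma_matrix[of i j k d] det_submatrix_gamma_matrix[of i' j' k' d] by auto
    then show "J = J'" using gamma_minor_inject J J' by blast
  qed
  ultimately have "card (maximal_minors (gamma_matrix d)) = card ?A" by (simp add: card_image)
  also have "\<dots> = d choose 3" using n_subsets[of "{..<d}" 3] by simp
  finally show ?thesis .
qed

lemma gamma_minor_nonzero: "i < j \<Longrightarrow> j < k \<Longrightarrow> gamma_minor i j k \<noteq> 0"
  using lookup_gamma_minor_leading[of i j k i j k] by auto

lemma gamma_minor_homogeneous: "homogeneous 3 (gamma_minor i j k)"
proof -
  have "tdeg a = 3" if "a \<in> Poly_Mapping.keys (gamma_minor i j k)" for a
  proof -
    have "a \<in> {cubic_monomial i j (k + 1), cubic_monomial i (j + 1) k, cubic_monomial (i + 1) j k}"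
      using that by (auto simp: gamma_minor_single in_keys_iff lookup_add lookup_single when_def split: if_splits)
    then show ?thesis by (auto simp: cubic_monomial_def tdeg_add)
  qed
  then show ?thesis by (simp add: homogeneous_def tdeg_def)
qed

lemma gamma_minor_closed [simp]: "i < j \<Longrightarrow> j < k \<Longrightarrow> k < d \<Longrightarrow> gamma_minor i j k \<in> poly_carrier d"
  by (simp add: gamma_minor_def)

text \<open>On the variety m_(n+1) = t (x + n) m_n, so the third row of the matrix is t times the
  first plus t x times the second.\<close>

lemma eval_gamma_minor:
  "eval_cpoly (gamma_minor i j k) (\<lambda>n. if n \<le> d then c * gamma_moment x t n else 0) = 0"
  if "i < j" "j < k" "k < d"
proof -
  have Suc: "gamma_moment x t (n + 1) = t * (x + of_nat n) * gamma_moment x t n" for n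
    by (simp add: gamma_moment_def)
  have "eval_cpoly (gamma_minor i j k) (\<lambda>n. if n \<le> d then c * gamma_moment x t n else 0)
     = c ^ 3 * t * gamma_moment x t i * gamma_moment x t j * gamma_moment x t k *
       ((of_nat i - of_nat j) * (x + of_nat k) + (of_nat k - of_nat i) * (x + of_nat j)
         + (of_nat j - of_nat k) * (x + of_nat i))"
    using that unfolding gamma_minor_def eval_cpoly_add eval_cpoly_mult eval_cpoly_diff
      eval_cpoly_of_nat eval_cpoly_var
    by (simp add: Suc[simplified] power3_eq_cube algebra_simps)
  also have "\<dots> = 0" by (simp add: algebra_simps)
  finally show ?thesis .
qed

section \<open>Generators modulo the minors\<close>

text \<open>The degree of \<open>unit_var a\<close>. Index 1 stands for the factor 1 because m_1 is
  expressed by L and the other variables.\<close>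

definition index_degree :: "nat \<Rightarrow> nat" where
  "index_degree a = (if a = 1 then 0 else 1)"

definition unit_var :: "nat \<Rightarrow> cpoly" where
  "unit_var a = (if a = 1 then 1 else var a)"

locale gamma_ring =
  fixes d :: nat
  assumes d3: "d \<ge> 3"
begin

definition minor_ideal :: "cpoly set" where
  "minor_ideal = Idl\<^bsub>poly_ring d\<^esub> (maximal_minors (gamma_matrix d))"

definition lin :: cpoly where
  "lin = (\<Sum>i\<in>{1..<d}. var i)"

text \<open>An index \<open>(p, q, n, a, c)\<close> stands for \<open>m\<^sub>0\<^sup>p m\<^sub>d\<^sup>q L\<^sup>n y\<^sub>a y\<^sub>c\<close>, where \<open>L = m\<^sub>1 + \<dots> + m\<^sub>d\<^sub>-\<^sub>1\<close>,
  \<open>y\<^sub>1 = 1\<close> and \<open>y\<^sub>i = m\<^sub>i\<close> for \<open>i \<ge> 2\<close>.\<close>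

definition pairs :: "(nat \<times> nat) set" where
  "pairs = {(a, c). 1 \<le> a \<and> a \<le> c \<and> c < d}"

definition indices :: "nat \<Rightarrow> (nat \<times> nat \<times> nat \<times> nat \<times> nat) set" where
  "indices N = {(p, q, n, a, c). (a, c) \<in> pairs \<and>
     p + q + n + index_degree a + index_degree c \<le> N}"

fun basis_elt :: "nat \<times> nat \<times> nat \<times> nat \<times> nat \<Rightarrow> cpoly" where
  "basis_elt (p, q, n, a, c) = var 0 ^ p * var d ^ q * lin ^ n * (unit_var a * unit_var c)"

text \<open>Powers of m_0, m_d and L are part of the index and coefficients are scalars, so that
  modulo the minors this is a finite-dimensional space to which counting applies.\<close>

definition spanned :: "nat \<Rightarrow> cpoly set" where
  "spanned N = {f \<in> poly_carrier d.
     \<exists>u. f - (\<Sum>t\<in>indices N. constp (u t) * basis_elt t) \<in> minor_ideal}"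

lemma minors_closed: "maximal_minors (gamma_matrix d) \<subseteq> poly_carrier d"
  by (auto simp: maximal_minors_gamma_matrix)

lemma ideal_minor_ideal: "ideal minor_ideal (poly_ring d)"
  unfolding minor_ideal_def
  by (rule ring.genideal_ideal[OF cring.axioms(1)[OF cring_poly_ring] minors_closed])

lemmas minor_ideal = poly_ring_idealD[OF ideal_minor_ideal]

lemma gamma_minor_mem: "i < j \<Longrightarrow> j < k \<Longrightarrow> k < d \<Longrightarrow> gamma_minor i j k \<in> minor_ideal"
  unfolding minor_ideal_def
  using ring.genideal_self[OF cring.axioms(1)[OF cring_poly_ring] minors_closed]
  by (auto simp: maximal_minors_gamma_matrix)

lemma finite_pairs: "finite pairs"
  by (rule finite_subset[of _ "{..d} \<times> {..d}"]) (auto simp: pairs_def)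

lemma finite_indices [simp]: "finite (indices N)"
  by (rule finite_subset[of _ "{..N} \<times> {..N} \<times> {..N} \<times> {..d} \<times> {..d}"])
    (auto simp: indices_def pairs_def)

lemma lin_closed [simp]: "lin \<in> poly_carrier d"
  unfolding lin_def by (rule poly_carrier_sum) auto

lemma unit_var_closed [simp]: "a \<le> d \<Longrightarrow> unit_var a \<in> poly_carrier d"
  by (simp add: unit_var_def)

lemma basis_elt_closed: "t \<in> indices N \<Longrightarrow> basis_elt t \<in> poly_carrier d"
  by (cases t) (auto simp: indices_def pairs_def)

lemma indices_mono: "M \<le> N \<Longrightarrow> indices M \<subseteq> indices N"
  by (auto simp: indices_def)

lemma spanned_mono:
  assumes "f \<in> spanned M" "M \<le> N"
  shows "f \<in> spanned N"
proof -
  obtain u where u: "f - (\<Sum>t\<in>indices M. constp (u t) * basis_elt t) \<in> minor_ideal"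
    using assms(1) by (auto simp: spanned_def)
  have "(\<Sum>t\<in>indices N. constp (if t \<in> indices M then u t else 0) * basis_elt t)
      = (\<Sum>t\<in>indices M. constp (u t) * basis_elt t)"
    by (rule sum.mono_neutral_cong_right) (use indices_mono[OF assms(2)] in auto)
  then show ?thesis using assms(1) u
    by (auto simp: spanned_def intro!: exI[of _ "\<lambda>t. if t \<in> indices M then u t else 0"])
qed

lemma spanned_ideal: "f \<in> minor_ideal \<Longrightarrow> f \<in> spanned N"
  using minor_ideal(1) by (auto simp: spanned_def intro!: exI[of _ "\<lambda>_. 0"])

lemma spanned_add: "f \<in> spanned N \<Longrightarrow> g \<in> spanned N \<Longrightarrow> f + g \<in> spanned N"
proof -
  assume f: "f \<in> spanned N" and g: "g \<in> spanned N"
  obtain u where u: "f - (\<Sum>t\<in>indices N. constp (u t) * basis_elt t) \<in> minor_ideal"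
    using f by (auto simp: spanned_def)
  obtain v where v: "g - (\<Sum>t\<in>indices N. constp (v t) * basis_elt t) \<in> minor_ideal"
    using g by (auto simp: spanned_def)
  have "f + g - (\<Sum>t\<in>indices N. constp (u t + v t) * basis_elt t)
    = (f - (\<Sum>t\<in>indices N. constp (u t) * basis_elt t))
      + (g - (\<Sum>t\<in>indices N. constp (v t) * basis_elt t))"
    by (simp add: constp_add distrib_right sum.distrib)
  moreover have "\<dots> \<in> minor_ideal" by (rule minor_ideal(3)[OF u v])
  ultimately have "f + g - (\<Sum>t\<in>indices N. constp (u t + v t) * basis_elt t) \<in> minor_ideal"
    by (rule ssubst)
  then show ?thesis using f g unfolding spanned_def
    by (auto intro!: exI[of _ "\<lambda>t. u t + v t"])
qed

lemma spanned_scale: "f \<in> spanned N \<Longrightarrow> constp c * f \<in> spanned N"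
proof -
  assume f: "f \<in> spanned N"
  obtain u where u: "f - (\<Sum>t\<in>indices N. constp (u t) * basis_elt t) \<in> minor_ideal"
    using f by (auto simp: spanned_def)
  have "constp c * f - (\<Sum>t\<in>indices N. constp (c * u t) * basis_elt t)
    = constp c * (f - (\<Sum>t\<in>indices N. constp (u t) * basis_elt t))"
    by (simp add: constp_mult right_diff_distrib sum_distrib_left mult.assoc)
  moreover have "\<dots> \<in> minor_ideal" by (rule minor_ideal(4)[OF u]) simp
  ultimately have "constp c * f - (\<Sum>t\<in>indices N. constp (c * u t) * basis_elt t) \<in> minor_ideal"
    by (rule ssubst)
  then show ?thesis using f unfolding spanned_def
    by (auto intro!: exI[of _ "\<lambda>t. c * u t"])
qed

lemma spanned_uminus: "f \<in> spanned N \<Longrightarrow> - f \<in> spanned N"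
  using spanned_scale[of f N "-1"] by (simp add: constp_uminus)

lemma spanned_diff: "f \<in> spanned N \<Longrightarrow> g \<in> spanned N \<Longrightarrow> f - g \<in> spanned N"
  using spanned_add[of f N "- g"] spanned_uminus[of g] by simp

lemma spanned_zero: "0 \<in> spanned N"
  by (rule spanned_ideal[OF minor_ideal(2)])

lemma spanned_sum: "(\<And>i. i \<in> A \<Longrightarrow> f i \<in> spanned N) \<Longrightarrow> (\<Sum>i\<in>A. f i) \<in> spanned N"
  by (induction A rule: infinite_finite_induct) (auto simp: spanned_zero spanned_add)

lemma spanned_basis_elt:
  assumes "t \<in> indices N"
  shows "basis_elt t \<in> spanned N"
proof -
  have "(\<Sum>s\<in>indices N. constp (if s = t then 1 else 0) * basis_elt s)
    = (\<Sum>s\<in>indices N. if s = t then basis_elt s else 0)"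
    by (intro sum.cong) auto
  also have "\<dots> = basis_elt t" using assms by simp
  finally show ?thesis using basis_elt_closed[OF assms] minor_ideal(2)
    by (auto simp: spanned_def intro!: exI[of _ "\<lambda>s. if s = t then 1 else 0"])
qed

lemma spanned_mult:
  assumes x: "x \<in> poly_carrier d" and *: "\<And>t. t \<in> indices N \<Longrightarrow> x * basis_elt t \<in> spanned M"
    and f: "f \<in> spanned N"
  shows "x * f \<in> spanned M"
proof -
  obtain u where u: "f - (\<Sum>t\<in>indices N. constp (u t) * basis_elt t) \<in> minor_ideal"
    using f by (auto simp: spanned_def)
  have "x * f = x * (f - (\<Sum>t\<in>indices N. constp (u t) * basis_elt t))
     + (\<Sum>t\<in>indices N. constp (u t) * (x * basis_elt t))"
    by (simp add: right_diff_distrib sum_distrib_left mult.left_commute)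
  moreover have "\<dots> \<in> spanned M"
    by (intro spanned_add spanned_sum spanned_scale * spanned_ideal minor_ideal(4) u x)
  ultimately show ?thesis by (rule ssubst)
qed

lemma spanned_var_0: "f \<in> spanned N \<Longrightarrow> var 0 * f \<in> spanned (Suc N)"
proof (rule spanned_mult)
  fix t assume "t \<in> indices N"
  then obtain p q n a c where t: "t = (p, q, n, a, c)" "(Suc p, q, n, a, c) \<in> indices (Suc N)"
    by (cases t) (auto simp: indices_def)
  have "var 0 * basis_elt t = basis_elt (Suc p, q, n, a, c)" unfolding t(1) basis_elt.simps power_Suc by (simp only: mult_ac)
  then show "var 0 * basis_elt t \<in> spanned (Suc N)" using spanned_basis_elt[OF t(2)] by (rule ssubst)
qed simp_all

lemma spanned_var_d: "f \<in> spanned N \<Longrightarrow> var d * f \<in> spanned (Suc N)"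
proof (rule spanned_mult)
  fix t assume "t \<in> indices N"
  then obtain p q n a c where t: "t = (p, q, n, a, c)" "(p, Suc q, n, a, c) \<in> indices (Suc N)"
    by (cases t) (auto simp: indices_def)
  have "var d * basis_elt t = basis_elt (p, Suc q, n, a, c)" unfolding t(1) basis_elt.simps power_Suc by (simp only: mult_ac)
  then show "var d * basis_elt t \<in> spanned (Suc N)" using spanned_basis_elt[OF t(2)] by (rule ssubst)
qed simp_all

lemma spanned_lin: "f \<in> spanned N \<Longrightarrow> lin * f \<in> spanned (Suc N)"
proof (rule spanned_mult)
  fix t assume "t \<in> indices N"
  then obtain p q n a c where t: "t = (p, q, n, a, c)" "(p, q, Suc n, a, c) \<in> indices (Suc N)"
    by (cases t) (auto simp: indices_def)
  have "lin * basis_elt t = basis_elt (p, q, Suc n, a, c)" unfolding t(1) basis_elt.simps power_Suc by (simp only: mult_ac)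
  then show "lin * basis_elt t \<in> spanned (Suc N)" using spanned_basis_elt[OF t(2)] by (rule ssubst)
qed simp_all

lemma spanned_powers: "f \<in> spanned N \<Longrightarrow> var 0 ^ p * var d ^ q * lin ^ n * f \<in> spanned (p + q + n + N)"
proof -
  assume f: "f \<in> spanned N"
  have "lin ^ n * f \<in> spanned (n + N)"
    by (induction n) (auto simp: f mult.assoc intro: spanned_lin)
  then have "var d ^ q * (lin ^ n * f) \<in> spanned (q + (n + N))"
    by (induction q) (auto simp: mult.assoc intro: spanned_var_d)
  then have "var 0 ^ p * (var d ^ q * (lin ^ n * f)) \<in> spanned (p + (q + (n + N)))"
    by (induction p) (auto simp: mult.assoc intro: spanned_var_0)
  then show ?thesis by (simp add: mult.assoc add.assoc)
qed

lemma var_1_eq: "var 1 = lin - (\<Sum>i\<in>{2..<d}. var i)"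
proof -
  have "{1..<d} = insert 1 {2..<d}" using d3 by auto
  then show ?thesis by (simp add: lin_def)
qed

lemma spanned_one: "1 \<in> spanned 0"
  using spanned_basis_elt[of "(0, 0, 0, 1, 1)" 0] d3
  by (simp add: indices_def pairs_def index_degree_def unit_var_def)

lemma spanned_var: "i \<le> d \<Longrightarrow> var i \<in> spanned 1"
proof -
  assume "i \<le> d"
  have big: "var i \<in> spanned 1" if "2 \<le> i" "i < d" for i
    using spanned_basis_elt[of "(0, 0, 0, 1, i)" 1] that
    by (simp add: indices_def pairs_def index_degree_def unit_var_def)
  have one: "var 1 \<in> spanned 1"
    unfolding var_1_eq using spanned_lin[OF spanned_one]
    by (intro spanned_diff spanned_sum big) auto
  consider "i = 0" | "i = d" | "i = 1" | "2 \<le> i" "i < d" using \<open>i \<le> d\<close> by linarith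
  then show ?thesis
    using spanned_var_0[OF spanned_one] spanned_var_d[OF spanned_one] one big by cases auto
qed

lemma spanned_var_var:
  assumes "i \<le> d" "j \<le> d"
  shows "var i * var j \<in> spanned 2"
proof -
  have sum: "var 1 * var j \<in> spanned 2" if "\<And>i. 2 \<le> i \<Longrightarrow> i < d \<Longrightarrow> var i * var j \<in> spanned 2" "j \<le> d" for j
  proof -
    have "var 1 * var j = lin * var j - (\<Sum>i\<in>{2..<d}. var i * var j)"
      unfolding var_1_eq by (simp add: left_diff_distrib sum_distrib_right)
    moreover have "lin * var j \<in> spanned 2"
      using spanned_lin[OF spanned_var[OF that(2)]] by (simp add: numeral_2_eq_2)
    ultimately show ?thesis using that by (auto intro!: spanned_diff spanned_sum)
  qed
  have 0: "var 0 * var j \<in> spanned 2" "var d * var j \<in> spanned 2" if "j \<le> d" for j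
    using spanned_var_0[OF spanned_var[OF that]] spanned_var_d[OF spanned_var[OF that]]
    by (simp_all add: numeral_2_eq_2)
  have le: "var i * var j \<in> spanned 2" if "2 \<le> i" "i \<le> j" "j < d" for i j
    using spanned_basis_elt[of "(0, 0, 0, i, j)" 2] that
    by (simp add: indices_def pairs_def index_degree_def unit_var_def)
  have big: "var i * var j \<in> spanned 2" if "2 \<le> i" "i < d" "2 \<le> j" "j < d" for i j
    using le[of i j] le[of j i] that by (cases "i \<le> j") (auto simp: mult.commute)
  have big': "var i * var j \<in> spanned 2" if "2 \<le> i" "i < d" "j \<le> d" for i j
  proof -
    consider "j = 0" | "j = d" | "j = 1" | "2 \<le> j" "j < d" using \<open>j \<le> d\<close> by linarith
    then show ?thesis
      using 0[of i] big[of i j] sum[of i] big that by cases (auto simp: mult.commute)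
  qed
  consider "i = 0" | "i = d" | "i = 1" | "2 \<le> i" "i < d" using \<open>i \<le> d\<close> by linarith
  then show ?thesis using 0[OF assms(2)] sum[OF big' assms(2)] big' assms by cases auto
qed

text \<open>Modulo \<open>m\<^sub>0\<close>, \<open>m\<^sub>d\<close> and \<open>L\<close> all cubic monomials vanish: the minor with columns \<open>a - 1, b, c\<close>
  rewrites \<open>m\<^sub>a m\<^sub>b m\<^sub>c\<close> with \<open>b < c\<close> into monomials with smaller smallest index, and \<open>m\<^sub>a m\<^sub>c\<^sup>2\<close> is
  reached by multiplying \<open>m\<^sub>a m\<^sub>c\<close> with \<open>L\<close>.\<close>

lemma spanned_var_var_var:
  assumes "a \<le> b" "b \<le> c" "c \<le> d"
  shows "var a * var b * var c \<in> spanned 3"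
  using assms
proof (induction a arbitrary: b c rule: less_induct)
  case (less a)
  have three: "Suc 2 = 3" by simp
  have zero: "var 0 * var i * var j \<in> spanned 3" if "i \<le> d" "j \<le> d" for i j
    using spanned_var_0[OF spanned_var_var[OF that]] by (simp add: three mult.assoc)
  have top: "var i * var j * var d \<in> spanned 3" if "i \<le> d" "j \<le> d" for i j
    using spanned_var_d[OF spanned_var_var[OF that]] by (simp add: three mult_ac)
  \<comment> \<open>Allowing any \<open>a'\<close> up to \<open>a\<close> makes this available for
    the products that arise from \<open>L\<close> below. The two other monomials of the minor have
    smallest index \<open>e = a' - 1 < a\<close>, so the induction hypothesis covers them.\<close>
  have strict: "var a' * var b * var c \<in> spanned 3" if "a' \<le> a" "a' \<le> b" "b < c" "c \<le> d" for a' b c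
  proof (cases "a' = 0 \<or> c = d")
    case True
    then show ?thesis using zero[of b c] top[of a' b] that by auto
  next
    case False
    then obtain e where e: "a' = Suc e" by (cases a') auto
    have 1: "var e * var b * var (c + 1) \<in> spanned 3"
      using less.IH[of e b "c + 1"] that False e by auto
    have 2: "var e * var (b + 1) * var c \<in> spanned 3"
      using less.IH[of e "b + 1" c] that False e by auto
    have 3: "gamma_minor e b c \<in> spanned 3"
      using spanned_ideal[OF gamma_minor_mem[of e b c]] that False e by auto
    define k :: complex where "k = of_nat b - of_nat c"
    have k: "k \<noteq> 0" using that by (simp add: k_def)
    have "constp k * (var a' * var b * var c) = gamma_minor e b c
        - constp (of_nat e - of_nat b) * (var e * var b * var (c + 1))
        - constp (of_nat c - of_nat e) * (var e * var (b + 1) * var c)"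
      by (simp add: gamma_minor_def e k_def constp_diff constp_of_nat)
    also have "\<dots> \<in> spanned 3" by (intro spanned_diff spanned_scale 1 2 3)
    finally have "constp (inverse k) * (constp k * (var a' * var b * var c)) \<in> spanned 3"
      by (rule spanned_scale)
    moreover have "constp (inverse k) * (constp k * (var a' * var b * var c)) = var a' * var b * var c"
      using k by (simp add: mult.assoc[symmetric] constp_mult[symmetric])
    ultimately show ?thesis by simp
  qed
  show ?case
  proof (cases "b < c \<or> a = 0 \<or> c = d")
    case True
    then show ?thesis using strict[of a b c] zero[of b c] top[of a b] less.prems by auto
  next
    case False
    then have bc: "b = c" "c < d" "1 \<le> a" using less.prems by auto
    have "{1..<d} = insert c ({1..<d} - {c})" using bc less.prems by auto
    then have "lin = var c + (\<Sum>j\<in>{1..<d} - {c}. var j)"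
      unfolding lin_def by (metis finite_atLeastLessThan finite_Diff insert_Diff_single sum.insert_remove Diff_idemp)
    then have "lin * (var a * var c)
        = var c * (var a * var c) + (\<Sum>j\<in>{1..<d} - {c}. var j * (var a * var c))"
      by (simp only: distrib_right sum_distrib_right)
    then have eq: "var a * var b * var c = lin * (var a * var c) - (\<Sum>j\<in>{1..<d} - {c}. var j * var a * var c)"
      by (simp add: bc mult.assoc mult.left_commute[of "var c" "var a"])
    have "lin * (var a * var c) \<in> spanned 3"
      using spanned_lin[OF spanned_var_var[of a c]] less.prems bc by (simp add: three)
    moreover have "var j * var a * var c \<in> spanned 3" if j: "j \<in> {1..<d} - {c}" for j
    proof -
      \<comment> \<open>After sorting, the two largest indices differ, except for m_j m_c m_c with j
        < a = c, whose smallest index is below \<open>a\<close>.\<close>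
      consider "j < a" "a = c" | "j < a" "a < c" | "a \<le> j" "j < c" | "c < j" using j bc less.prems by fastforce
      then show ?thesis
      proof cases
        case 1
        then show ?thesis using less.IH[of j a c] bc by auto
      next
        case 2
        then show ?thesis using strict[of j a c] bc by auto
      next
        case 3
        then show ?thesis using strict[of a j c] bc by (auto simp: mult.commute)
      next
        case 4
        then have "var a * var c * var j \<in> spanned 3" using strict[of a c j] bc j less.prems by auto
        then show ?thesis by (simp add: mult_ac)
      qed
    qed
    ultimately show ?thesis unfolding eq by (intro spanned_diff spanned_sum)
  qed
qed

text \<open>Powers of m_0, m_d and L can be pulled out of a basis element, so multiplication by a
  variable only has to be studied on products of degree at most 3.\<close>

lemma spanned_unit_vars:
  assumes "(a, c) \<in> pairs" "2 \<le> b" "b < d"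
  shows "var b * (unit_var a * unit_var c) \<in> spanned (Suc (index_degree a + index_degree c))"
proof -
  consider "a = 1" "c = 1" | "a = 1" "c \<noteq> 1" | "2 \<le> a" "a \<le> c" "c < d"
    using assms by (auto simp: pairs_def) linarith
  then show ?thesis
  proof cases
    case 1
    then show ?thesis using spanned_var[of b] assms by (simp add: unit_var_def index_degree_def)
  next
    case 2
    then show ?thesis using spanned_var_var[of b c] assms
      by (simp add: unit_var_def index_degree_def pairs_def numeral_2_eq_2)
  next
    case 3
    consider "b \<le> a" | "a \<le> b" "b \<le> c" | "c \<le> b" using 3 by linarith
    then have "var b * (var a * var c) \<in> spanned 3"
      using spanned_var_var_var[of b a c] spanned_var_var_var[of a b c] spanned_var_var_var[of a c b] 3 assms
      by cases (auto simp: mult_ac)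
    then show ?thesis using 3 by (simp add: unit_var_def index_degree_def numeral_3_eq_3)
  qed
qed

lemma spanned_var_mult:
  assumes "i \<le> d" "f \<in> spanned N"
  shows "var i * f \<in> spanned (Suc N)"
proof -
  have big: "var b * f \<in> spanned (Suc N)" if b: "2 \<le> b" "b < d" for b
  proof (rule spanned_mult[OF _ _ assms(2)])
    fix t assume "t \<in> indices N"
    then obtain p q n a c where t: "t = (p, q, n, a, c)" "(a, c) \<in> pairs"
      "p + q + n + index_degree a + index_degree c \<le> N"
      by (cases t) (auto simp: indices_def)
    have "var b * basis_elt t = var 0 ^ p * var d ^ q * lin ^ n * (var b * (unit_var a * unit_var c))"
      unfolding t(1) basis_elt.simps by (simp only: mult_ac)
    moreover have "\<dots> \<in> spanned (Suc N)"
      by (rule spanned_mono[OF spanned_powers[OF spanned_unit_vars[OF t(2) b]]]) (use t(3) in simp)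
    ultimately show "var b * basis_elt t \<in> spanned (Suc N)" by (rule ssubst)
  qed (use b in simp)
  have "var 1 * f = lin * f - (\<Sum>i\<in>{2..<d}. var i * f)"
    unfolding var_1_eq by (simp add: left_diff_distrib sum_distrib_right)
  then have one: "var 1 * f \<in> spanned (Suc N)"
    using big spanned_lin[OF assms(2)] by (auto intro!: spanned_diff spanned_sum)
  consider "i = 0" | "i = d" | "i = 1" | "2 \<le> i" "i < d" using \<open>i \<le> d\<close> by linarith
  then show ?thesis
    using spanned_var_0[OF assms(2)] spanned_var_d[OF assms(2)] one big by cases auto
qed

lemma spanned_monomial:
  "Poly_Mapping.keys a \<subseteq> {..d} \<Longrightarrow> Poly_Mapping.single a 1 \<in> spanned (tdeg a)"
proof (induction "tdeg a" arbitrary: a)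
  case 0
  then have "a = 0" by (auto simp: tdeg_def in_keys_iff intro!: poly_mapping_eqI)
  then show ?case using spanned_one by simp
next
  case (Suc n)
  then have "Poly_Mapping.keys a \<noteq> {}" by (metis tdeg_def sum.empty nat.distinct(1))
  then obtain i where i: "i \<in> Poly_Mapping.keys a" by blast
  define b where "b = a - Poly_Mapping.single i 1"
  have a: "a = Poly_Mapping.single i 1 + b"
  proof (rule poly_mapping_eqI)
    fix k show "Poly_Mapping.lookup a k = Poly_Mapping.lookup (Poly_Mapping.single i 1 + b) k"
      using i by (auto simp: b_def lookup_add lookup_minus lookup_single when_def in_keys_iff)
  qed
  then have "tdeg b = n" using Suc(2) tdeg_add[of "Poly_Mapping.single i 1" b] by simp
  moreover have "Poly_Mapping.keys b \<subseteq> {..d}"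
  proof -
    have "Poly_Mapping.keys b \<subseteq> Poly_Mapping.keys a"
    proof
      fix x assume "x \<in> Poly_Mapping.keys b"
      then have "Poly_Mapping.lookup a x \<noteq> 0"
        by (metis b_def diff_0_eq_0 in_keys_iff lookup_minus)
      then show "x \<in> Poly_Mapping.keys a" by (simp add: in_keys_iff)
    qed
    then show ?thesis using Suc.prems by blast
  qed
  ultimately have "Poly_Mapping.single b 1 \<in> spanned n" using Suc(1)[of b] by auto
  then have "var i * Poly_Mapping.single b 1 \<in> spanned (Suc n)"
    using spanned_var_mult[of i] i Suc.prems by auto
  moreover have "var i * Poly_Mapping.single b 1 = Poly_Mapping.single a 1"
    by (simp add: var_def mult_single a)
  ultimately show ?case using Suc(2) by simp
qed

theorem spanned_degree_le:
  assumes "f \<in> poly_carrier d" "degree_le N f"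
  shows "f \<in> spanned N"
proof -
  have "f = (\<Sum>a\<in>Poly_Mapping.keys f. constp (Poly_Mapping.lookup f a) * Poly_Mapping.single a 1)"
    by (subst cpoly_sum_single) (simp add: constp_def mult_single)
  also have "\<dots> \<in> spanned N"
  proof (intro spanned_sum spanned_scale)
    fix a assume "a \<in> Poly_Mapping.keys f"
    then show "Poly_Mapping.single a 1 \<in> spanned N"
      using assms spanned_mono[OF spanned_monomial] by (auto simp: carrier_poly_ring degree_le_def)
  qed
  finally show ?thesis .
qed

end

section \<open>The minors generate the vanishing ideal\<close>

text \<open>Gaussian elimination: \<open>B\<close> indexes the equations and \<open>I\<close> the
  unknowns; each equation with a nonzero coefficient eliminates one unknown.\<close>

lemma homogeneous_system_nontrivial_solution:
  fixes M :: "'i \<Rightarrow> 'b \<Rightarrow> 'a::field"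
  assumes "finite B" "finite I" "card B < card I"
  shows "\<exists>c. (\<exists>i\<in>I. c i \<noteq> 0) \<and> (\<forall>b\<in>B. (\<Sum>i\<in>I. c i * M i b) = 0)"
  using assms
proof (induction B arbitrary: I M rule: finite_induct)
  case empty
  then obtain i where "i \<in> I" by fastforce
  then show ?case by (intro exI[of _ "\<lambda>_. 1"]) auto
next
  case (insert b B)
  show ?case
  proof (cases "\<forall>i\<in>I. M i b = 0")
    case True
    have "card B < card I" using insert by simp
    from insert.IH[OF insert.prems(1) this, of M] show ?thesis using True by auto
  next
    case False
    then obtain k where k: "k \<in> I" "M k b \<noteq> 0" by blast
    let ?I = "I - {k}"
    have "card B < card ?I" using insert k by (simp add: card_Diff_singleton)
    moreover have "finite ?I" using insert by simp
    ultimately obtain c where c: "\<exists>i\<in>?I. c i \<noteq> 0"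
      "\<And>b'. b' \<in> B \<Longrightarrow> (\<Sum>i\<in>?I. c i * (M i b' - M i b / M k b * M k b')) = 0"
      using insert.IH[of ?I "\<lambda>i b'. M i b' - M i b / M k b * M k b'"] by blast
    \<comment> \<open>Equation \<open>b\<close> determines the value \<open>- e\<close> of the pivot
      unknown \<open>k\<close> from the others.\<close>
    define e where "e = (\<Sum>i\<in>?I. c i * (M i b / M k b))"
    define c' where "c' = c(k := - e)"
    have split: "(\<Sum>i\<in>I. c' i * M i b') = - e * M k b' + (\<Sum>i\<in>?I. c i * M i b')" for b'
      using insert.prems(1) k(1) by (subst sum.remove[of I k]) (auto simp: c'_def intro!: sum.cong)
    have "(\<Sum>i\<in>I. c' i * M i b') = 0" if "b' \<in> insert b B" for b'
    proof (cases "b' = b")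
      case True
      have "e * M k b = (\<Sum>i\<in>?I. c i * M i b)"
        using k(2) by (simp add: e_def sum_distrib_right)
      then show ?thesis by (simp add: split True)
    next
      case False
      then have "(\<Sum>i\<in>?I. c i * M i b') - (\<Sum>i\<in>?I. c i * (M i b / M k b)) * M k b' = 0"
        using c(2)[of b'] that by (simp add: right_diff_distrib sum_subtractf sum_distrib_right mult.assoc)
      then show ?thesis by (simp add: split e_def)
    qed
    moreover have "\<exists>i\<in>I. c' i \<noteq> 0" using c(1) by (auto simp: c'_def)
    ultimately show ?thesis by blast
  qed
qed

text \<open>A polynomial in c that vanishes for all c \<noteq> 0 is zero, so its coefficients vanish
  separately. This splits relations first by degree and then by weight.\<close>

lemma sum_power_eq_0_separate:
  fixes u :: "'i \<Rightarrow> complex"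
  assumes "finite F" "\<And>c. c \<noteq> 0 \<Longrightarrow> (\<Sum>s\<in>F. u s * c ^ N s) = 0"
  shows "(\<Sum>s\<in>{s \<in> F. N s = k}. u s) = 0"
proof -
  define p where "p = (\<Sum>s\<in>F. monom (u s) (N s))"
  have "poly p c = 0" if "c \<noteq> 0" for c
    using assms(2)[OF that] by (simp add: p_def poly_sum poly_monom)
  then have sub: "UNIV - {0} \<subseteq> {c. poly p c = 0}" by auto
  have "infinite (UNIV - {0 :: complex})" using infinite_UNIV_char_0 by (rule infinite_remove)
  then have "p = 0" using sub poly_roots_finite[of p] finite_subset by blast
  then have "0 = coeff p k" by simp
  also have "\<dots> = (\<Sum>s\<in>F. if N s = k then u s else 0)" by (simp add: p_def coeff_sum)
  also have "\<dots> = (\<Sum>s\<in>{s \<in> F. N s = k}. u s)" using assms(1) by (simp add: sum.inter_filter)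
  finally show ?thesis by simp
qed

definition rising :: "nat \<Rightarrow> complex poly" where
  "rising n = (\<Prod>j<n. [:of_nat j, 1:])"

lemma poly_rising: "poly (rising n) x = (\<Prod>j<n. x + of_nat j)"
  by (simp add: rising_def poly_prod add.commute)

lemma gamma_moment_rising: "gamma_moment x t n = t ^ n * poly (rising n) x"
  by (simp add: gamma_moment_def poly_rising)

lemma rising_0 [simp]: "rising 0 = 1"
  by (simp add: rising_def)

text \<open>This is what tells the variables apart: at x = -c exactly the m_n with n > c vanish,
  apart from powers of t.\<close>

lemma poly_rising_eq_0_iff: "poly (rising n) (- of_nat c) = 0 \<longleftrightarrow> c < n"
proof -
  have "- of_nat c + of_nat j = (0::complex) \<longleftrightarrow> j = c" for j
    by (metis add.commute add_right_cancel neg_eq_iff_add_eq_0 of_nat_eq_iff right_minus_eq diff_conv_add_uminus)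
  then show ?thesis by (auto simp: poly_rising)
qed

lemma rising_nonzero: "rising n \<noteq> 0"
  using poly_rising_eq_0_iff[of n n] by auto

section \<open>Independence on the variety\<close>

context gamma_ring
begin

definition gamma_point :: "complex \<Rightarrow> complex \<Rightarrow> complex \<Rightarrow> nat \<Rightarrow> complex" where
  "gamma_point c t x = (\<lambda>n. if n \<le> d then c * gamma_moment x t n else 0)"

text \<open>The polynomials vanishing on the cone over the parametrized points. Working with it
  avoids both homogeneity and the Zariski closure until \<open>vanishing_ideal_eq\<close>.\<close>

definition gamma_ideal :: "cpoly set" where
  "gamma_ideal = {f \<in> poly_carrier d. \<forall>c t x. c \<noteq> 0 \<longrightarrow> eval_cpoly f (gamma_point c t x) = 0}"

lemma ideal_gamma_ideal: "ideal gamma_ideal (poly_ring d)"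
  unfolding poly_ring_ideal_iff by (auto simp: gamma_ideal_def)

lemma minor_ideal_subset: "minor_ideal \<subseteq> gamma_ideal"
proof -
  have "maximal_minors (gamma_matrix d) \<subseteq> gamma_ideal"
    using eval_gamma_minor
    by (auto simp: maximal_minors_gamma_matrix gamma_ideal_def gamma_point_def)
  then show ?thesis
    unfolding minor_ideal_def
    using ring.genideal_minimal[OF cring.axioms(1)[OF cring_poly_ring] ideal_gamma_ideal] by blast
qed

text \<open>Standard monomials for the order in which \<open>m\<^sub>i\<^sub>+\<^sub>1 m\<^sub>j m\<^sub>k\<close> is the leading monomial of the minor
  with columns \<open>i < j < k\<close>: the products of powers of \<open>m\<^sub>0\<close> and \<open>m\<^sub>d\<close> with \<open>1\<close>, \<open>m\<^sub>c\<close> or \<open>m\<^sub>a m\<^sub>c\<^sup>e\<close>,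
  where \<open>a \<le> c\<close> and \<open>e \<ge> 1\<close>.  They are indexed like \<open>basis_elt\<close>, with equal degrees.\<close>

definition core_degree :: "nat \<Rightarrow> nat \<Rightarrow> nat \<Rightarrow> nat" where
  "core_degree n a c = n + index_degree a + index_degree c"

text \<open>Stated for monoids because it is used for variables, for their values, and for rising
  factorials. Degree 1 is a case of its own, since there the single factor has index
  \<open>c\<close> and not \<open>a\<close>.\<close>

definition core_value :: "'a::monoid_mult \<Rightarrow> 'a \<Rightarrow> nat \<Rightarrow> 'a" where
  "core_value ya yc D = (if D = 0 then 1 else if D = 1 then yc else ya * yc ^ (D - 1))"

text \<open>The sum of the indices of the factors, which is the exponent of \<theta> in the
  value.\<close>

definition core_weight :: "nat \<Rightarrow> nat \<Rightarrow> nat \<Rightarrow> nat" where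
  "core_weight a c D = (if D = 0 then 0 else if D = 1 then c else a + (D - 1) * c)"

fun standard :: "nat \<times> nat \<times> nat \<times> nat \<times> nat \<Rightarrow> cpoly" where
  "standard (p, q, n, a, c) = var 0 ^ p * var d ^ q * core_value (var a) (var c) (core_degree n a c)"

fun standard_degree :: "nat \<times> nat \<times> nat \<times> nat \<times> nat \<Rightarrow> nat" where
  "standard_degree (p, q, n, a, c) = p + q + core_degree n a c"

fun standard_weight :: "nat \<times> nat \<times> nat \<times> nat \<times> nat \<Rightarrow> nat" where
  "standard_weight (p, q, n, a, c) = q * d + core_weight a c (core_degree n a c)"

fun standard_poly :: "nat \<times> nat \<times> nat \<times> nat \<times> nat \<Rightarrow> complex poly" where
  "standard_poly (p, q, n, a, c) = rising d ^ q * core_value (rising a) (rising c) (core_degree n a c)"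

lemma eval_core_value:
  "eval_cpoly (core_value f g D) v = core_value (eval_cpoly f v) (eval_cpoly g v) D"
  by (simp add: core_value_def)

lemma eval_standard:
  assumes "s \<in> indices N"
  shows "eval_cpoly (standard s) (gamma_point c t x)
    = c ^ standard_degree s * t ^ standard_weight s * poly (standard_poly s) x"
proof -
  obtain p q n a e where s: "s = (p, q, n, a, e)" and ae: "a \<le> d" "e \<le> d"
    using assms by (cases s) (auto simp: indices_def pairs_def)
  define D where "D = core_degree n a e"
  have "core_value (c * (t ^ a * poly (rising a) x)) (c * (t ^ e * poly (rising e) x)) D
     = c ^ D * t ^ core_weight a e D * poly (core_value (rising a) (rising e) D) x"
  proof (cases "D \<le> 1")
    case True
    then show ?thesis by (cases D) (auto simp: core_value_def core_weight_def)
  next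
    case False
    then obtain k where "D = Suc (Suc k)" by (metis One_nat_def Suc_le_mono not0_implies_Suc not_less_eq_eq le0)
    then show ?thesis
      by (simp add: core_value_def core_weight_def power_mult_distrib power_add power_mult[symmetric] mult_ac)
  qed
  then show ?thesis using ae unfolding s D_def
    by (simp add: eval_core_value gamma_point_def gamma_moment_rising power_mult_distrib power_add
        power_mult[symmetric] mult_ac)
qed

text \<open>For D \<ge> 2 the weight without the m_d part is 1 + (a - 1) + (D - 1) c with a - 1 < c,
  so division with remainder by c recovers a and D. Then n follows from D and a, and p from the
  degree.\<close>

lemma standard_index_unique:
  assumes "(p, q, n, a, c) \<in> indices N" "(p', q, n', a', c) \<in> indices N"
    and deg: "standard_degree (p, q, n, a, c) = standard_degree (p', q, n', a', c)"
    and weight: "standard_weight (p, q, n, a, c) = standard_weight (p', q, n', a', c)"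
  shows "(p, q, n, a, c) = (p', q, n', a', c)"
proof -
  define D D' where "D = core_degree n a c" and "D' = core_degree n' a' c"
  have ac: "1 \<le> a" "a \<le> c" "1 \<le> a'" "a' \<le> c" using assms by (auto simp: indices_def pairs_def)
  have w: "core_weight a c D = core_weight a' c D'" using weight by (simp add: D_def D'_def)
  have small: "a = 1" if "core_degree n a c \<le> 1" "1 \<le> a" "a \<le> c" for n a
    using that by (auto simp: core_degree_def index_degree_def split: if_splits)
  have large: "(a - 1) + (D - 1) * c + 1 = core_weight a c D" if "2 \<le> D" "1 \<le> a" for a D
    using that by (simp add: core_weight_def)
  \<comment> \<open>For D \<le> 1 this weight is at most \<open>c\<close>, so the weight separates
    the two ranges of D.\<close>
  have gt: "core_weight a c D > c" if D: "2 \<le> D" "1 \<le> a" for a D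
  proof -
    obtain k where "D = 2 + k" using D(1) le_Suc_ex by blast
    then show ?thesis using D(2) by (simp add: core_weight_def)
  qed
  have "D = D' \<and> a = a'"
  proof (cases "2 \<le> D")
    case True
    then have "\<not> D' \<le> 1" using gt[of D a] w ac by (auto simp: core_weight_def split: if_splits)
    then have D': "2 \<le> D'" by simp
    have eq: "(a - 1) + (D - 1) * c = (a' - 1) + (D' - 1) * c"
      using large[of D a] large[of D' a'] w ac True D' by linarith
    have "a - 1 < c" "a' - 1 < c" using ac by auto
    then have "a - 1 = a' - 1" "D - 1 = D' - 1"
      using arg_cong[OF eq, of "\<lambda>m. m mod c"] arg_cong[OF eq, of "\<lambda>m. m div c"] by simp_all
    then show ?thesis using ac True D' by auto
  next
    case False
    then have "\<not> 2 \<le> D'" using gt[of D' a'] w ac by (auto simp: core_weight_def split: if_splits)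
    then have "D = D'" using False w ac by (auto simp: core_weight_def split: if_splits)
    then show ?thesis using small[of n a] small[of n' a'] False ac by (simp add: D_def D'_def)
  qed
  then show ?thesis using deg by (auto simp: D_def D'_def core_degree_def)
qed

text \<open>Here c \<ge> 2, which makes the degree positive, so the factor \<open>rising c\<close>
  is really present.\<close>

lemma core_value_eq_0:
  assumes "(p, q, n, a, c) \<in> indices N" "c' < c" "1 \<le> c'"
  shows "poly (core_value (rising a) (rising c) (core_degree n a c)) (- of_nat c') = 0"
proof -
  have "index_degree c = 1" using assms by (auto simp: index_degree_def)
  then have "core_degree n a c \<noteq> 0" by (simp add: core_degree_def)
  moreover have "poly (rising c) (- of_nat c') = 0" using assms by (simp add: poly_rising_eq_0_iff)
  ultimately show ?thesis by (auto simp: core_value_def)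
qed

lemma core_value_nonzero:
  assumes "a \<le> c"
  shows "poly (core_value (rising a) (rising c) D) (- of_nat c) \<noteq> 0"
  using assms poly_rising_eq_0_iff[of c c] poly_rising_eq_0_iff[of a c] by (auto simp: core_value_def)

text \<open>At \<open>x = -c\<close> the polynomial of a standard monomial vanishes if it contains \<open>m\<^sub>d\<close> or some
  \<open>m\<^sub>c\<^sub>'\<close> with \<open>c' > c\<close>.\<close>

lemma standard_independent:
  assumes *: "\<And>c t x. c \<noteq> 0 \<Longrightarrow> (\<Sum>s\<in>indices N. \<gamma> s * eval_cpoly (standard s) (gamma_point c t x)) = 0"
    and s: "s \<in> indices N"
  shows "\<gamma> s = 0"
proof (rule ccontr)
  assume "\<gamma> s \<noteq> 0"
  let ?A = "{r \<in> indices N. standard_degree r = standard_degree s}"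
  let ?B = "{r \<in> ?A. standard_weight r = standard_weight s}"
  have deg: "(\<Sum>r\<in>?A. \<gamma> r * t ^ standard_weight r * poly (standard_poly r) x) = 0" for t x
  proof (rule sum_power_eq_0_separate[OF finite_indices])
    fix c :: complex assume "c \<noteq> 0"
    from *[OF this, of t x]
    show "(\<Sum>r\<in>indices N. \<gamma> r * t ^ standard_weight r * poly (standard_poly r) x * c ^ standard_degree r) = 0"
      by (simp add: eval_standard mult_ac)
  qed
  have weight: "(\<Sum>r\<in>?B. \<gamma> r * poly (standard_poly r) x) = 0" for x
    by (rule sum_power_eq_0_separate) (use deg[of _ x] in \<open>simp_all add: mult_ac\<close>)
  define C where "C = {r \<in> ?B. \<gamma> r \<noteq> 0}"
  have fin: "finite C" by (simp add: C_def)
  have "s \<in> C" using s \<open>\<gamma> s \<noteq> 0\<close> by (simp add: C_def)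
  have mem: "r \<in> indices N" "standard_degree r = standard_degree s"
    "standard_weight r = standard_weight s" "\<gamma> r \<noteq> 0" if "r \<in> C" for r
    using that by (simp_all add: C_def)
  have "poly (\<Sum>r\<in>C. smult (\<gamma> r) (standard_poly r)) x = 0" for x
  proof -
    have "poly (\<Sum>r\<in>C. smult (\<gamma> r) (standard_poly r)) x = (\<Sum>r\<in>?B. \<gamma> r * poly (standard_poly r) x)"
      unfolding poly_sum poly_smult by (rule sum.mono_neutral_left) (auto simp: C_def)
    also have "\<dots> = 0" by (rule weight)
    finally show ?thesis .
  qed
  then have zero: "(\<Sum>r\<in>C. smult (\<gamma> r) (standard_poly r)) = 0"
    using poly_all_0_iff_0 by blast
  define Q where "Q = (\<lambda>r::nat \<times> nat \<times> nat \<times> nat \<times> nat. fst (snd r))"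
  define c where "c = (\<lambda>r::nat \<times> nat \<times> nat \<times> nat \<times> nat. snd (snd (snd (snd r))))"
  \<comment> \<open>The common power of \<open>rising d\<close> must be divided out before
    evaluating at -c0, because it vanishes there.\<close>
  define q0 where "q0 = Min (Q ` C)"
  have q0: "q0 \<le> Q r" if "r \<in> C" for r using that fin unfolding q0_def by (intro Min_le) auto
  have "q0 \<in> Q ` C" using fin \<open>s \<in> C\<close> unfolding q0_def by (intro Min_in) auto
  let ?E = "{r \<in> C. Q r = q0}"
  define c0 where "c0 = Min (c ` ?E)"
  have c0: "c0 \<le> c r" if "r \<in> ?E" for r using that fin unfolding c0_def by (intro Min_le) auto
  have "?E \<noteq> {}" using \<open>q0 \<in> Q ` C\<close> by blast
  then have "c0 \<in> c ` ?E" using fin unfolding c0_def by (intro Min_in) simp_all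
  then obtain r0 where r0: "r0 \<in> C" "Q r0 = q0" "c r0 = c0" by auto
  then obtain p n a where r0': "r0 = (p, q0, n, a, c0)" by (cases r0) (auto simp: Q_def c_def)
  have ac: "1 \<le> a" "a \<le> c0" "c0 < d" using mem(1)[OF r0(1)] unfolding r0' by (auto simp: indices_def pairs_def)
  define H where "H = (\<lambda>r. rising d ^ (Q r - q0) * (case r of (p, q, n, a, c) \<Rightarrow>
    core_value (rising a) (rising c) (core_degree n a c)))"
  have H: "standard_poly r = rising d ^ q0 * H r" if "r \<in> C" for r
    using q0[OF that] by (cases r) (simp add: H_def Q_def mult.assoc[symmetric] power_add[symmetric])
  have "rising d ^ q0 * (\<Sum>r\<in>C. smult (\<gamma> r) (H r)) = (\<Sum>r\<in>C. smult (\<gamma> r) (standard_poly r))"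
    unfolding sum_distrib_left by (rule sum.cong) (auto simp: H)
  then have "(\<Sum>r\<in>C. smult (\<gamma> r) (H r)) = 0" using zero rising_nonzero by simp
  then have "0 = poly (\<Sum>r\<in>C. smult (\<gamma> r) (H r)) (- of_nat c0)" by simp
  also have "\<dots> = (\<Sum>r\<in>C. \<gamma> r * poly (H r) (- of_nat c0))" by (simp add: poly_sum)
  also have "\<dots> = \<gamma> r0 * poly (H r0) (- of_nat c0)"
  proof -
    \<comment> \<open>Terms with a larger exponent of m_d keep a factor \<open>rising d\<close>, and
      terms with a larger last index keep a factor vanishing at -c0. Degree, weight, exponent of m_d
      and last index together determine the term, so only \<open>r0\<close> survives.\<close>
    have "poly (H r) (- of_nat c0) = 0" if r: "r \<in> C" "r \<noteq> r0" for r
    proof (cases "Q r = q0")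
      case False
      then have "Q r - q0 \<noteq> 0" using q0[OF r(1)] by simp
      moreover have "poly (rising d) (- of_nat c0) = 0" using ac by (simp add: poly_rising_eq_0_iff)
      ultimately show ?thesis by (simp add: H_def)
    next
      case True
      obtain p' n' a' c' where r': "r = (p', q0, n', a', c')" using True by (cases r) (auto simp: Q_def)
      have "c0 \<le> c'" using c0[of r] r(1) True r' by (simp add: c_def)
      moreover have "c' \<noteq> c0"
      proof
        assume "c' = c0"
        have "standard_degree r = standard_degree r0" "standard_weight r = standard_weight r0"
          using mem[OF r0(1)] mem[OF r(1)] by simp_all
        then have "r = r0"
          using mem(1)[OF r0(1)] mem(1)[OF r(1)] unfolding r' r0' \<open>c' = c0\<close>
          by (intro standard_index_unique[of _ _ _ _ _ N])
        then show False using r(2) by contradiction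
      qed
      ultimately have "poly (core_value (rising a') (rising c') (core_degree n' a' c')) (- of_nat c0) = 0"
        using core_value_eq_0[of p' q0 n' a' c' N c0] mem(1)[OF r(1)] ac unfolding r' by simp
      then show ?thesis by (simp add: H_def r')
    qed
    then have "(\<Sum>r\<in>C. \<gamma> r * poly (H r) (- of_nat c0)) = (\<Sum>r\<in>{r0}. \<gamma> r * poly (H r) (- of_nat c0))"
      using r0(1) fin by (intro sum.mono_neutral_right) auto
    then show ?thesis by simp
  qed
  finally have "poly (H r0) (- of_nat c0) = 0" using mem(4)[OF r0(1)] by simp
  then show False using core_value_nonzero[OF ac(2)] by (simp add: H_def r0' Q_def)
qed

lemma degree_le_var: "degree_le 1 (var i)"
  by (simp add: degree_le_def var_def)

lemma standard_spanned:
  assumes "s \<in> indices N"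
  shows "standard s \<in> spanned N"
proof -
  obtain p q n a c where s: "s = (p, q, n, a, c)" and ac: "a \<le> d" "c \<le> d"
    and N: "p + q + core_degree n a c \<le> N"
    using assms by (cases s) (auto simp: indices_def pairs_def core_degree_def)
  have "degree_le D (core_value (var a) (var c) D)" for D
  proof (cases "D \<le> 1")
    case False
    then have "degree_le (1 + 1 * (D - 1)) (var a * var c ^ (D - 1))"
      by (intro degree_le_mult degree_le_power degree_le_var)
    then show ?thesis using False by (simp add: core_value_def)
  qed (cases D, auto simp: core_value_def degree_le_var[simplified])
  then have deg: "degree_le (1 * p + 1 * q + core_degree n a c) (standard s)"
    unfolding s standard.simps by (intro degree_le_mult degree_le_power degree_le_var)
  have cl: "standard s \<in> poly_carrier d" using ac by (simp add: s core_value_def)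
  show ?thesis by (rule spanned_degree_le[OF cl degree_le_mono[OF deg]]) (use N in simp)
qed

text \<open>There are as many \<open>standard\<close> as \<open>basis_elt\<close> members of degree at most \<open>N\<close>, and the latter span.\<close>

lemma basis_elt_independent:
  assumes mem: "(\<Sum>t\<in>indices N. constp (u t) * basis_elt t) \<in> gamma_ideal" and t0: "t0 \<in> indices N"
  shows "u t0 = 0"
proof (rule ccontr)
  assume u: "u t0 \<noteq> 0"
  let ?e = "\<lambda>f c t x. eval_cpoly f (gamma_point c t x)"
  have "\<forall>s\<in>indices N. \<exists>w. standard s - (\<Sum>t\<in>indices N. constp (w t) * basis_elt t) \<in> gamma_ideal"
    using standard_spanned minor_ideal_subset by (fastforce simp: spanned_def)
  from bchoice[OF this] obtain w where w: "\<forall>s\<in>indices N.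
      standard s - (\<Sum>t\<in>indices N. constp (w s t) * basis_elt t) \<in> gamma_ideal" ..
  have ev: "?e (standard s) c t x = (\<Sum>r\<in>indices N. w s r * ?e (basis_elt r) c t x)"
    if "s \<in> indices N" "c \<noteq> 0" for s c t x
    using bspec[OF w that(1)] that(2) by (simp add: gamma_ideal_def)
  have "card (indices N - {t0}) < card (indices N)"
    using t0 by (intro psubset_card_mono) auto
  \<comment> \<open>The assumed relation expresses \<open>basis_elt t0\<close> by the other basis
    elements. After this substitution the coefficients of \<open>standard s\<close> are those in the
    bracket; there is one equation fewer than there are unknowns.\<close>
  then obtain \<gamma> where g: "\<exists>s\<in>indices N. \<gamma> s \<noteq> 0"
    "\<And>r. r \<in> indices N - {t0} \<Longrightarrow> (\<Sum>s\<in>indices N. \<gamma> s * (w s r - w s t0 * (u r / u t0))) = 0"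
    using homogeneous_system_nontrivial_solution[of "indices N - {t0}" "indices N"
        "\<lambda>s r. w s r - w s t0 * (u r / u t0)"] finite_indices by blast
  define \<kappa> where "\<kappa> = (\<lambda>r. \<Sum>s\<in>indices N. \<gamma> s * w s r)"
  \<comment> \<open>The coefficients of the resulting combination of standard monomials are
    proportional to \<open>u\<close>, so the combination vanishes on the cone together with the
    assumed relation.\<close>
  have \<kappa>: "\<kappa> r = \<kappa> t0 / u t0 * u r" if "r \<in> indices N" for r
  proof (cases "r = t0")
    case False
    have "\<kappa> r - \<kappa> t0 * (u r / u t0) = (\<Sum>s\<in>indices N. \<gamma> s * (w s r - w s t0 * (u r / u t0)))"
      unfolding \<kappa>_def right_diff_distrib sum_subtractf sum_distrib_right mult.assoc ..
    also have "\<dots> = 0" using g(2)[of r] that False by blast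
    finally show ?thesis by simp
  qed (use u in simp)
  have "(\<Sum>s\<in>indices N. \<gamma> s * ?e (standard s) c t x) = 0" if c: "c \<noteq> 0" for c t x
  proof -
    have "(\<Sum>s\<in>indices N. \<gamma> s * ?e (standard s) c t x)
        = (\<Sum>s\<in>indices N. \<Sum>r\<in>indices N. \<gamma> s * w s r * ?e (basis_elt r) c t x)"
      by (intro sum.cong refl) (simp add: ev c sum_distrib_left mult.assoc)
    also have "\<dots> = (\<Sum>r\<in>indices N. \<Sum>s\<in>indices N. \<gamma> s * w s r * ?e (basis_elt r) c t x)"
      by (rule sum.swap)
    also have "\<dots> = (\<Sum>r\<in>indices N. \<kappa> r * ?e (basis_elt r) c t x)"
      by (simp add: \<kappa>_def sum_distrib_right)
    also have "\<dots> = \<kappa> t0 / u t0 * (\<Sum>r\<in>indices N. u r * ?e (basis_elt r) c t x)"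
      unfolding sum_distrib_left by (intro sum.cong refl) (simp add: \<kappa>)
    also have "(\<Sum>r\<in>indices N. u r * ?e (basis_elt r) c t x) = 0"
      using mem c by (simp add: gamma_ideal_def)
    finally show ?thesis by simp
  qed
  then have "\<gamma> s = 0" if "s \<in> indices N" for s using that by (rule standard_independent)
  then show False using g(1) by blast
qed

text \<open>Modulo the minors an element of the larger ideal is a combination of basis elements,
  which again vanishes on the cone; independence makes it trivial.\<close>

theorem gamma_ideal_eq: "gamma_ideal = minor_ideal"
proof
  show "gamma_ideal \<subseteq> minor_ideal"
  proof
    fix f assume f: "f \<in> gamma_ideal"
    obtain N where "degree_le N f" using degree_le_exists by blast
    then have "f \<in> spanned N" using f by (intro spanned_degree_le) (auto simp: gamma_ideal_def)
    then obtain u where u: "f - (\<Sum>t\<in>indices N. constp (u t) * basis_elt t) \<in> minor_ideal"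
      by (auto simp: spanned_def)
    have "f - (f - (\<Sum>t\<in>indices N. constp (u t) * basis_elt t)) \<in> gamma_ideal"
      by (rule poly_ring_idealD(7)[OF ideal_gamma_ideal f]) (use u minor_ideal_subset in blast)
    then have "u t = 0" if "t \<in> indices N" for t
      using that by (intro basis_elt_independent[of u N]) simp_all
    then show "f \<in> minor_ideal" using u by simp
  qed
qed (rule minor_ideal_subset)

section \<open>From the cone to the projective variety\<close>

text \<open>The vanishing ideal lies between \<open>minor_ideal\<close> and
  \<open>gamma_ideal\<close>: each minor has a closed zero set that contains the parametrized points
  and hence their closure, and conversely these points belong to the closure.\<close>

lemma vanishing_ideal_eq: "vanishing_ideal d (gamma_moment_variety d) = minor_ideal"
proof -
  let ?V = "gamma_moment_variety d"
  let ?G = "{f \<in> homogeneous_polys d. \<forall>p\<in>?V. vanishes_at f p}"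
  have R: "ring (poly_ring d)" by (rule cring.axioms(1)[OF cring_poly_ring])
  have pt: "\<exists>v. gamma_moment_point d k \<theta> = proj_point v \<and> v \<noteq> (\<lambda>_. 0) \<and> (\<forall>i>d. v i = 0)" for k \<theta>
  proof -
    have "(\<lambda>i. if i \<le> d then gamma_moment k \<theta> i else 0) 0 \<noteq> 0" by (simp add: gamma_moment_def)
    then show ?thesis unfolding gamma_moment_point_def
      by (intro exI[of _ "\<lambda>i. if i \<le> d then gamma_moment k \<theta> i else 0"]) (auto simp: fun_eq_iff)
  qed
  have G: "?G \<subseteq> gamma_ideal"
  proof
    fix f assume f: "f \<in> ?G"
    have "eval_cpoly f (gamma_point c t x) = 0" if "c \<noteq> 0" for c t x
    proof -
      have "gamma_moment_point d x t \<in> ?V"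
        unfolding gamma_moment_variety_def zariski_closure_def by (rule hull_inc) blast
      then have "vanishes_at f (gamma_moment_point d x t)" using f by blast
      moreover have "gamma_point c t x \<in> gamma_moment_point d x t"
        using that by (auto simp: gamma_moment_point_def proj_point_def gamma_point_def fun_eq_iff intro!: exI[of _ c])
      ultimately show ?thesis by (simp add: vanishes_at_def)
    qed
    then show "f \<in> gamma_ideal" using f by (simp add: gamma_ideal_def homogeneous_polys_def)
  qed
  have "maximal_minors (gamma_matrix d) \<subseteq> ?G"
  proof
    fix f assume "f \<in> maximal_minors (gamma_matrix d)"
    then obtain i j k where f: "f = gamma_minor i j k" "i < j" "j < k" "k < d"
      by (auto simp: maximal_minors_gamma_matrix)
    have hom: "f \<in> homogeneous_polys d"
      using f gamma_minor_homogeneous by (auto simp: homogeneous_polys_def)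
    let ?Z = "{p \<in> proj_space d. \<forall>f\<in>{f}. vanishes_at f p}"
    have "vanishes_at f (gamma_moment_point d x t)" for x t
      using eval_gamma_minor[OF f(2-4)]
      by (auto simp: vanishes_at_def gamma_moment_point_def proj_point_def f(1) if_distrib cong: if_cong)
    moreover have "gamma_moment_point d x t \<in> proj_space d" for x t
      using pt[of x t] unfolding proj_space_def by auto
    ultimately have "{gamma_moment_point d k \<theta> |k \<theta>. True} \<subseteq> ?Z" by auto
    moreover have "zariski_closed d ?Z"
      unfolding zariski_closed_def using hom by (intro exI[of _ "{f}"]) auto
    ultimately have "?V \<subseteq> ?Z"
      unfolding gamma_moment_variety_def zariski_closure_def by (rule hull_minimal)
    then show "f \<in> ?G" using hom by auto
  qed
  then have "minor_ideal \<subseteq> vanishing_ideal d ?V"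
    unfolding minor_ideal_def vanishing_ideal_def
    by (intro ring.subset_Idl_subset[OF R]) (auto simp: homogeneous_polys_def)
  moreover have "vanishing_ideal d ?V \<subseteq> gamma_ideal"
    unfolding vanishing_ideal_def by (rule ring.genideal_minimal[OF R ideal_gamma_ideal G])
  ultimately show ?thesis using gamma_ideal_eq by blast
qed

end

section \<open>Primality, points of maximal ideals and the basis theorem\<close>

locale unital_hom =
  fixes h :: "'a::comm_ring_1 \<Rightarrow> 'b::comm_ring_1"
  assumes add: "h (a + b) = h a + h b" and mult: "h (a * b) = h a * h b" and one: "h 1 = 1"
begin

lemma zero: "h 0 = 0"
  using add[of 0 0] by simp

lemma uminus: "h (- a) = - h a"
  using add[of a "- a"] by (simp add: zero eq_neg_iff_add_eq_0 add.commute)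

lemma diff: "h (a - b) = h a - h b"
  using add[of a "- b"] by (simp add: uminus)

lemma sum: "h (\<Sum>i\<in>A. f i) = (\<Sum>i\<in>A. h (f i))"
  by (induction A rule: infinite_finite_induct) (auto simp: zero add)

lemma prod: "h (\<Prod>i\<in>A. f i) = (\<Prod>i\<in>A. h (f i))"
  by (induction A rule: infinite_finite_induct) (auto simp: one mult)

end

text \<open>Iterated below to evaluate nested polynomials at L, m_d and m_0.\<close>

definition poly_via :: "('a::comm_ring_1 \<Rightarrow> 'b::comm_ring_1) \<Rightarrow> 'b \<Rightarrow> 'a poly \<Rightarrow> 'b" where
  "poly_via h x p = poly (map_poly h p) x"

context unital_hom
begin

lemma poly_via_pCons: "poly_via h x (pCons a p) = h a + x * poly_via h x p"
  by (simp add: poly_via_def map_poly_pCons zero)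

lemma poly_via_0: "poly_via h x 0 = 0"
  by (simp add: poly_via_def)

lemma poly_via_add: "poly_via h x (p + q) = poly_via h x p + poly_via h x q"
  by (induction p q rule: poly_induct2) (simp_all add: poly_via_pCons poly_via_0 add algebra_simps)

lemma poly_via_smult: "poly_via h x (smult a p) = h a * poly_via h x p"
  by (induction p) (simp_all add: poly_via_pCons poly_via_0 mult algebra_simps)

lemma poly_via_hom: "unital_hom (poly_via h x)"
proof
  show "poly_via h x (p + q) = poly_via h x p + poly_via h x q" for p q
    by (rule poly_via_add)
  show "poly_via h x (p * q) = poly_via h x p * poly_via h x q" for p q
    by (induction p) (simp_all add: poly_via_pCons poly_via_0 poly_via_add poly_via_smult zero algebra_simps)
  show "poly_via h x 1 = 1"
    using poly_via_pCons[of x 1 0] by (simp add: poly_via_0 one one_pCons)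
qed

lemma poly_via_const: "poly_via h x [:a:] = h a"
  by (simp add: poly_via_pCons poly_via_0)

lemma poly_via_linear: "poly_via h x [:- a, 1:] = x - h a"
  by (simp add: poly_via_pCons poly_via_0 one uminus)

lemma poly_via_bounded:
  assumes "\<And>i. n < i \<Longrightarrow> coeff p i = 0"
  shows "poly_via h x p = (\<Sum>i\<le>n. h (coeff p i) * x ^ i)"
proof -
  have "poly_via h x p = (\<Sum>i\<le>degree (map_poly h p). h (coeff p i) * x ^ i)"
    by (simp add: poly_via_def poly_altdef coeff_map_poly zero)
  also have "\<dots> = (\<Sum>i\<le>max n (degree (map_poly h p)). h (coeff p i) * x ^ i)"
  proof (rule sum.mono_neutral_left)
    show "\<forall>i\<in>{..max n (degree (map_poly h p))} - {..degree (map_poly h p)}. h (coeff p i) * x ^ i = 0"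
      using coeff_eq_0[of "map_poly h p"] by (auto simp: coeff_map_poly zero)
  qed auto
  also have "\<dots> = (\<Sum>i\<le>n. h (coeff p i) * x ^ i)"
    by (rule sum.mono_neutral_right) (use assms in \<open>auto simp: zero\<close>)
  finally show ?thesis .
qed

lemma poly_via_monom: "poly_via h x (monom a n) = h a * x ^ n"
  by (induction n) (simp_all add: monom_0 monom_Suc poly_via_pCons poly_via_0 zero mult_ac)

end

interpretation constp: unital_hom constp
  by unfold_locales (simp_all add: constp_add constp_mult)

lemma poly_carrier_poly_via:
  assumes "\<And>a. h a \<in> poly_carrier d" "x \<in> poly_carrier d" "unital_hom h"
  shows "poly_via h x p \<in> poly_carrier d"
proof -
  interpret unital_hom h by fact
  show ?thesis by (induction p) (simp_all add: poly_via_pCons poly_via_0 assms)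
qed

section \<open>A weak Nullstellensatz\<close>

text \<open>Over the complex numbers \<open>p\<close> splits into linear factors; a prime ideal
  contains one of them unless it contains a nonzero constant, which is a unit.\<close>

lemma prime_contains_linear_factor:
  assumes M: "primeideal M (poly_ring d)" and t: "t \<in> poly_carrier d"
    and p: "p \<noteq> 0" "poly_via constp t p \<in> M"
  shows "\<exists>z. t - constp z \<in> M"
  using p
proof (induction "degree p" arbitrary: p)
  interpret M: primeideal M "poly_ring d" by fact
  note M = poly_ring_idealD[OF M.is_ideal]
  {
    case 0
    then obtain a where a: "p = [:a:]" by (metis degree_0_id)
    then have "constp a \<in> M" "a \<noteq> 0" using 0 by (simp_all add: constp.poly_via_const)
    then have "constp (inverse a) * constp a \<in> M" by (intro M(4)) auto
    then have "1 \<in> M" using \<open>a \<noteq> 0\<close> by (simp add: constp_mult[symmetric])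
    then show ?case using M.one_imp_carrier M.I_notcarr by simp
  next
    case (Suc n)
    have "\<not> constant (poly p)" using Suc(2) by (simp add: constant_degree)
    then obtain z where "poly p z = 0" using fundamental_theorem_of_algebra by blast
    then have "[:- z, 1:] dvd p" by (simp only: poly_eq_0_iff_dvd)
    then obtain q where q: "p = [:- z, 1:] * q" by (rule dvdE)
    then have "q \<noteq> 0" using Suc(3) by auto
    then have "degree q = n" using Suc(2) q degree_mult_eq[of "[:- z, 1:]" q] by simp
    interpret v: unital_hom "poly_via constp t" by (rule constp.poly_via_hom)
    have "(t - constp z) * poly_via constp t q \<in> M"
      using Suc(4) unfolding q v.mult constp.poly_via_linear .
    moreover have "poly_via constp t q \<in> poly_carrier d"
      by (rule poly_carrier_poly_via) (use t constp.unital_hom_axioms in auto)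
    ultimately have "t - constp z \<in> M \<or> poly_via constp t q \<in> M"
      using M.I_prime[of "t - constp z" "poly_via constp t q"] t by simp
    then show ?case using Suc(1)[of q] \<open>degree q = n\<close> \<open>q \<noteq> 0\<close> by blast
  }
qed

text \<open>A weak Nullstellensatz.  Otherwise all \<open>t - z\<close> are invertible modulo \<open>M\<close>; uncountably many
  inverses have representatives of bounded degree and are therefore linearly dependent, and clearing
  denominators in a linear relation gives an algebraic equation for \<open>t\<close> modulo \<open>M\<close>.\<close>

lemma maximal_ideal_contains_linear:
  assumes M: "primeideal M (poly_ring d)"
    and inv: "\<And>f. f \<in> poly_carrier d \<Longrightarrow> f \<notin> M \<Longrightarrow> \<exists>g\<in>poly_carrier d. f * g - 1 \<in> M"
    and t: "t \<in> poly_carrier d"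
  shows "\<exists>z. t - constp z \<in> M"
proof (rule ccontr)
  assume none: "\<not> ?thesis"
  interpret M: primeideal M "poly_ring d" by fact
  note I = poly_ring_idealD[OF M.is_ideal]
  have "\<forall>x :: real. \<exists>g. g \<in> poly_carrier d \<and> (t - constp (of_real x)) * g - 1 \<in> M"
    using inv none t by (metis poly_carrier_closed(5) poly_carrier_diff)
  from choice[OF this] obtain g where g: "\<And>x :: real. g x \<in> poly_carrier d"
    "\<And>x :: real. (t - constp (of_real x)) * g x - 1 \<in> M" by blast
  have "\<forall>x. \<exists>N. degree_le N (g x)" by (simp add: degree_le_exists)
  from choice[OF this] obtain e where e: "\<And>x. degree_le (e x) (g x)" by blast
  \<comment> \<open>Uncountably many scalars are distributed over countably many degree
    bounds.\<close>
  have "\<exists>N. infinite {x. e x = N}"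
  proof (rule ccontr)
    assume "\<not> ?thesis"
    then have "countable (\<Union>N. {x. e x = N})" by (intro countable_UN) (auto intro: countable_finite)
    moreover have "(\<Union>N. {x. e x = N}) = UNIV" by auto
    ultimately show False using uncountable_UNIV_real by simp
  qed
  then obtain N where N: "infinite {x. e x = N}" by blast
  define B :: "(nat \<Rightarrow>\<^sub>0 nat) set" where "B = {a. Poly_Mapping.keys a \<subseteq> {..d} \<and> tdeg a \<le> N}"
  have "finite B"
  proof (rule finite_imageD)
    have le: "Poly_Mapping.lookup a i \<le> N" if "a \<in> B" for a i
    proof (cases "i \<in> Poly_Mapping.keys a")
      case True
      then have "Poly_Mapping.lookup a i \<le> tdeg a" unfolding tdeg_def by (intro member_le_sum) auto
      then show ?thesis using that by (simp add: B_def)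
    qed (simp add: in_keys_iff)
    show "finite (Poly_Mapping.lookup ` B)"
    proof (rule finite_subset)
      show "Poly_Mapping.lookup ` B \<subseteq> {f. \<forall>i. (i \<in> {..d} \<longrightarrow> f i \<in> {..N}) \<and> (i \<notin> {..d} \<longrightarrow> f i = 0)}"
        using le by (auto simp: B_def in_keys_iff subset_iff)
      show "finite {f. \<forall>i. (i \<in> {..d} \<longrightarrow> f i \<in> {..N}) \<and> (i \<notin> {..d} \<longrightarrow> f i = (0::nat))}"
        by (rule finite_set_of_finite_funs) auto
    qed
    show "inj_on Poly_Mapping.lookup B" by (auto intro: inj_onI poly_mapping_eqI)
  qed
  obtain X where X: "finite X" "card X = Suc (card B)" "X \<subseteq> {x. e x = N}"
    using infinite_arbitrarily_large[OF N] by blast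
  then obtain c where c: "\<exists>x\<in>X. c x \<noteq> 0"
    "\<forall>a\<in>B. (\<Sum>x\<in>X. c x * Poly_Mapping.lookup (g x) a) = 0"
    using homogeneous_system_nontrivial_solution[OF \<open>finite B\<close>, of X "\<lambda>x a. Poly_Mapping.lookup (g x) a"]
    by auto
  have dep: "(\<Sum>x\<in>X. constp (c x) * g x) = 0"
  proof (rule poly_mapping_eqI)
    fix a
    have l: "Poly_Mapping.lookup (constp b * f) a = b * Poly_Mapping.lookup f a" for b f
      by (simp add: constp_def mult_map_scale_conv_mult[symmetric] Poly_Mapping.map.rep_eq when_def)
    have "Poly_Mapping.lookup (g x) a = 0" if "x \<in> X" "a \<notin> B" for x
    proof (rule ccontr)
      assume "Poly_Mapping.lookup (g x) a \<noteq> 0"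
      then have "a \<in> Poly_Mapping.keys (g x)" by (simp add: in_keys_iff)
      moreover have "e x = N" using that X by auto
      ultimately show False using g(1)[of x] e[of x] that(2)
        unfolding B_def degree_le_def carrier_poly_ring by blast
    qed
    then show "Poly_Mapping.lookup (\<Sum>x\<in>X. constp (c x) * g x) a = Poly_Mapping.lookup 0 a"
      using c(2) by (cases "a \<in> B") (simp_all add: lookup_sum l)
  qed
  let ?l = "\<lambda>x. t - constp (of_real x)"
  have lc: "?l x \<in> poly_carrier d" for x using t by simp
  \<comment> \<open>The numerator of the sum of \<open>c x\<close> / (t - x) over the common
    denominator.\<close>
  define h where "h = (\<Sum>x\<in>X. smult (c x) (\<Prod>y\<in>X - {x}. [:- of_real y, 1:]))"
  interpret v: unital_hom "poly_via constp t" by (rule constp.poly_via_hom)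
  have "poly_via constp t h = (\<Sum>x\<in>X. constp (c x) * (\<Prod>y\<in>X - {x}. ?l y))"
    by (simp add: h_def v.sum v.prod constp.poly_via_smult constp.poly_via_linear)
  \<comment> \<open>Modulo \<open>M\<close> the product without the factor t - x equals the full
    product times \<open>g x\<close>, so the relation \<open>dep\<close> puts the sum into
    \<open>M\<close>.\<close>
  also have "\<dots> = (\<Prod>y\<in>X. ?l y) * (\<Sum>x\<in>X. constp (c x) * g x)
      - (\<Sum>x\<in>X. (constp (c x) * (\<Prod>y\<in>X - {x}. ?l y)) * (?l x * g x - 1))"
  proof -
    have "(\<Prod>y\<in>X. ?l y) * (constp (c x) * g x)
        = constp (c x) * (\<Prod>y\<in>X - {x}. ?l y) * (?l x * g x)" if "x \<in> X" for x
      using X(1) that by (subst prod.remove[of X x]) (simp_all add: mult_ac)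
    then have eq: "(\<Prod>y\<in>X. ?l y) * (\<Sum>x\<in>X. constp (c x) * g x)
        = (\<Sum>x\<in>X. constp (c x) * (\<Prod>y\<in>X - {x}. ?l y) * (?l x * g x))"
      unfolding sum_distrib_left by (rule sum.cong[OF refl])
    have "a * (b - 1) = a * b - a" for a b :: cpoly by (simp add: right_diff_distrib)
    then show ?thesis unfolding eq by (simp only: sum_subtractf) simp
  qed
  also have "\<dots> \<in> M"
    unfolding dep
    by (intro I(7) poly_ring_ideal_sum[OF M.is_ideal] I(4) g(2) poly_carrier_closed poly_carrier_prod lc)
      (simp add: I(2))
  finally have "poly_via constp t h \<in> M" .
  moreover have "h \<noteq> 0"
  proof
    assume "h = 0"
    obtain x where x: "x \<in> X" "c x \<noteq> 0" using c(1) by blast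
    \<comment> \<open>At this point all summands but the one for \<open>x\<close> contain a zero
      factor.\<close>
    have "0 = poly h (of_real x)" using \<open>h = 0\<close> by simp
    also have "\<dots> = (\<Sum>z\<in>X. c z * (\<Prod>y\<in>X - {z}. of_real x - of_real y))"
      by (simp add: h_def poly_sum poly_prod)
    also have "\<dots> = (\<Sum>z\<in>{x}. c z * (\<Prod>y\<in>X - {z}. of_real x - of_real y))"
      by (rule sum.mono_neutral_right) (use X(1) x(1) in auto)
    finally have "(\<Prod>y\<in>X - {x}. of_real x - of_real y) = (0::complex)" using x(2) by simp
    then show False using X(1) by auto
  qed
  ultimately show False using prime_contains_linear_factor[OF M t] none by blast
qed

lemma eval_cpoly_poly_points:
  fixes v :: "nat \<Rightarrow> complex poly"
  shows "\<exists>p. \<forall>s. poly p s = eval_cpoly f (\<lambda>i. poly (v i) s)"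
  by (rule exI[of _ "\<Sum>a\<in>Poly_Mapping.keys f. smult (Poly_Mapping.lookup f a)
      (\<Prod>i\<in>Poly_Mapping.keys a. v i ^ Poly_Mapping.lookup a i)"])
    (simp add: eval_cpoly_def poly_sum poly_prod)

context gamma_ring
begin

text \<open>If neither of two polynomials vanishes on all points \<open>gamma_point c t x\<close> with \<open>c \<noteq> 0\<close>, then
  along the line in the parameter space through two points where they do not vanish, their product
  is a nonzero polynomial.\<close>

lemma primeideal_gamma_ideal: "primeideal gamma_ideal (poly_ring d)"
proof (rule primeidealI[OF ideal_gamma_ideal cring_poly_ring])
  have "1 \<notin> gamma_ideal" by (auto simp: gamma_ideal_def intro: exI[of _ 1])
  then show "poly_carrier d \<noteq> gamma_ideal" using poly_carrier_closed(4) by blast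
  fix f g assume fg: "f \<in> poly_carrier d" "g \<in> poly_carrier d"
    "f \<otimes>\<^bsub>poly_ring d\<^esub> g \<in> gamma_ideal"
  show "f \<in> gamma_ideal \<or> g \<in> gamma_ideal"
  proof (rule ccontr)
    assume "\<not> ?thesis"
    then obtain c t x c' t' x' where
      f: "c \<noteq> 0" "eval_cpoly f (gamma_point c t x) \<noteq> 0" and
      g: "c' \<noteq> 0" "eval_cpoly g (gamma_point c' t' x') \<noteq> 0"
      using fg by (auto simp: gamma_ideal_def)
    define C T X where "C = [:c, c' - c:]" and "T = [:t, t' - t:]" and "X = [:x, x' - x:]"
    define v where "v = (\<lambda>n. if n \<le> d then C * (T ^ n * (\<Prod>j<n. X + [:of_nat j:])) else 0)"
    have v: "(\<lambda>i. poly (v i) s) = gamma_point (poly C s) (poly T s) (poly X s)" for s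
      by (auto simp: v_def gamma_point_def gamma_moment_def poly_prod fun_eq_iff)
    obtain p where p: "\<And>s. poly p s = eval_cpoly f (\<lambda>i. poly (v i) s)"
      using eval_cpoly_poly_points by blast
    obtain q where q: "\<And>s. poly q s = eval_cpoly g (\<lambda>i. poly (v i) s)"
      using eval_cpoly_poly_points by blast
    have "poly p 0 \<noteq> 0" "poly q 1 \<noteq> 0" "poly C 0 \<noteq> 0"
      using f g unfolding p q v by (simp_all add: C_def T_def X_def)
    \<comment> \<open>The factor \<open>C\<close> ensures that the point found on the line has
      nonzero scale.\<close>
    then have "p * q * C \<noteq> 0" by auto
    then obtain s where "poly (p * q * C) s \<noteq> 0" using poly_all_0_iff_0 by blast
    then have "poly C s \<noteq> 0" "eval_cpoly (f * g) (gamma_point (poly C s) (poly T s) (poly X s)) \<noteq> 0"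
      using p[of s] q[of s] unfolding v by auto
    then show False using fg(3) by (auto simp: gamma_ideal_def)
  qed
qed

end

section \<open>Dickson's lemma and Hilbert's basis theorem\<close>

text \<open>A monotone subsequence exists; if it decreases, it is constant from the place where it
  attains its minimum.\<close>

lemma nat_sequence_mono_subsequence:
  fixes f :: "nat \<Rightarrow> nat"
  shows "\<exists>r :: nat \<Rightarrow> nat. strict_mono r \<and> (\<forall>i j. i \<le> j \<longrightarrow> f (r i) \<le> f (r j))"
proof -
  obtain r :: "nat \<Rightarrow> nat" where r: "strict_mono r" "monoseq (\<lambda>n. f (r n))"
    using seq_monosub[of f] by blast
  show ?thesis
  proof (cases "\<forall>m n. m \<le> n \<longrightarrow> f (r m) \<le> f (r n)")
    case True
    then show ?thesis using r(1) by blast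
  next
    case False
    then have decr: "\<And>m n. m \<le> n \<Longrightarrow> f (r n) \<le> f (r m)" using r(2) by (auto simp: monoseq_def)
    define m where "m = (LEAST y. \<exists>n. y = f (r n))"
    have "\<exists>k. m = f (r k)" unfolding m_def by (rule LeastI_ex) blast
    then obtain k where k: "m = f (r k)" ..
    have "m \<le> f (r n)" for n unfolding m_def by (rule Least_le) blast
    then have "f (r (k + n)) = m" for n using decr[of k "k + n"] k by (intro antisym) auto
    moreover have "strict_mono (\<lambda>n. r (k + n))"
      using r(1) by (auto simp: strict_mono_def)
    ultimately show ?thesis by (intro exI[of _ "\<lambda>n. r (k + n)"]) auto
  qed
qed

lemma sequence_mono_subsequence:
  fixes f :: "nat \<Rightarrow> nat \<Rightarrow> nat"
  shows "\<exists>r :: nat \<Rightarrow> nat. strict_mono r \<and> (\<forall>k<n. \<forall>i j. i \<le> j \<longrightarrow> f (r i) k \<le> f (r j) k)"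
proof (induction n)
  case 0
  show ?case by (intro exI[of _ id]) (auto simp: strict_mono_def)
next
  case (Suc n)
  then obtain r :: "nat \<Rightarrow> nat" where r: "strict_mono r" "\<And>k i j. k < n \<Longrightarrow> i \<le> j \<Longrightarrow> f (r i) k \<le> f (r j) k"
    by blast
  obtain q :: "nat \<Rightarrow> nat" where q: "strict_mono q" "\<And>i j. i \<le> j \<Longrightarrow> f (r (q i)) n \<le> f (r (q j)) n"
    using nat_sequence_mono_subsequence[of "\<lambda>i. f (r i) n"] by blast
  have "f (r (q i)) k \<le> f (r (q j)) k" if "k < Suc n" "i \<le> j" for k i j
    using that r(2)[of k "q i" "q j"] q(2)[of i j] strict_mono_less_eq[OF q(1), of i j]
    by (cases "k = n") auto
  moreover have "strict_mono (\<lambda>i. r (q i))" using r(1) q(1) by (auto simp: strict_mono_def)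
  ultimately show ?case by (intro exI[of _ "\<lambda>i. r (q i)"]) auto
qed

text \<open>Dickson's lemma: the first two members of a subsequence that increases in every exponent
  give the divisibility.\<close>

lemma dickson_sequence:
  fixes f :: "nat \<Rightarrow> nat \<Rightarrow>\<^sub>0 nat"
  assumes "\<And>i. Poly_Mapping.keys (f i) \<subseteq> {..d}"
  shows "\<exists>i j m. i < j \<and> f j = m + f i \<and> Poly_Mapping.keys m \<subseteq> {..d}"
proof -
  obtain r :: "nat \<Rightarrow> nat" where r: "strict_mono r"
    "\<And>k i j. k < Suc d \<Longrightarrow> i \<le> j \<Longrightarrow> Poly_Mapping.lookup (f (r i)) k \<le> Poly_Mapping.lookup (f (r j)) k"
    using sequence_mono_subsequence[of "Suc d" "\<lambda>i. Poly_Mapping.lookup (f i)"] by blast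
  have le: "Poly_Mapping.lookup (f (r 0)) k \<le> Poly_Mapping.lookup (f (r 1)) k" for k
  proof (cases "k \<le> d")
    case False
    then have "k \<notin> Poly_Mapping.keys (f (r 0))" using assms by blast
    then show ?thesis by (simp add: in_keys_iff)
  qed (use r(2)[of k 0 1] in simp)
  let ?m = "f (r 1) - f (r 0)"
  have "f (r 1) = ?m + f (r 0)"
    by (rule poly_mapping_eqI) (use le in \<open>simp add: lookup_add lookup_minus\<close>)
  moreover have "Poly_Mapping.keys ?m \<subseteq> {..d}"
  proof
    fix k assume "k \<in> Poly_Mapping.keys ?m"
    then have "Poly_Mapping.lookup (f (r 1)) k \<noteq> 0"
      by (metis diff_0_eq_0 in_keys_iff lookup_minus)
    then show "k \<in> {..d}" using assms[of "r 1"] by (auto simp: in_keys_iff subset_iff)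
  qed
  moreover have "r 0 < r 1" using r(1) by (simp add: strict_mono_def)
  ultimately show ?thesis by blast
qed

lemma monomial_zero_le: "0 \<le> (m :: nat \<Rightarrow>\<^sub>0 nat)"
proof (rule ccontr)
  assume "\<not> ?thesis"
  then have "m < 0" by simp
  then show False by (simp add: less_poly_mapping.rep_eq less_fun_def)
qed

text \<open>The order is lexicographic and not well-founded in infinitely many variables, where m_0
  > m_1 > m_2 > ... descends forever. With finitely many variables Dickson's lemma yields an earlier
  monomial that divides, and hence is at most, a later one.\<close>

lemma wf_bounded_monomials:
  "wf {(a, b :: nat \<Rightarrow>\<^sub>0 nat). Poly_Mapping.keys a \<subseteq> {..d} \<and> Poly_Mapping.keys b \<subseteq> {..d} \<and> a < b}"
  unfolding wf_iff_no_infinite_down_chain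
proof
  assume "\<exists>f. \<forall>i. (f (Suc i), f i) \<in>
    {(a, b :: nat \<Rightarrow>\<^sub>0 nat). Poly_Mapping.keys a \<subseteq> {..d} \<and> Poly_Mapping.keys b \<subseteq> {..d} \<and> a < b}"
  then obtain f :: "nat \<Rightarrow> nat \<Rightarrow>\<^sub>0 nat" where f: "\<And>i. Poly_Mapping.keys (f i) \<subseteq> {..d}" "\<And>i. f (Suc i) < f i"
    by auto
  obtain i j m where ij: "i < j" "f j = m + f i" using dickson_sequence[of f d] f(1) by blast
  have "f (Suc (i + k)) < f i" for k
    by (induction k) (use f(2) in \<open>auto intro: less_trans\<close>)
  then have "f j < f i" using less_imp_Suc_add[OF ij(1)] by blast
  moreover have "f i \<le> f j" unfolding ij(2) using add_right_mono[OF monomial_zero_le[of m], of "f i"] by simp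
  ultimately show False by simp
qed

lemma lookup_single_mult:
  fixes g :: cpoly
  shows "Poly_Mapping.lookup (Poly_Mapping.single m c * g) (m + a) = c * Poly_Mapping.lookup g a"
proof -
  have "Poly_Mapping.single m c * g
    = (\<Sum>b\<in>Poly_Mapping.keys g. Poly_Mapping.single (m + b) (c * Poly_Mapping.lookup g b))"
    by (subst cpoly_sum_single[of g]) (simp add: sum_distrib_left mult_single)
  then show ?thesis by (simp add: lookup_sum lookup_single when_def in_keys_iff)
qed

text \<open>Hilbert's basis theorem: in a sequence of elements of an ideal, each of which is not generated by
  its predecessors and has the smallest possible leading monomial, no leading monomial can divide a
  later one.\<close>

lemma noetherian_poly_ring: "noetherian_ring (poly_ring d)"
proof (rule ring.noetherian_ringI)
  show R: "ring (poly_ring d)" by (rule cring.axioms(1)[OF cring_poly_ring])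
  fix J assume J: "ideal J (poly_ring d)"
  note JD = poly_ring_idealD[OF J]
  let ?I = "\<lambda>A. Idl\<^bsub>poly_ring d\<^esub> A"
  show "\<exists>A\<subseteq>poly_carrier d. finite A \<and> J = ?I A"
  proof (rule ccontr)
    assume nfg: "\<not> ?thesis"
    \<comment> \<open>Elements outside an ideal are nonzero, so the value at 0 never enters the
      minimality condition.\<close>
    define lm :: "cpoly \<Rightarrow> nat \<Rightarrow>\<^sub>0 nat" where "lm f = Max (Poly_Mapping.keys f)" for f
    have lm: "lm f \<in> Poly_Mapping.keys f" "\<And>a. a \<in> Poly_Mapping.keys f \<Longrightarrow> a \<le> lm f" if "f \<noteq> 0" for f
      using that by (auto simp: lm_def intro: Max_in)
    define P where "P f n r \<longleftrightarrow> r \<in> J \<and> r \<notin> ?I (f ` {..<n}) \<and>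
        (\<forall>h\<in>J. h \<notin> ?I (f ` {..<n}) \<longrightarrow> \<not> lm h < lm r)" for f :: "nat \<Rightarrow> cpoly" and n r
    have "\<exists>f. \<forall>n. P f n (f n)"
    proof (rule dependent_wellorder_choice)
      fix r :: cpoly and f g :: "nat \<Rightarrow> cpoly" and n :: nat
      assume "\<And>y. y < n \<Longrightarrow> f y = g y"
      then have "f ` {..<n} = g ` {..<n}" by auto
      then show "P f n r = P g n r" by (simp add: P_def)
    next
      fix n :: nat and f :: "nat \<Rightarrow> cpoly"
      assume "\<And>y. y < n \<Longrightarrow> P f y (f y)"
      then have f: "f y \<in> J" if "y < n" for y using that by (simp add: P_def)
      let ?A = "f ` {..<n}"
      have "?A \<subseteq> J" using f by blast
      then have A: "?A \<subseteq> poly_carrier d" "?I ?A \<subseteq> J"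
        using JD(1) ring.genideal_minimal[OF R J] by blast+
      then have "J \<noteq> ?I ?A" using nfg by blast
      let ?W = "{h \<in> J. h \<notin> ?I ?A}"
      have nz: "h \<noteq> 0" if "h \<in> ?W" for h
        using that poly_ring_idealD(2)[OF ring.genideal_ideal[OF R A(1)]] by auto
      have keys: "Poly_Mapping.keys (lm h) \<subseteq> {..d}" if "h \<in> ?W" for h
        using lm(1)[OF nz[OF that]] JD(1)[of h] that by (auto simp: carrier_poly_ring)
      have "lm ` ?W \<noteq> {}" using \<open>J \<noteq> ?I ?A\<close> A(2) by blast
      then obtain a where a: "a \<in> lm ` ?W" and min: "\<And>b. (b, a) \<in> {(a, b). Poly_Mapping.keys a \<subseteq> {..d} \<and>
          Poly_Mapping.keys b \<subseteq> {..d} \<and> a < b} \<Longrightarrow> b \<notin> lm ` ?W"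
        using wfE_min'[OF wf_bounded_monomials[of d], of "lm ` ?W"] by blast
      obtain r where r: "r \<in> ?W" "a = lm r" using a by blast
      have "\<not> lm h < lm r" if "h \<in> ?W" for h
        using min[of "lm h"] keys[OF that] keys[OF r(1)] that r(2) by auto
      then show "\<exists>r. P f n r" using r(1) unfolding P_def by blast
    qed
    then obtain f where "\<And>n. P f n (f n)" by blast
    then have f: "\<And>n. f n \<in> J" "\<And>n. f n \<notin> ?I (f ` {..<n})"
      and min: "\<And>n h. h \<in> J \<Longrightarrow> h \<notin> ?I (f ` {..<n}) \<Longrightarrow> \<not> lm h < lm (f n)"
      unfolding P_def by blast+
    have sub: "f ` {..<n} \<subseteq> poly_carrier d" for n using f(1) JD(1) by blast
    note ID = poly_ring_idealD[OF ring.genideal_ideal[OF R sub]]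
    have nz: "f n \<noteq> 0" for n using f(2)[of n] ID(2)[of n] by auto
    have keys: "Poly_Mapping.keys (lm (f n)) \<subseteq> {..d}" for n
      using lm(1)[OF nz[of n]] JD(1)[OF f(1)[of n]] by (auto simp: carrier_poly_ring)
    obtain i j m where ij: "i < j" "lm (f j) = m + lm (f i)" "Poly_Mapping.keys m \<subseteq> {..d}"
      using dickson_sequence[of "\<lambda>n. lm (f n)" d] keys by blast
    \<comment> \<open>Chosen so that \<open>f j\<close> and \<open>q\<close> have the same leading
      term; their difference is still new but has a smaller leading monomial.\<close>
    define c where "c = Poly_Mapping.lookup (f j) (lm (f j)) / Poly_Mapping.lookup (f i) (lm (f i))"
    define q where "q = Poly_Mapping.single m c * f i"
    have nzi: "Poly_Mapping.lookup (f i) (lm (f i)) \<noteq> 0" using lm(1)[OF nz[of i]] by (simp add: in_keys_iff)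
    have "f i \<in> ?I (f ` {..<j})" using ring.genideal_self[OF R sub[of j]] ij(1) by blast
    moreover have "Poly_Mapping.single m c \<in> poly_carrier d"
      using ij(3) by (simp add: carrier_poly_ring)
    ultimately have q: "q \<in> ?I (f ` {..<j})" unfolding q_def by (rule ID(4))
    moreover have "?I (f ` {..<j}) \<subseteq> J"
      by (rule ring.genideal_minimal[OF R J]) (use f(1) in blast)
    ultimately have "f j - q \<in> J" using JD(7)[OF f(1)] by blast
    moreover have new: "f j - q \<notin> ?I (f ` {..<j})"
    proof
      assume "f j - q \<in> ?I (f ` {..<j})"
      from ID(3)[OF this q] show False using f(2)[of j] by simp
    qed
    ultimately have "\<not> lm (f j - q) < lm (f j)" by (rule min)
    moreover have "f j - q \<noteq> 0" using new ID(2)[of j] by auto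
    then have "lm (f j - q) \<in> Poly_Mapping.keys (f j - q)" by (rule lm)
    moreover have "a < lm (f j)" if a: "a \<in> Poly_Mapping.keys (f j - q)" for a
    proof -
      have "Poly_Mapping.lookup (f j - q) (lm (f j)) = 0"
        unfolding lookup_minus q_def using nzi
        by (subst (2) ij(2)) (simp add: lookup_single_mult c_def)
      then have "a \<noteq> lm (f j)" using a by (auto simp: in_keys_iff)
      moreover have "a \<le> lm (f j)"
      proof (cases "a \<in> Poly_Mapping.keys (f j)")
        case False
        then have "a \<in> Poly_Mapping.keys q" using a by (auto simp: in_keys_iff lookup_minus)
        then obtain b where b: "a = m + b" "b \<in> Poly_Mapping.keys (f i)"
          using keys_mult[of "Poly_Mapping.single m c" "f i"] unfolding q_def
          by (cases "c = 0") auto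
        show ?thesis unfolding ij(2) b(1) using lm(2)[OF nz[of i] b(2)] by (rule add_left_mono)
      qed (rule lm(2)[OF nz[of j]])
      ultimately show ?thesis by simp
    qed
    ultimately show False by blast
  qed
qed

section \<open>Freeness, regular sequences and dimension\<close>

text \<open>An arbitrary measure \<open>b\<close> of the coefficients lets the bound be iterated
  through nested polynomials.\<close>

lemma poly_coeff_bound:
  fixes f :: "'a::zero poly" and b :: "'a \<Rightarrow> nat"
  shows "\<exists>D. \<forall>p. coeff f p \<noteq> 0 \<longrightarrow> p + b (coeff f p) \<le> D"
proof (intro exI allI impI)
  fix p assume "coeff f p \<noteq> 0"
  then have "p \<le> degree f" by (rule le_degree)
  moreover from this have "b (coeff f p) \<le> (\<Sum>p\<le>degree f. b (coeff f p))"
    by (intro member_le_sum) auto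
  ultimately show "p + b (coeff f p) \<le> degree f + (\<Sum>p\<le>degree f. b (coeff f p))" by simp
qed

lemma poly3_coeff_bound:
  fixes f :: "'a::zero poly poly poly"
  shows "\<exists>D. \<forall>p q n. coeff (coeff (coeff f p) q) n \<noteq> 0 \<longrightarrow> p + (q + n) \<le> D"
proof -
  have "\<forall>g :: 'a poly poly. \<exists>D. \<forall>q. coeff g q \<noteq> 0 \<longrightarrow> q + degree (coeff g q) \<le> D"
    using poly_coeff_bound[of _ degree] by blast
  from choice[OF this] obtain b :: "'a poly poly \<Rightarrow> nat"
    where b: "\<And>g q. coeff g q \<noteq> 0 \<Longrightarrow> q + degree (coeff g q) \<le> b g" by blast
  obtain D where D: "\<And>p. coeff f p \<noteq> 0 \<Longrightarrow> p + b (coeff f p) \<le> D"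
    using poly_coeff_bound[of f b] by blast
  have "p + (q + n) \<le> D" if "coeff (coeff (coeff f p) q) n \<noteq> 0" for p q n
    using that le_degree[of "coeff (coeff f p) q" n] b[of "coeff f p" q] D[of p]
    by (cases "coeff f p = 0"; cases "coeff (coeff f p) q = 0") auto
  then show ?thesis by blast
qed

section \<open>Freeness over the polynomials in m_0, m_d and L\<close>

context gamma_ring
begin

text \<open>The outermost variable is m_0, then m_d, then L. Reduction modulo m_0 - \<alpha> and
  then m_d - \<beta> thus becomes two evaluations from the outside, with synthetic division
  providing the quotients.\<close>

abbreviation eval1 :: "complex poly \<Rightarrow> cpoly" where "eval1 \<equiv> poly_via constp lin"
abbreviation eval2 :: "complex poly poly \<Rightarrow> cpoly" where "eval2 \<equiv> poly_via eval1 (var d)"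
abbreviation eval3 :: "complex poly poly poly \<Rightarrow> cpoly" where "eval3 \<equiv> poly_via eval2 (var 0)"

text \<open>The module map from the free module with basis \<open>pairs\<close> to the polynomial
  ring.\<close>

definition combine :: "(nat \<times> nat \<Rightarrow> complex poly poly poly) \<Rightarrow> cpoly" where
  "combine F = (\<Sum>ac\<in>pairs. eval3 (F ac) * (unit_var (fst ac) * unit_var (snd ac)))"

sublocale eval1: unital_hom eval1 by (rule constp.poly_via_hom)
sublocale eval2: unital_hom eval2 by (rule eval1.poly_via_hom)
sublocale eval3: unital_hom eval3 by (rule eval2.poly_via_hom)

lemma eval3_closed: "eval3 f \<in> poly_carrier d"
  by (intro poly_carrier_poly_via constp.unital_hom_axioms eval1.unital_hom_axioms
      eval2.unital_hom_axioms) simp_all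

lemma combine_closed: "combine F \<in> poly_carrier d"
  unfolding combine_def
  by (intro poly_carrier_sum poly_carrier_closed(2) eval3_closed) (auto simp: pairs_def)

lemma combine_mult: "combine (\<lambda>ac. f * F ac) = eval3 f * combine F"
  by (simp add: combine_def eval3.mult sum_distrib_left mult.assoc)

lemma combine_add: "combine (\<lambda>ac. F ac + G ac) = combine F + combine G"
  by (simp add: combine_def eval3.add sum.distrib distrib_right)

lemma combine_diff: "combine (\<lambda>ac. F ac - G ac) = combine F - combine G"
  by (simp add: combine_def eval3.diff sum_subtractf left_diff_distrib)

lemma eval3_monom:
  "eval3 (monom (monom (monom u n) q) p) = constp u * (var 0 ^ p * var d ^ q * lin ^ n)"
  by (simp add: eval2.poly_via_monom eval1.poly_via_monom constp.poly_via_monom mult_ac)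

lemma eval3_expand:
  assumes "\<And>p q n. coeff (coeff (coeff f p) q) n \<noteq> 0 \<Longrightarrow> p + (q + n) \<le> D"
  shows "eval3 f = (\<Sum>p\<le>D. \<Sum>q\<le>D. \<Sum>n\<le>D.
    constp (coeff (coeff (coeff f p) q) n) * (var 0 ^ p * var d ^ q * lin ^ n))"
proof -
  have z: "coeff (coeff (coeff f p) q) n = 0" if "D < p \<or> D < q \<or> D < n" for p q n
    using assms[of p q n] that by linarith
  have "eval3 f = (\<Sum>p\<le>D. eval2 (coeff f p) * var 0 ^ p)"
    by (rule eval2.poly_via_bounded) (auto intro!: poly_eqI simp: z)
  also have "\<dots> = (\<Sum>p\<le>D. (\<Sum>q\<le>D. eval1 (coeff (coeff f p) q) * var d ^ q) * var 0 ^ p)"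
    by (intro sum.cong refl arg_cong2[where f = "(*)"] eval1.poly_via_bounded)
      (auto intro!: poly_eqI simp: z)
  also have "\<dots> = (\<Sum>p\<le>D. (\<Sum>q\<le>D. (\<Sum>n\<le>D. constp (coeff (coeff (coeff f p) q) n) * lin ^ n) * var d ^ q) * var 0 ^ p)"
    by (intro sum.cong refl arg_cong2[where f = "(*)"] constp.poly_via_bounded) (auto simp: z)
  also have "\<dots> = (\<Sum>p\<le>D. \<Sum>q\<le>D. \<Sum>n\<le>D.
    constp (coeff (coeff (coeff f p) q) n) * (var 0 ^ p * var d ^ q * lin ^ n))"
    by (simp add: sum_distrib_left sum_distrib_right mult_ac)
  finally show ?thesis .
qed

text \<open>Separate bounds for the exponents make sums over indices split into nested sums over
  powers.\<close>

definition box :: "nat \<Rightarrow> (nat \<times> nat \<times> nat \<times> nat \<times> nat) set" where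
  "box D = {..D} \<times> {..D} \<times> {..D} \<times> pairs"

lemma sum_box:
  "(\<Sum>t\<in>box D. constp (w t) * basis_elt t) =
    (\<Sum>ac\<in>pairs. (\<Sum>p\<le>D. \<Sum>q\<le>D. \<Sum>n\<le>D. constp (w (p, q, n, ac)) * (var 0 ^ p * var d ^ q * lin ^ n))
      * (unit_var (fst ac) * unit_var (snd ac)))"
proof -
  have "(\<Sum>t\<in>box D. g t) = (\<Sum>p\<le>D. \<Sum>q\<le>D. \<Sum>n\<le>D. \<Sum>ac\<in>pairs. g (p, q, n, ac))" for g :: "_ \<Rightarrow> cpoly"
    by (simp add: box_def sum.cartesian_product split_def)
  moreover have "constp (w (p, q, n, ac)) * basis_elt (p, q, n, ac)
    = constp (w (p, q, n, ac)) * (var 0 ^ p * var d ^ q * lin ^ n) * (unit_var (fst ac) * unit_var (snd ac))"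
    for p q n ac by (cases ac) (simp add: mult.assoc)
  ultimately show ?thesis
    by (simp only: sum_distrib_right sum.swap[of _ "{..D}" pairs])
qed

lemma finite_box: "finite (box D)"
  by (simp add: box_def finite_pairs)

text \<open>Three exponents contribute at most D each, and the factors y_a and y_c at most 1
  each.\<close>

lemma box_subset: "box D \<subseteq> indices (3 * D + 2)"
  by (auto simp: box_def indices_def index_degree_def)

lemma indices_subset: "indices D \<subseteq> box D"
  by (auto simp: box_def indices_def)

text \<open>Modulo the ideal the ring is free over the polynomials in \<open>m\<^sub>0\<close>, \<open>m\<^sub>d\<close> and \<open>L\<close>, with basis the
  \<open>y\<^sub>a y\<^sub>c\<close>.\<close>

lemma combine_independent:
  assumes "combine F \<in> gamma_ideal" "ac \<in> pairs"
  shows "F ac = 0"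
proof -
  have "\<forall>ac. \<exists>D. \<forall>p q n. coeff (coeff (coeff (F ac) p) q) n \<noteq> 0 \<longrightarrow> p + (q + n) \<le> D"
    using poly3_coeff_bound by blast
  from choice[OF this] obtain b where b: "\<And>ac p q n. coeff (coeff (coeff (F ac) p) q) n \<noteq> 0 \<Longrightarrow> p + (q + n) \<le> b ac"
    by blast
  define D where "D = (\<Sum>ac\<in>pairs. b ac)"
  have bD: "b ac \<le> D" if "ac \<in> pairs" for ac
    unfolding D_def using that finite_pairs by (intro member_le_sum) auto
  define w where "w = (\<lambda>(p, q, n, ac). if (p, q, n, ac) \<in> box D then coeff (coeff (coeff (F ac) p) q) n else 0)"
  have "combine F = (\<Sum>ac\<in>pairs. (\<Sum>p\<le>D. \<Sum>q\<le>D. \<Sum>n\<le>D. constp (w (p, q, n, ac)) * (var 0 ^ p * var d ^ q * lin ^ n))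
      * (unit_var (fst ac) * unit_var (snd ac)))"
    unfolding combine_def
  proof (rule sum.cong[OF refl])
    fix ac assume ac: "ac \<in> pairs"
    have "eval3 (F ac) = (\<Sum>p\<le>D. \<Sum>q\<le>D. \<Sum>n\<le>D.
      constp (coeff (coeff (coeff (F ac) p) q) n) * (var 0 ^ p * var d ^ q * lin ^ n))"
      by (rule eval3_expand) (use b bD[OF ac] order_trans in blast)
    also have "\<dots> = (\<Sum>p\<le>D. \<Sum>q\<le>D. \<Sum>n\<le>D. constp (w (p, q, n, ac)) * (var 0 ^ p * var d ^ q * lin ^ n))"
      by (intro sum.cong refl) (use ac in \<open>auto simp: w_def box_def\<close>)
    finally show "eval3 (F ac) * (unit_var (fst ac) * unit_var (snd ac)) =
      (\<Sum>p\<le>D. \<Sum>q\<le>D. \<Sum>n\<le>D. constp (w (p, q, n, ac)) * (var 0 ^ p * var d ^ q * lin ^ n))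
      * (unit_var (fst ac) * unit_var (snd ac))" by simp
  qed
  also have "\<dots> = (\<Sum>t\<in>box D. constp (w t) * basis_elt t)" by (rule sum_box[symmetric])
  also have "\<dots> = (\<Sum>t\<in>indices (3 * D + 2). constp (w t) * basis_elt t)"
    by (rule sum.mono_neutral_left[OF finite_indices box_subset]) (auto simp: w_def)
  finally have "(\<Sum>t\<in>indices (3 * D + 2). constp (w t) * basis_elt t) \<in> gamma_ideal"
    using assms(1) by (rule subst)
  then have zero: "w t = 0" if "t \<in> indices (3 * D + 2)" for t
    using that by (rule basis_elt_independent)
  have "coeff (coeff (coeff (F ac) p) q) n = 0" for p q n
  proof (rule ccontr)
    assume nz: "coeff (coeff (coeff (F ac) p) q) n \<noteq> 0"
    then have "p + (q + n) \<le> D" using b[OF nz] bD[OF assms(2)] by linarith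
    then have "(p, q, n, ac) \<in> box D" using assms(2) by (simp add: box_def)
    then show False using zero[of "(p, q, n, ac)"] box_subset nz by (auto simp: w_def)
  qed
  then show ?thesis by (intro poly_eqI) simp
qed

lemma combine_surjective:
  assumes "f \<in> poly_carrier d"
  shows "\<exists>F. f - combine F \<in> minor_ideal"
proof -
  obtain N where "degree_le N f" using degree_le_exists by blast
  then have "f \<in> spanned N" using assms by (intro spanned_degree_le)
  then obtain u where u: "f - (\<Sum>t\<in>indices N. constp (u t) * basis_elt t) \<in> minor_ideal"
    by (auto simp: spanned_def)
  define w where "w = (\<lambda>t. if t \<in> indices N then u t else 0)"
  define F where "F = (\<lambda>ac. \<Sum>p\<le>N. \<Sum>q\<le>N. \<Sum>n\<le>N. monom (monom (monom (w (p, q, n, ac)) n) q) p)"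
  have "combine F = (\<Sum>t\<in>box N. constp (w t) * basis_elt t)"
    unfolding sum_box combine_def F_def eval3.sum eval3_monom ..
  also have "\<dots> = (\<Sum>t\<in>indices N. constp (u t) * basis_elt t)"
    by (rule sum.mono_neutral_cong_right[OF finite_box indices_subset]) (auto simp: w_def)
  finally have "f - combine F \<in> minor_ideal" using u by (rule ssubst)
  then show ?thesis by (rule exI[of _ F])
qed

lemma combine_mod:
  assumes "f - combine F \<in> minor_ideal" "g \<in> poly_carrier d"
  shows "g * f - g * combine F \<in> minor_ideal"
  using minor_ideal(4)[OF assms] by (simp add: right_diff_distrib)

section \<open>Nonzerodivisors\<close>

definition X0 :: "complex \<Rightarrow> complex poly poly poly" where "X0 \<alpha> = [:- [:[:\<alpha>:]:], 1:]"
definition Xd :: "complex \<Rightarrow> complex poly poly poly" where "Xd \<beta> = [:[:- [:\<beta>:], 1:]:]"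
definition XL :: "complex \<Rightarrow> complex poly poly poly" where "XL \<gamma> = [:[:[:- \<gamma>, 1:]:]:]"

lemma eval3_X0: "eval3 (X0 \<alpha>) = var 0 - constp \<alpha>"
  unfolding X0_def eval2.poly_via_linear eval1.poly_via_const constp.poly_via_const ..

lemma eval3_Xd: "eval3 (Xd \<beta>) = var d - constp \<beta>"
  unfolding Xd_def eval2.poly_via_const eval1.poly_via_linear constp.poly_via_const ..

lemma eval3_XL: "eval3 (XL \<gamma>) = lin - constp \<gamma>"
  unfolding XL_def eval2.poly_via_const eval1.poly_via_const constp.poly_via_linear ..

lemma poly_X0_mult: "poly (X0 \<alpha> * f) [:[:\<alpha>:]:] = 0"
  unfolding poly_mult by (simp add: X0_def)

lemma poly_Xd_mult: "poly (Xd \<beta> * f) a = [:- [:\<beta>:], 1:] * poly f a"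
  unfolding poly_mult by (simp add: Xd_def)

lemma poly_poly_Xd_mult: "poly (poly (Xd \<beta> * f) a) [:\<beta>:] = 0"
  unfolding poly_mult by (simp add: Xd_def)

lemma poly_poly_XL_mult: "poly (poly (XL \<gamma> * f) a) b = [:- \<gamma>, 1:] * poly (poly f a) b"
  unfolding poly_mult by (simp add: XL_def)

text \<open>Freeness turns the congruence into an identity of polynomials for each basis member.
  Putting m_0 = \<alpha> leaves (m_d - \<beta>) F(\<alpha>) = 0, so F(\<alpha>) = 0 and division of
  F by m_0 - \<alpha> is exact.\<close>

lemma nonzerodivisor_var_d:
  assumes f: "f \<in> poly_carrier d" and g: "g \<in> poly_carrier d"
    and eq: "(var d - constp \<beta>) * f - (var 0 - constp \<alpha>) * g \<in> minor_ideal"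
  shows "\<exists>h\<in>poly_carrier d. f - (var 0 - constp \<alpha>) * h \<in> minor_ideal"
proof -
  obtain F where F: "f - combine F \<in> minor_ideal" using combine_surjective[OF f] by blast
  obtain G where G: "g - combine G \<in> minor_ideal" using combine_surjective[OF g] by blast
  have 1: "(var d - constp \<beta>) * f - (var d - constp \<beta>) * combine F \<in> minor_ideal"
    by (rule combine_mod[OF F]) simp
  have 2: "(var 0 - constp \<alpha>) * g - (var 0 - constp \<alpha>) * combine G \<in> minor_ideal"
    by (rule combine_mod[OF G]) simp
  have "combine (\<lambda>ac. Xd \<beta> * F ac - X0 \<alpha> * G ac)
    = ((var d - constp \<beta>) * f - (var 0 - constp \<alpha>) * g)
      - ((var d - constp \<beta>) * f - (var d - constp \<beta>) * combine F)
      + ((var 0 - constp \<alpha>) * g - (var 0 - constp \<alpha>) * combine G)"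
    unfolding combine_diff combine_mult eval3_X0 eval3_Xd by simp
  also have "\<dots> \<in> minor_ideal" by (intro minor_ideal(3,7) eq 1 2)
  finally have "Xd \<beta> * F ac - X0 \<alpha> * G ac = 0" if "ac \<in> pairs" for ac
    using combine_independent[of "\<lambda>ac. Xd \<beta> * F ac - X0 \<alpha> * G ac"] that gamma_ideal_eq by simp
  then have "poly (Xd \<beta> * F ac) [:[:\<alpha>:]:] = poly (X0 \<alpha> * G ac) [:[:\<alpha>:]:]" if "ac \<in> pairs" for ac
    using that by simp
  then have "[:- [:\<beta>:], 1:] * poly (F ac) [:[:\<alpha>:]:] = 0" if "ac \<in> pairs" for ac
    using that unfolding poly_Xd_mult poly_X0_mult .
  then have zero: "poly (F ac) [:[:\<alpha>:]:] = 0" if "ac \<in> pairs" for ac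
    using that by (simp only: mult_eq_0_iff pCons_eq_0_iff one_neq_zero simp_thms)
  define H where "H = (\<lambda>ac. synthetic_div (F ac) [:[:\<alpha>:]:])"
  have "combine F = combine (\<lambda>ac. X0 \<alpha> * H ac)"
    unfolding combine_def
  proof (rule sum.cong[OF refl])
    fix ac assume "ac \<in> pairs"
    then have "F ac = X0 \<alpha> * H ac"
      using synthetic_div_correct'[of "[:[:\<alpha>:]:]" "F ac"] zero by (simp add: X0_def H_def)
    then show "eval3 (F ac) * (unit_var (fst ac) * unit_var (snd ac))
      = eval3 (X0 \<alpha> * H ac) * (unit_var (fst ac) * unit_var (snd ac))" by simp
  qed
  then have "combine F = (var 0 - constp \<alpha>) * combine H" unfolding combine_mult eval3_X0 .
  then show ?thesis using F combine_closed[of H] by auto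
qed

text \<open>As for m_d, but with m_0 = \<alpha> and m_d = \<beta> substituted, after which only the
  factor L - \<gamma> is left to be cancelled.\<close>

lemma nonzerodivisor_lin:
  assumes f: "f \<in> poly_carrier d" and g: "g \<in> poly_carrier d" and h: "h \<in> poly_carrier d"
    and eq: "(lin - constp \<gamma>) * f - (g * (var 0 - constp \<alpha>) + h * (var d - constp \<beta>)) \<in> minor_ideal"
  shows "\<exists>g\<in>poly_carrier d. \<exists>h\<in>poly_carrier d.
    f - (g * (var 0 - constp \<alpha>) + h * (var d - constp \<beta>)) \<in> minor_ideal"
proof -
  obtain F where F: "f - combine F \<in> minor_ideal" using combine_surjective[OF f] by blast
  obtain G where G: "g - combine G \<in> minor_ideal" using combine_surjective[OF g] by blast
  obtain H where H: "h - combine H \<in> minor_ideal" using combine_surjective[OF h] by blast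
  have 1: "(lin - constp \<gamma>) * f - (lin - constp \<gamma>) * combine F \<in> minor_ideal"
    by (rule combine_mod[OF F]) simp
  have 2: "(var 0 - constp \<alpha>) * g - (var 0 - constp \<alpha>) * combine G \<in> minor_ideal"
    by (rule combine_mod[OF G]) simp
  have 3: "(var d - constp \<beta>) * h - (var d - constp \<beta>) * combine H \<in> minor_ideal"
    by (rule combine_mod[OF H]) simp
  have "combine (\<lambda>ac. XL \<gamma> * F ac - (X0 \<alpha> * G ac + Xd \<beta> * H ac))
    = ((lin - constp \<gamma>) * f - (g * (var 0 - constp \<alpha>) + h * (var d - constp \<beta>)))
      - ((lin - constp \<gamma>) * f - (lin - constp \<gamma>) * combine F)
      + ((var 0 - constp \<alpha>) * g - (var 0 - constp \<alpha>) * combine G)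
      + ((var d - constp \<beta>) * h - (var d - constp \<beta>) * combine H)"
    unfolding combine_diff combine_add combine_mult eval3_X0 eval3_Xd eval3_XL by (simp add: algebra_simps)
  also have "\<dots> \<in> minor_ideal" by (intro minor_ideal(3,7) eq 1 2 3)
  finally have "XL \<gamma> * F ac - (X0 \<alpha> * G ac + Xd \<beta> * H ac) = 0" if "ac \<in> pairs" for ac
    using combine_independent[of "\<lambda>ac. XL \<gamma> * F ac - (X0 \<alpha> * G ac + Xd \<beta> * H ac)"] that gamma_ideal_eq by simp
  then have "poly (poly (XL \<gamma> * F ac) [:[:\<alpha>:]:]) [:\<beta>:]
    = poly (poly (X0 \<alpha> * G ac + Xd \<beta> * H ac) [:[:\<alpha>:]:]) [:\<beta>:]" if "ac \<in> pairs" for ac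
    using that by simp
  then have "[:- \<gamma>, 1:] * poly (poly (F ac) [:[:\<alpha>:]:]) [:\<beta>:] = 0" if "ac \<in> pairs" for ac
    using that
    unfolding poly_add poly_poly_XL_mult poly_poly_Xd_mult poly_X0_mult poly_0 add_0_left .
  then have zero: "poly (poly (F ac) [:[:\<alpha>:]:]) [:\<beta>:] = 0" if "ac \<in> pairs" for ac
    using that by (simp only: mult_eq_0_iff pCons_eq_0_iff one_neq_zero simp_thms)
  define G' where "G' = (\<lambda>ac. synthetic_div (F ac) [:[:\<alpha>:]:])"
  \<comment> \<open>The remainder of \<open>F ac\<close> on division by m_0 - \<alpha> is free of
    m_0, and it is divisible by m_d - \<beta> because it vanishes at \<beta>.\<close>
  define H' where "H' = (\<lambda>ac. [:synthetic_div (poly (F ac) [:[:\<alpha>:]:]) [:\<beta>:]:])"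
  have "combine F = combine (\<lambda>ac. X0 \<alpha> * G' ac + Xd \<beta> * H' ac)"
    unfolding combine_def
  proof (rule sum.cong[OF refl])
    fix ac assume ac: "ac \<in> pairs"
    have "poly (F ac) [:[:\<alpha>:]:] = [:- [:\<beta>:], 1:] * synthetic_div (poly (F ac) [:[:\<alpha>:]:]) [:\<beta>:]"
      using synthetic_div_correct'[of "[:\<beta>:]" "poly (F ac) [:[:\<alpha>:]:]"] zero[OF ac] by simp
    then have "[:poly (F ac) [:[:\<alpha>:]:]:] = Xd \<beta> * H' ac"
      unfolding Xd_def H'_def by simp
    then have "F ac = X0 \<alpha> * G' ac + Xd \<beta> * H' ac"
      using synthetic_div_correct'[of "[:[:\<alpha>:]:]" "F ac"] by (simp add: X0_def G'_def)
    then show "eval3 (F ac) * (unit_var (fst ac) * unit_var (snd ac))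
      = eval3 (X0 \<alpha> * G' ac + Xd \<beta> * H' ac) * (unit_var (fst ac) * unit_var (snd ac))" by simp
  qed
  then have "combine F = combine G' * (var 0 - constp \<alpha>) + combine H' * (var d - constp \<beta>)"
    unfolding combine_add combine_mult eval3_X0 eval3_Xd by (simp add: mult.commute)
  then show ?thesis using F combine_closed[of G'] combine_closed[of H'] by auto
qed

section \<open>Chains of primes\<close>

lemma card_indices_le: "card (indices N) \<le> (N + 1) ^ 3 * (d * d)"
proof -
  have "card (indices N) \<le> card ({..N} \<times> {..N} \<times> {..N} \<times> {..<d} \<times> {..<d})"
    by (rule card_mono) (auto simp: indices_def pairs_def)
  also have "\<dots> = (N + 1) ^ 3 * (d * d)"
    by (simp only: card_cartesian_product card_atMost card_lessThan Suc_eq_plus1 power3_eq_cube mult.assoc)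
  finally show ?thesis .
qed

end

text \<open>Take the lowest index m not marked by \<open>Z\<close> and write the relation as x^m
  (g_m + x r). Since x is outside the prime \<open>Q\<close>, the factor x^m cancels, and modulo
  \<open>Q'\<close>, which contains x, only g_m remains. The predicate \<open>Z\<close> records that
  the coefficients of \<open>g j\<close> vanish formally, which is stronger than
  \<open>g j = 0\<close>.\<close>

lemma prime_chain_step:
  assumes Q: "primeideal Q (poly_ring d)" and Q': "primeideal Q' (poly_ring d)" "Q \<subseteq> Q'"
    and x: "x \<in> Q'" "x \<notin> Q" and g: "\<And>j. g j \<in> poly_carrier d"
    and mem: "(\<Sum>j<K. x ^ j * g j) \<in> Q"
    and Z: "\<And>j. Z j \<Longrightarrow> g j = 0" "\<exists>j<K. \<not> Z j"
  shows "\<exists>j<K. \<not> Z j \<and> g j \<in> Q'"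
proof -
  interpret Q: primeideal Q "poly_ring d" by fact
  interpret Q': primeideal Q' "poly_ring d" by fact
  note QI = poly_ring_idealD[OF Q'.is_ideal]
  have xc: "x \<in> poly_carrier d" by (rule QI(1)[OF x(1)])
  define m where "m = (LEAST j. j < K \<and> \<not> Z j)"
  have m: "m < K" "\<not> Z m" using LeastI_ex[OF Z(2)] by (simp_all add: m_def)
  have less: "g j = 0" if "j < m" for j
    using not_less_Least[of j "\<lambda>j. j < K \<and> \<not> Z j"] that m(1) Z(1) by (auto simp: m_def)
  define r where "r = (\<Sum>j\<in>{Suc m..<K}. x ^ (j - Suc m) * g j)"
  have "(\<Sum>j<K. x ^ j * g j) = (\<Sum>j\<in>{m..<K}. x ^ j * g j)"
    by (rule sum.mono_neutral_right) (use less in auto)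
  also have "\<dots> = x ^ m * g m + (\<Sum>j\<in>{Suc m..<K}. x ^ j * g j)"
    using m(1) by (simp add: sum.atLeast_Suc_lessThan)
  also have "(\<Sum>j\<in>{Suc m..<K}. x ^ j * g j) = (\<Sum>j\<in>{Suc m..<K}. x ^ m * (x * (x ^ (j - Suc m) * g j)))"
  proof (rule sum.cong[OF refl])
    fix j assume "j \<in> {Suc m..<K}"
    then have "x ^ j = x ^ m * (x * x ^ (j - Suc m))"
      by (simp add: power_add[symmetric] power_Suc[symmetric] del: power_Suc)
    then show "x ^ j * g j = x ^ m * (x * (x ^ (j - Suc m) * g j))" by (simp only: mult.assoc)
  qed
  also have "x ^ m * g m + \<dots> = x ^ m * (g m + x * r)"
    by (simp only: r_def sum_distrib_left distrib_left)
  finally have in_Q: "x ^ m * (g m + x * r) \<in> Q" using mem by simp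
  have rc: "r \<in> poly_carrier d" unfolding r_def by (intro poly_carrier_sum poly_carrier_closed(2) poly_carrier_power xc g)
  have "f \<in> Q" if "x ^ n * f \<in> Q" "f \<in> poly_carrier d" for n f
    using that(1)
  proof (induction n)
    case (Suc n)
    then have "x \<otimes>\<^bsub>poly_ring d\<^esub> (x ^ n * f) \<in> Q" by (simp add: mult.assoc)
    then have "x ^ n * f \<in> Q" using Q.I_prime[of x "x ^ n * f"] x(2) xc that(2) by auto
    then show ?case by (rule Suc.IH)
  qed simp
  from this[OF in_Q] have "g m + x * r \<in> Q'" using g xc rc Q'(2) by auto
  then have "g m + x * r - x * r \<in> Q'" by (rule QI(7)) (rule QI(5)[OF x(1) rc])
  then show ?thesis using m by auto
qed

context gamma_ring
begin

lemma no_long_prime_chain: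
  assumes Q: "\<And>i. i \<le> 4 \<Longrightarrow> primeideal (Q i) (poly_ring d)" "\<And>i. i < 4 \<Longrightarrow> Q i \<subset> Q (Suc i)"
    and sub: "minor_ideal \<subseteq> Q 0"
  shows False
proof -
  have "\<forall>i. \<exists>x. i < 4 \<longrightarrow> x \<in> Q (Suc i) \<and> x \<notin> Q i" using Q(2) by blast
  from choice[OF this] obtain x where x: "\<And>i. i < 4 \<Longrightarrow> x i \<in> Q (Suc i)" "\<And>i. i < 4 \<Longrightarrow> x i \<notin> Q i"
    by blast
  have xc: "x i \<in> poly_carrier d" if "i < 4" for i
    using poly_ring_idealD(1)[OF primeideal.axioms(1)[OF Q(1)[of "Suc i"]] x(1)[OF that]] that by simp
  have "\<forall>i. \<exists>N. degree_le N (x i)" by (simp add: degree_le_exists)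
  from choice[OF this] obtain b where b: "\<And>i. degree_le (b i) (x i)" by blast
  define e where "e = b 0 + b 1 + b 2 + b 3"
  have e: "degree_le e (x 0)" "degree_le e (x 1)" "degree_le e (x 2)" "degree_le e (x 3)"
    by (rule degree_le_mono[OF b], simp add: e_def)+
  \<comment> \<open>There are K^4 products with exponents below K, of degree at most N = 4eK. Since
    4eK + 1 \<le> (4e + 1) K, the spanning set has at most (4e + 1)^3 d^2 K^3 members, so K must
    exceed (4e + 1)^3 d^2.\<close>
  define K where "K = (4 * e + 1) ^ 3 * (d * d) + 1"
  define N where "N = 4 * (e * K)"
  let ?k = "{..<K}"
  let ?I = "?k \<times> ?k \<times> ?k \<times> ?k"
  define m where "m = (\<lambda>(i, j, k, l). x 0 ^ i * (x 1 ^ j * (x 2 ^ k * x 3 ^ l)))"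
  have "card (indices N) < card ?I"
  proof -
    have "card (indices N) \<le> (N + 1) ^ 3 * (d * d)" by (rule card_indices_le)
    also have "\<dots> \<le> ((4 * e + 1) * K) ^ 3 * (d * d)"
      by (intro mult_right_mono power_mono) (simp_all add: N_def K_def add_mult_distrib)
    also have "\<dots> = ((4 * e + 1) ^ 3 * (d * d)) * K ^ 3" by (simp only: power_mult_distrib mult_ac)
    also have "\<dots> = (K - 1) * K ^ 3" unfolding K_def add_diff_cancel_right' ..
    also have "\<dots> < K * K ^ 3" by (rule mult_strict_right_mono) (simp_all add: K_def)
    also have "\<dots> = card ?I" by (simp add: card_cartesian_product power3_eq_cube)
    finally show ?thesis .
  qed
  have span: "m s \<in> spanned N" if mem: "s \<in> ?I" for s
  proof -
    obtain i j k l where s: "s = (i, j, k, l)" "i < K" "j < K" "k < K" "l < K" using mem by auto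
    have "degree_le (e * i + (e * j + (e * k + e * l))) (m s)"
      unfolding s(1) m_def prod.case by (intro degree_le_mult degree_le_power e)
    moreover have "e * i + (e * j + (e * k + e * l)) \<le> N"
    proof -
      have "e * i \<le> e * K" "e * j \<le> e * K" "e * k \<le> e * K" "e * l \<le> e * K" using s by simp_all
      then show ?thesis unfolding N_def by linarith
    qed
    ultimately have "degree_le N (m s)" by (rule degree_le_mono)
    then show ?thesis using xc by (intro spanned_degree_le) (simp_all add: s m_def)
  qed
  have "\<forall>s\<in>?I. \<exists>u. m s - (\<Sum>t\<in>indices N. constp (u t) * basis_elt t) \<in> minor_ideal"
    using span by (auto simp: spanned_def)
  from bchoice[OF this] obtain u where u: "\<forall>s\<in>?I. m s - (\<Sum>t\<in>indices N. constp (u s t) * basis_elt t) \<in> minor_ideal" ..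
  have finI: "finite ?I" by simp
  obtain c where cc: "(\<exists>s\<in>?I. c s \<noteq> 0) \<and> (\<forall>t\<in>indices N. (\<Sum>s\<in>?I. c s * u s t) = 0)"
    using homogeneous_system_nontrivial_solution[OF finite_indices finI \<open>card (indices N) < card ?I\<close>, of u]
    by (rule exE)
  note c = conjunct1[OF cc] bspec[OF conjunct2[OF cc]]
  have "(\<Sum>s\<in>?I. constp (c s) * (m s - (\<Sum>t\<in>indices N. constp (u s t) * basis_elt t))) \<in> minor_ideal"
    by (intro poly_ring_ideal_sum[OF ideal_minor_ideal] minor_ideal(4)) (use u in auto)
  moreover have "(\<Sum>s\<in>?I. constp (c s) * (\<Sum>t\<in>indices N. constp (u s t) * basis_elt t)) = 0"
  proof -
    have "(\<Sum>s\<in>?I. constp (c s) * (\<Sum>t\<in>indices N. constp (u s t) * basis_elt t))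
      = (\<Sum>t\<in>indices N. \<Sum>s\<in>?I. constp (c s * u s t) * basis_elt t)"
      unfolding sum_distrib_left constp_mult mult.assoc by (rule sum.swap)
    also have "\<dots> = (\<Sum>t\<in>indices N. constp (\<Sum>s\<in>?I. c s * u s t) * basis_elt t)"
      by (simp only: constp.sum sum_distrib_right)
    also have "\<dots> = 0" using c(2) by (intro sum.neutral) simp
    finally show ?thesis .
  qed
  ultimately have rel: "(\<Sum>s\<in>?I. constp (c s) * m s) \<in> Q 0"
    using sub by (auto simp only: right_diff_distrib sum_subtractf diff_0_right)
  \<comment> \<open>The relation is nested as a polynomial in x_0 whose coefficients are polynomials
    in x_1, and so on, so that each step up the chain removes one variable.\<close>
  define c4 where "c4 = (\<lambda>i j k l. constp (c (i, j, k, l)))"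
  define c3 where "c3 = (\<lambda>i j k. \<Sum>l<K. x 3 ^ l * c4 i j k l)"
  define c2 where "c2 = (\<lambda>i j. \<Sum>k<K. x 2 ^ k * c3 i j k)"
  define c1 where "c1 = (\<lambda>i. \<Sum>j<K. x 1 ^ j * c2 i j)"
  have "(\<Sum>s\<in>?I. constp (c s) * m s) = (\<Sum>i<K. x 0 ^ i * c1 i)"
    unfolding c1_def c2_def c3_def c4_def sum_distrib_left
    by (simp add: sum.cartesian_product split_def m_def mult_ac)
  then have rel1: "(\<Sum>i<K. x 0 ^ i * c1 i) \<in> Q 0" using rel by simp
  have cl4: "c4 i j k l \<in> poly_carrier d" for i j k l by (simp add: c4_def)
  have cl3: "c3 i j k \<in> poly_carrier d" for i j k
    unfolding c3_def by (intro poly_carrier_sum poly_carrier_closed(2) poly_carrier_power xc cl4) simp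
  have cl2: "c2 i j \<in> poly_carrier d" for i j
    unfolding c2_def by (intro poly_carrier_sum poly_carrier_closed(2) poly_carrier_power xc cl3) simp
  have cl1: "c1 i \<in> poly_carrier d" for i
    unfolding c1_def by (intro poly_carrier_sum poly_carrier_closed(2) poly_carrier_power xc cl2) simp
  define Z3 where "Z3 = (\<lambda>i j k. \<forall>l<K. c (i, j, k, l) = 0)"
  define Z2 where "Z2 = (\<lambda>i j. \<forall>k<K. Z3 i j k)"
  define Z1 where "Z1 = (\<lambda>i. \<forall>j<K. Z2 i j)"
  have z3: "c3 i j k = 0" if "Z3 i j k" for i j k using that by (simp add: c3_def c4_def Z3_def)
  have z2: "c2 i j = 0" if "Z2 i j" for i j using that z3 by (simp add: c2_def Z2_def)
  have z1: "c1 i = 0" if "Z1 i" for i using that z2 by (simp add: c1_def Z1_def)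
  have sub': "Q i \<subseteq> Q (Suc i)" if "i < 4" for i using Q(2)[OF that] by blast
  have step: "\<exists>j<K. \<not> Z j \<and> g j \<in> Q (Suc n)"
    if "n < 4" "\<And>j. g j \<in> poly_carrier d" "(\<Sum>j<K. x n ^ j * g j) \<in> Q n"
      "\<And>j. Z j \<Longrightarrow> g j = 0" "\<exists>j<K. \<not> Z j" for n g Z
    by (rule prime_chain_step[OF Q(1)[of n] Q(1)[of "Suc n"] sub'[OF that(1)] x(1)[OF that(1)]
          x(2)[OF that(1)] that(2-5)]) (use that(1) in simp_all)
  have "\<exists>i<K. \<not> Z1 i" using c(1) by (force simp: Z1_def Z2_def Z3_def)
  from step[of 0 c1 Z1, OF _ cl1 rel1 z1 this] obtain i where
    i: "\<not> Z1 i" "c1 i \<in> Q 1" by auto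
  have "\<exists>j<K. \<not> Z2 i j" using i(1) by (simp add: Z1_def)
  from step[of 1 "c2 i" "Z2 i", OF _ cl2 i(2)[unfolded c1_def] z2 this] obtain j where
    j: "\<not> Z2 i j" "c2 i j \<in> Q 2" by (auto simp: numeral_2_eq_2)
  have "\<exists>k<K. \<not> Z3 i j k" using j(1) by (simp add: Z2_def)
  from step[of 2 "c3 i j" "Z3 i j", OF _ cl3 j(2)[unfolded c2_def] z3 this] obtain k where
    k: "\<not> Z3 i j k" "c3 i j k \<in> Q 3" by (auto simp: numeral_3_eq_3 numeral_2_eq_2)
  have z4: "c4 i j k l = 0" if "c (i, j, k, l) = 0" for l using that by (simp add: c4_def)
  have "\<exists>l<K. c (i, j, k, l) \<noteq> 0" using k(1) by (simp add: Z3_def)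
  from step[of 3 "c4 i j k" "\<lambda>l. c (i, j, k, l) = 0", OF _ cl4 k(2)[unfolded c3_def] z4 this]
  obtain l where l: "c (i, j, k, l) \<noteq> 0" "c4 i j k l \<in> Q (Suc 3)" by auto
  interpret Q4: primeideal "Q (Suc 3)" "poly_ring d" by (rule Q(1)) simp
  \<comment> \<open>After four steps a nonzero constant lies in the top prime.\<close>
  have "constp (inverse (c (i, j, k, l))) * c4 i j k l \<in> Q (Suc 3)"
    by (rule poly_ring_idealD(4)[OF Q4.is_ideal l(2)]) simp
  then have "1 \<in> Q (Suc 3)" using l(1) by (simp add: c4_def constp_mult[symmetric])
  then show False using Q4.one_imp_carrier Q4.I_notcarr by simp
qed

end

section \<open>The coordinate ring\<close>

lemma zero_FactRing: "\<zero>\<^bsub>R Quot P\<^esub> = P"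
  by (simp add: FactRing_def)

text \<open>Ideals of the quotient correspond to ideals of \<open>R\<close> that contain
  \<open>P\<close>, which lets regularity be checked in \<open>R\<close>.\<close>

lemma mem_genideal_quotient:
  assumes R: "cring R" and P: "ideal P R" and A: "A \<subseteq> carrier R" and r: "r \<in> carrier R"
  shows "P +>\<^bsub>R\<^esub> r \<in> Idl\<^bsub>R Quot P\<^esub> ((+>\<^bsub>R\<^esub>) P ` A) \<longleftrightarrow> r \<in> Idl\<^bsub>R\<^esub> (A \<union> P)"
proof -
  interpret R: cring R by fact
  interpret P: ideal P R by fact
  interpret h: ring_hom_cring R "R Quot P" "(+>\<^bsub>R\<^esub>) P" by (rule P.rcos_ring_hom_cring[OF R])
  have AP: "A \<union> P \<subseteq> carrier R" using A P.a_subset by blast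
  have hA: "(+>\<^bsub>R\<^esub>) P ` A \<subseteq> carrier (R Quot P)" using A by auto
  interpret I: ideal "Idl\<^bsub>R\<^esub> (A \<union> P)" R by (rule R.genideal_ideal[OF AP])
  let ?J = "Idl\<^bsub>R Quot P\<^esub> ((+>\<^bsub>R\<^esub>) P ` A)"
  interpret J: ideal ?J "R Quot P" by (rule h.S.genideal_ideal[OF hA])
  have self: "A \<union> P \<subseteq> Idl\<^bsub>R\<^esub> (A \<union> P)" by (rule R.genideal_self[OF AP])
  show ?thesis
  proof
    assume mem: "P +>\<^bsub>R\<^esub> r \<in> ?J"
    have "?J \<subseteq> (+>\<^bsub>R\<^esub>) P ` (Idl\<^bsub>R\<^esub> (A \<union> P))"
      by (rule h.S.genideal_minimal[OF R.ring_ideal_imp_quot_ideal[OF P I.is_ideal]])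
        (use self in blast)
    then obtain s where s: "s \<in> Idl\<^bsub>R\<^esub> (A \<union> P)" "P +>\<^bsub>R\<^esub> r = P +>\<^bsub>R\<^esub> s" using mem by blast
    have sc: "s \<in> carrier R" by (rule I.Icarr[OF s(1)])
    have "r \<ominus>\<^bsub>R\<^esub> s \<in> P" using R.quotient_eq_iff_same_a_r_cos[OF P r sc] s(2) by simp
    then have "r \<ominus>\<^bsub>R\<^esub> s \<in> Idl\<^bsub>R\<^esub> (A \<union> P)" using self by blast
    from I.a_closed[OF this s(1)] show "r \<in> Idl\<^bsub>R\<^esub> (A \<union> P)"
      using r sc by (simp add: R.minus_eq R.a_assoc R.l_neg)
  next
    assume mem: "r \<in> Idl\<^bsub>R\<^esub> (A \<union> P)"
    have "Idl\<^bsub>R\<^esub> (A \<union> P) \<subseteq> {r \<in> carrier R. P +>\<^bsub>R\<^esub> r \<in> ?J}"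
    proof (rule R.genideal_minimal[OF h.ring.ideal_vimage[OF J.is_ideal]])
      have "P +>\<^bsub>R\<^esub> a \<in> ?J" if "a \<in> A" for a using that h.S.genideal_self[OF hA] by blast
      moreover have "P +>\<^bsub>R\<^esub> p \<in> ?J" if "p \<in> P" for p
      proof -
        have "P +>\<^bsub>R\<^esub> p = P" using that by (rule P.a_rcos_const)
        then show ?thesis using J.zero_closed unfolding zero_FactRing by (rule ssubst)
      qed
      ultimately show "A \<union> P \<subseteq> {r \<in> carrier R. P +>\<^bsub>R\<^esub> r \<in> ?J}" using AP by blast
    qed
    then show "P +>\<^bsub>R\<^esub> r \<in> ?J" using mem by blast
  qed
qed

lemma regular_sequence_quotient:
  assumes R: "cring R" and P: "ideal P R" and xs: "set xs \<subseteq> carrier R"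
    and reg: "\<And>i r. i < length xs \<Longrightarrow> r \<in> carrier R \<Longrightarrow>
      r \<otimes>\<^bsub>R\<^esub> xs ! i \<in> Idl\<^bsub>R\<^esub> (set (take i xs) \<union> P) \<Longrightarrow> r \<in> Idl\<^bsub>R\<^esub> (set (take i xs) \<union> P)"
    and proper: "\<one>\<^bsub>R\<^esub> \<notin> Idl\<^bsub>R\<^esub> (set xs \<union> P)"
  shows "regular_sequence (R Quot P) (map ((+>\<^bsub>R\<^esub>) P) xs)"
proof -
  interpret R: cring R by fact
  interpret P: ideal P R by fact
  interpret h: ring_hom_cring R "R Quot P" "(+>\<^bsub>R\<^esub>) P" by (rule P.rcos_ring_hom_cring[OF R])
  have sub: "set (take j xs) \<subseteq> carrier R" for j using xs set_take_subset by fastforce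
  have take: "set (take i (map ((+>\<^bsub>R\<^esub>) P) xs)) = (+>\<^bsub>R\<^esub>) P ` set (take i xs)" for i by (simp add: take_map)
  show ?thesis
    unfolding regular_sequence_def
  proof (intro conjI allI impI ballI)
    show "set (map ((+>\<^bsub>R\<^esub>) P) xs) \<subseteq> carrier (R Quot P)" using xs by auto
    fix i X assume i: "i < length (map ((+>\<^bsub>R\<^esub>) P) xs)" and X: "X \<in> carrier (R Quot P)"
      and *: "X \<otimes>\<^bsub>R Quot P\<^esub> map ((+>\<^bsub>R\<^esub>) P) xs ! i \<in> Idl\<^bsub>R Quot P\<^esub> (set (take i (map ((+>\<^bsub>R\<^esub>) P) xs)))"
    from X obtain r where r: "r \<in> carrier R" "X = P +>\<^bsub>R\<^esub> r"
      unfolding FactRing_def A_RCOSETS_def' by auto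
    have xi: "xs ! i \<in> carrier R" using xs i by auto
    have "X \<otimes>\<^bsub>R Quot P\<^esub> map ((+>\<^bsub>R\<^esub>) P) xs ! i = P +>\<^bsub>R\<^esub> (r \<otimes>\<^bsub>R\<^esub> xs ! i)"
      using i xi r by simp
    then have "r \<otimes>\<^bsub>R\<^esub> xs ! i \<in> Idl\<^bsub>R\<^esub> (set (take i xs) \<union> P)"
      using * mem_genideal_quotient[OF R P sub, of "r \<otimes>\<^bsub>R\<^esub> xs ! i" i] r xi unfolding take by simp
    then have "r \<in> Idl\<^bsub>R\<^esub> (set (take i xs) \<union> P)" using reg[of i r] i r by simp
    then show "X \<in> Idl\<^bsub>R Quot P\<^esub> (set (take i (map ((+>\<^bsub>R\<^esub>) P) xs)))"
      unfolding take r(2) using mem_genideal_quotient[OF R P sub r(1)] by blast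
  next
    show "Idl\<^bsub>R Quot P\<^esub> (set (map ((+>\<^bsub>R\<^esub>) P) xs)) \<noteq> carrier (R Quot P)"
    proof
      assume "Idl\<^bsub>R Quot P\<^esub> (set (map ((+>\<^bsub>R\<^esub>) P) xs)) = carrier (R Quot P)"
      then have "P +>\<^bsub>R\<^esub> \<one>\<^bsub>R\<^esub> \<in> Idl\<^bsub>R Quot P\<^esub> ((+>\<^bsub>R\<^esub>) P ` set xs)"
        using h.hom_closed[OF R.one_closed] unfolding set_map by blast
      then show False using mem_genideal_quotient[OF R P xs R.one_closed] proper by blast
    qed
  qed
qed

lemma (in ring_hom_cring) hom_mult_minus_one:
  "x \<in> carrier R \<Longrightarrow> y \<in> carrier R \<Longrightarrow>
    h (x \<otimes>\<^bsub>R\<^esub> y \<ominus>\<^bsub>R\<^esub> \<one>\<^bsub>R\<^esub>) = h x \<otimes>\<^bsub>S\<^esub> h y \<ominus>\<^bsub>S\<^esub> \<one>\<^bsub>S\<^esub>"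
  by (simp add: R.minus_eq S.minus_eq)

text \<open>By maximality the ideal M + (x) contains 1.\<close>

lemma maximalideal_inverse:
  assumes R: "cring R" and M: "maximalideal M R" and x: "x \<in> carrier R" "x \<notin> M"
  shows "\<exists>y\<in>carrier R. x \<otimes>\<^bsub>R\<^esub> y \<ominus>\<^bsub>R\<^esub> \<one>\<^bsub>R\<^esub> \<in> M"
proof -
  interpret R: cring R by fact
  interpret M: maximalideal M R by fact
  let ?J = "set_add R M (PIdl\<^bsub>R\<^esub> x)"
  note mem = R.mem_add_principal[OF M.is_ideal x(1)]
  have J: "ideal ?J R" by (intro R.add_ideals M.is_ideal R.cgenideal_ideal x)
  have "M \<subseteq> ?J"
  proof
    fix q assume q: "q \<in> M"
    show "q \<in> ?J" unfolding mem
      using q x M.Icarr[OF q] by (intro bexI[of _ q] bexI[of _ "\<zero>\<^bsub>R\<^esub>"]) auto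
  qed
  moreover have "x \<in> ?J" unfolding mem
    using x by (intro bexI[of _ "\<zero>\<^bsub>R\<^esub>"] bexI[of _ "\<one>\<^bsub>R\<^esub>"]) auto
  moreover have "?J \<subseteq> carrier R" by (rule additive_subgroup.a_subset[OF ideal.axioms(1)[OF J]])
  ultimately have "?J = carrier R" using M.I_maximal[OF J] x(2) by blast
  then have "\<one>\<^bsub>R\<^esub> \<in> ?J" by simp
  then obtain q y where qy: "q \<in> M" "y \<in> carrier R" "\<one>\<^bsub>R\<^esub> = q \<oplus>\<^bsub>R\<^esub> y \<otimes>\<^bsub>R\<^esub> x" unfolding mem by blast
  have q: "q \<in> carrier R" by (rule M.Icarr[OF qy(1)])
  have "x \<otimes>\<^bsub>R\<^esub> y \<ominus>\<^bsub>R\<^esub> \<one>\<^bsub>R\<^esub> = x \<otimes>\<^bsub>R\<^esub> y \<ominus>\<^bsub>R\<^esub> (q \<oplus>\<^bsub>R\<^esub> y \<otimes>\<^bsub>R\<^esub> x)" using qy(3) by simp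
  also have "\<dots> = \<ominus>\<^bsub>R\<^esub> q"
    using x(1) qy(2) q by (simp add: R.minus_eq R.minus_add R.m_comm[of y x] R.a_lcomm R.r_neg)
  also have "\<dots> \<in> M" using qy(1) by simp
  finally show ?thesis using qy(2) by blast
qed

context gamma_ring
begin

abbreviation coordinate_ring where "coordinate_ring \<equiv> poly_ring d Quot minor_ideal"
abbreviation coset where "coset \<equiv> (+>\<^bsub>poly_ring d\<^esub>) minor_ideal"

lemma mem_genideal_two:
  assumes a: "a \<in> poly_carrier d" and b: "b \<in> poly_carrier d"
  shows "f \<in> Idl\<^bsub>poly_ring d\<^esub> ({a, b} \<union> minor_ideal) \<longleftrightarrow>
    f \<in> poly_carrier d \<and> (\<exists>g\<in>poly_carrier d. \<exists>h\<in>poly_carrier d. f - (g * a + h * b) \<in> minor_ideal)"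
proof -
  interpret R: cring "poly_ring d" by (rule cring_poly_ring)
  have sub: "{a, b} \<union> minor_ideal \<subseteq> poly_carrier d" using a b minor_ideal(1) by blast
  let ?I = "Idl\<^bsub>poly_ring d\<^esub> ({a, b} \<union> minor_ideal)"
  note I = poly_ring_idealD[OF R.genideal_ideal[OF sub]]
  have self: "{a, b} \<union> minor_ideal \<subseteq> ?I" by (rule R.genideal_self[OF sub])
  let ?E = "{f \<in> poly_carrier d. \<exists>g\<in>poly_carrier d. \<exists>h\<in>poly_carrier d. f - (g * a + h * b) \<in> minor_ideal}"
  have mem: "f \<in> ?E" if "f \<in> poly_carrier d" "g \<in> poly_carrier d" "h \<in> poly_carrier d"
    "f - (g * a + h * b) \<in> minor_ideal" for f g h
    using that by blast
  have "ideal ?E (poly_ring d)"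
    unfolding poly_ring_ideal_iff
  proof (intro conjI ballI)
    show "?E \<subseteq> poly_carrier d" by blast
    show "0 \<in> ?E" using minor_ideal(2) by (intro mem[of 0 0 0]) simp_all
    fix f assume "f \<in> ?E"
    then obtain g h where f: "f \<in> poly_carrier d" "g \<in> poly_carrier d" "h \<in> poly_carrier d"
      "f - (g * a + h * b) \<in> minor_ideal" by blast
    {
      fix f' assume "f' \<in> ?E"
      then obtain g' h' where f': "f' \<in> poly_carrier d" "g' \<in> poly_carrier d" "h' \<in> poly_carrier d"
        "f' - (g' * a + h' * b) \<in> minor_ideal" by blast
      have "f + f' - ((g + g') * a + (h + h') * b) = (f - (g * a + h * b)) + (f' - (g' * a + h' * b))"
        by (simp add: algebra_simps)
      also have "\<dots> \<in> minor_ideal" by (rule minor_ideal(3)[OF f(4) f'(4)])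
      finally show "f + f' \<in> ?E" using f f' by (intro mem[of _ "g + g'" "h + h'"]) simp_all
    next
      fix r assume r: "r \<in> poly_carrier d"
      have "r * f - ((r * g) * a + (r * h) * b) = r * (f - (g * a + h * b))"
        by (simp add: algebra_simps)
      also have "\<dots> \<in> minor_ideal" by (rule minor_ideal(4)[OF f(4) r])
      finally show "r * f \<in> ?E" using f r by (intro mem[of _ "r * g" "r * h"]) simp_all
    }
  qed
  moreover have "{a, b} \<union> minor_ideal \<subseteq> ?E"
  proof -
    have "a \<in> ?E" using a minor_ideal(2) by (intro mem[of _ 1 0]) simp_all
    moreover have "b \<in> ?E" using b minor_ideal(2) by (intro mem[of _ 0 1]) simp_all
    moreover have "f \<in> ?E" if "f \<in> minor_ideal" for f
      using that minor_ideal(1) by (intro mem[of _ 0 0]) simp_all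
    ultimately show ?thesis by blast
  qed
  ultimately have "?I \<subseteq> ?E" by (rule R.genideal_minimal)
  moreover have "f \<in> ?I" if "g \<in> poly_carrier d" "h \<in> poly_carrier d" "f - (g * a + h * b) \<in> minor_ideal" for g h
  proof -
    have "f - (g * a + h * b) + (g * a + h * b) \<in> ?I"
      by (intro I(3,4)) (use self that in auto)
    then show ?thesis by simp
  qed
  ultimately show ?thesis by blast
qed

text \<open>On the cone m_0 equals the scale factor, which can be chosen different from 0 and
  \<alpha>.\<close>

lemma var_0_diff_notin: "var 0 - constp \<alpha> \<notin> gamma_ideal"
proof -
  define c :: complex where "c = (if \<alpha> = 1 then 2 else 1)"
  have c: "c \<noteq> 0" "c \<noteq> \<alpha>" by (auto simp: c_def)
  then have "eval_cpoly (var 0 - constp \<alpha>) (gamma_point c 0 0) \<noteq> 0"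
    by (simp add: gamma_point_def gamma_moment_def)
  then show ?thesis using c(1) by (auto simp: gamma_ideal_def)
qed

text \<open>The first member is a nonzerodivisor because the coordinate ring is a domain, the other
  two because of freeness.\<close>

lemma regular_sequence_coordinate_ring:
  assumes proper: "1 \<notin> Idl\<^bsub>poly_ring d\<^esub> (set [var 0 - constp \<alpha>, var d - constp \<beta>, lin - constp \<gamma>] \<union> minor_ideal)"
  shows "regular_sequence coordinate_ring (map coset [var 0 - constp \<alpha>, var d - constp \<beta>, lin - constp \<gamma>])"
proof (rule regular_sequence_quotient[OF cring_poly_ring ideal_minor_ideal])
  let ?a = "var 0 - constp \<alpha>" and ?b = "var d - constp \<beta>" and ?c = "lin - constp \<gamma>"
  have cl: "?a \<in> poly_carrier d" "?b \<in> poly_carrier d" "?c \<in> poly_carrier d" by simp_all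
  show "set [?a, ?b, ?c] \<subseteq> poly_carrier d" using cl by simp
  show "\<one>\<^bsub>poly_ring d\<^esub> \<notin> Idl\<^bsub>poly_ring d\<^esub> (set [?a, ?b, ?c] \<union> minor_ideal)" using proper by simp
  interpret R: cring "poly_ring d" by (rule cring_poly_ring)
  interpret G: primeideal minor_ideal "poly_ring d"
    using primeideal_gamma_ideal unfolding gamma_ideal_eq .
  have self: "Idl\<^bsub>poly_ring d\<^esub> minor_ideal = minor_ideal"
    using R.genideal_minimal[OF ideal_minor_ideal order_refl] R.genideal_self[OF G.a_subset] by blast
  fix i f assume i: "i < length [?a, ?b, ?c]" and f: "f \<in> poly_carrier d"
    and *: "f \<otimes>\<^bsub>poly_ring d\<^esub> [?a, ?b, ?c] ! i \<in> Idl\<^bsub>poly_ring d\<^esub> (set (take i [?a, ?b, ?c]) \<union> minor_ideal)"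
  consider "i = 0" | "i = 1" | "i = 2" using i by fastforce
  then show "f \<in> Idl\<^bsub>poly_ring d\<^esub> (set (take i [?a, ?b, ?c]) \<union> minor_ideal)"
  proof cases
    case 1
    then have "f * ?a \<in> minor_ideal" using * by (simp add: self)
    then have "f \<in> minor_ideal"
      using G.I_prime[OF f cl(1)] var_0_diff_notin[of \<alpha>] by (simp add: gamma_ideal_eq)
    then show ?thesis using 1 by (simp add: self)
  next
    case 2
    \<comment> \<open>The single generator is listed twice so that \<open>mem_genideal_two\<close>
      applies; its two multipliers are added.\<close>
    have take: "set (take i [?a, ?b, ?c]) = {?a, ?a}" using 2 by simp
    have "f * ?b \<in> Idl\<^bsub>poly_ring d\<^esub> ({?a, ?a} \<union> minor_ideal)" using * unfolding take using 2 by simp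
    then obtain g h where gh: "g \<in> poly_carrier d" "h \<in> poly_carrier d" "f * ?b - (g * ?a + h * ?a) \<in> minor_ideal"
      unfolding mem_genideal_two[OF cl(1) cl(1)] by blast
    have "f * ?b - (g * ?a + h * ?a) = ?b * f - ?a * (g + h)" by (simp only: algebra_simps)
    with gh(3) have "?b * f - ?a * (g + h) \<in> minor_ideal" by (rule back_subst)
    then obtain k where k: "k \<in> poly_carrier d" "f - ?a * k \<in> minor_ideal"
      using nonzerodivisor_var_d[OF f poly_carrier_closed(1)[OF gh(1,2)]] by blast
    have "f - ?a * k = f - (k * ?a + 0 * ?a)" by (simp add: mult.commute)
    with k(2) have "f - (k * ?a + 0 * ?a) \<in> minor_ideal" by (rule back_subst)
    then show ?thesis unfolding take mem_genideal_two[OF cl(1) cl(1)]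
      using f k(1) poly_carrier_closed(3) by blast
  next
    case 3
    have take: "set (take i [?a, ?b, ?c]) = {?a, ?b}" using 3 by simp
    have "f * ?c \<in> Idl\<^bsub>poly_ring d\<^esub> ({?a, ?b} \<union> minor_ideal)" using * unfolding take using 3 by simp
    then obtain g h where gh: "g \<in> poly_carrier d" "h \<in> poly_carrier d" "?c * f - (g * ?a + h * ?b) \<in> minor_ideal"
      unfolding mem_genideal_two[OF cl(1,2)] mult.commute[of f] by blast
    from nonzerodivisor_lin[OF f gh] show ?thesis
      unfolding take mem_genideal_two[OF cl(1,2)] using f by blast
  qed
qed

lemma krull_dim_coordinate_ring: "krull_dim coordinate_ring \<le> enat 3"
  unfolding krull_dim_def
proof (rule Sup_least)
  interpret h: extension_hom "poly_ring d" coordinate_ring coset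
    by (rule extension_hom_quotient[OF cring_poly_ring ideal_minor_ideal])
  fix e assume "e \<in> {enat n |n. \<exists>P :: nat \<Rightarrow> cpoly set set.
     (\<forall>i\<le>n. primeideal (P i) coordinate_ring) \<and> (\<forall>i<n. P i \<subset> P (Suc i))}"
  then obtain n and P :: "nat \<Rightarrow> cpoly set set" where e: "e = enat n"
    and P: "\<And>i. i \<le> n \<Longrightarrow> primeideal (P i) coordinate_ring" "\<And>i. i < n \<Longrightarrow> P i \<subset> P (Suc i)"
    by blast
  have "n \<le> 3"
  proof (rule ccontr)
    assume "\<not> n \<le> 3"
    then have n: "4 \<le> n" by simp
    let ?Q = "\<lambda>i. {f \<in> poly_carrier d. coset f \<in> P i}"
    have "minor_ideal \<subseteq> ?Q 0"
    proof
      interpret P0: primeideal "P 0" coordinate_ring by (rule P(1)) simp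
      fix f assume f: "f \<in> minor_ideal"
      have "coset f = minor_ideal" by (rule abelian_subgroup.a_rcos_const[OF abelian_subgroupI3 f])
        (use ideal_minor_ideal h.R.is_abelian_group in \<open>auto intro: ideal.axioms(1)\<close>)
      then have "coset f \<in> P 0" using P0.zero_closed unfolding zero_FactRing by (rule ssubst)
      then show "f \<in> ?Q 0" using minor_ideal(1)[OF f] by blast
    qed
    moreover have "primeideal (?Q i) (poly_ring d)" if "i \<le> 4" for i
      by (rule h.preimage_primeideal) (use P(1) that n in simp)
    moreover have "?Q i \<subset> ?Q (Suc i)" if "i < 4" for i
      by (rule h.preimage_strict_mono) (use P that n in \<open>auto intro: primeideal.axioms(1)\<close>)
    ultimately show False using no_long_prime_chain[of ?Q] by blast
  qed
  then show "e \<le> enat 3" by (simp add: e)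
qed

theorem cohen_macaulay_coordinate_ring: "cohen_macaulay_ring coordinate_ring"
proof -
  interpret h: extension_hom "poly_ring d" coordinate_ring coset
    by (rule extension_hom_quotient[OF cring_poly_ring ideal_minor_ideal])
  show ?thesis
  proof (rule cohen_macaulay_ringI[OF h.S.is_cring h.noetherian[OF noetherian_poly_ring] krull_dim_coordinate_ring])
    fix M assume M: "maximalideal M coordinate_ring"
    interpret M: primeideal M coordinate_ring by (rule h.S.maximalideal_prime[OF M])
    define M0 where "M0 = {f \<in> poly_carrier d. coset f \<in> M}"
    have prime: "primeideal M0 (poly_ring d)"
      unfolding M0_def by (rule h.preimage_primeideal[OF M.primeideal])
    interpret M0: primeideal M0 "poly_ring d" by (rule prime)
    \<comment> \<open>Inverses modulo the maximal ideal \<open>M\<close> of the quotient are lifted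
      to inverses modulo its preimage, as the weak Nullstellensatz requires.\<close>
    have inv: "\<exists>g\<in>poly_carrier d. f * g - 1 \<in> M0" if f: "f \<in> poly_carrier d" "f \<notin> M0" for f
    proof -
      have "coset f \<in> carrier coordinate_ring" by (rule h.hom_closed[OF f(1)])
      moreover have "coset f \<notin> M" using f unfolding M0_def by blast
      ultimately obtain Y where
        Y: "Y \<in> carrier coordinate_ring" "coset f \<otimes>\<^bsub>coordinate_ring\<^esub> Y \<ominus>\<^bsub>coordinate_ring\<^esub> \<one>\<^bsub>coordinate_ring\<^esub> \<in> M"
        using maximalideal_inverse[OF h.S.is_cring M] by blast
      have "carrier coordinate_ring = a_rcosets\<^bsub>poly_ring d\<^esub> minor_ideal" by (simp add: FactRing_def)
      with Y(1) have "Y \<in> a_rcosets\<^bsub>poly_ring d\<^esub> minor_ideal" by (rule back_subst)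
      then obtain g where g: "g \<in> poly_carrier d" "Y = coset g"
        unfolding A_RCOSETS_def' by blast
      have "coset (f * g \<ominus>\<^bsub>poly_ring d\<^esub> 1)
        = coset f \<otimes>\<^bsub>coordinate_ring\<^esub> Y \<ominus>\<^bsub>coordinate_ring\<^esub> \<one>\<^bsub>coordinate_ring\<^esub>"
        using h.hom_mult_minus_one[OF f(1) g(1)] unfolding g(2) poly_ring_simps .
      then have "coset (f * g - 1) \<in> M" using Y(2) f(1) g(1) by (simp add: poly_ring_minus)
      moreover have "f * g - 1 \<in> poly_carrier d" using f(1) g(1) by simp
      ultimately have "f * g - 1 \<in> M0" unfolding M0_def by blast
      then show ?thesis using g(1) by (rule bexI)
    qed
    have le0: "0 \<le> d" by simp
    obtain \<alpha> where \<alpha>: "var 0 - constp \<alpha> \<in> M0"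
      using maximal_ideal_contains_linear[OF prime inv poly_carrier_var[OF le0]] by blast
    obtain \<beta> where \<beta>: "var d - constp \<beta> \<in> M0"
      using maximal_ideal_contains_linear[OF prime inv poly_carrier_var[OF order_refl]] by blast
    obtain \<gamma> where \<gamma>: "lin - constp \<gamma> \<in> M0"
      using maximal_ideal_contains_linear[OF prime inv lin_closed] by blast
    let ?xs = "[var 0 - constp \<alpha>, var d - constp \<beta>, lin - constp \<gamma>]"
    have "minor_ideal \<subseteq> M0"
    proof
      fix f assume f: "f \<in> minor_ideal"
      have "coset f = minor_ideal" by (rule abelian_subgroup.a_rcos_const[OF abelian_subgroupI3 f])
        (use ideal_minor_ideal h.R.is_abelian_group in \<open>auto intro: ideal.axioms(1)\<close>)
      then have "coset f \<in> M" using M.zero_closed unfolding zero_FactRing by (rule ssubst)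
      then show "f \<in> M0" using minor_ideal(1)[OF f] unfolding M0_def by blast
    qed
    then have "Idl\<^bsub>poly_ring d\<^esub> (set ?xs \<union> minor_ideal) \<subseteq> M0"
      by (intro h.R.genideal_minimal[OF M0.is_ideal]) (use \<alpha> \<beta> \<gamma> in simp)
    moreover have "1 \<notin> M0" using M0.one_imp_carrier M0.I_notcarr by (simp only: poly_ring_simps) blast
    ultimately have "regular_sequence coordinate_ring (map coset ?xs)"
      by (intro regular_sequence_coordinate_ring) blast
    moreover have "set (map coset ?xs) \<subseteq> M"
      using \<alpha> \<beta> \<gamma> unfolding M0_def list.map list.set by blast
    moreover have "length (map coset ?xs) = 3" by simp
    ultimately show "\<exists>xs. regular_sequence coordinate_ring xs \<and> set xs \<subseteq> M \<and> length xs = 3"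
      by blast
  qed
qed

end

theorem theorem4p1:
  fixes d :: nat
  assumes "d \<ge> 3"
  shows "primeideal (vanishing_ideal d (gamma_moment_variety d)) (poly_ring d) \<and>
         vanishing_ideal d (gamma_moment_variety d)
           = Idl\<^bsub>poly_ring d\<^esub> (maximal_minors (gamma_matrix d)) \<and>
         card (maximal_minors (gamma_matrix d)) = d choose 3 \<and>
         (\<forall>f\<in>maximal_minors (gamma_matrix d). f \<noteq> 0 \<and> homogeneous 3 f) \<and>
         cohen_macaulay_variety d (gamma_moment_variety d)"
proof -
  interpret gamma_ring d by unfold_locales (rule assms)
  have "\<forall>f\<in>maximal_minors (gamma_matrix d). f \<noteq> 0 \<and> homogeneous 3 f"
    using gamma_minor_nonzero gamma_minor_homogeneous by (auto simp: maximal_minors_gamma_matrix)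
  then show ?thesis
    using primeideal_gamma_ideal cohen_macaulay_coordinate_ring card_maximal_minors_gamma_matrix
    by (simp add: cohen_macaulay_variety_def vanishing_ideal_eq gamma_ideal_eq minor_ideal_def)
qed

end
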